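(* Assume $K<\infty$. Let $\varepsilon_n\to0$ and $(u_n,\gamma_n)\in L^1(a,b)\times\mathcal M(a,b)$ with $E_{\varepsilon_n}(u_n,\gamma_n)\le C_0$ for all $n$, for some constant $C_0>0$. Then there exist $u\in BV(a,b)$ with $\|u\|_{L^\infty(a,b)}\le K$ and $\gamma\in\mathcal M(a,b)$ such that, along a subsequence, $u_n\to u$ in $L^1(a,b)$ and $\gamma_n\to\gamma$ in $W^{-1,q}(a,b)$ for every $1<q<\infty$, in particular in the flat norm. Moreover, writing $\gamma=\gamma^s+g\mathcal L^1$ (Lebesgue decomposition), one has $\gamma^s=D^su$ and $u'-g\in L^2(a,b)$.
   Context: Fix $0<a<b<\infty$, $c_0>0$, $K\in(0,\infty)$. $f(t)=c_0\min\{t,1\}$ for $t\ge0$. $I_\varepsilon(x)=(x-\varepsilon,x+\varepsilon)$, $\fint_Bh=\frac1{|B|}\int_Bh$. $\mathcal M(a,b)$ = finite signed Radon measures on $(a,b)$; $W^{-1,q}(a,b)$ is the dual of $W^{1,q'}_0(a,b)$, measures being viewed as elements via $\varphi\mapsto\int\varphi\,d\mu$; the flat norm is $\|\mu\|_{\rm flat}=\sup\{\int\varphi\,d\mu:\varphi\in W^{1,\infty}_0(a,b),\|\varphi\|_{W^{1,\infty}}\le1\}$. For $u\in BV(a,b)$, $Du=u'\mathcal L^1+D^su$. $E_\varepsilon(u,\gamma)=\int_a^b|u'-g|^2dx+\frac1\varepsilon\int_a^bf\big(\varepsilon\fint_{I_\varepsilon(x)\cap(a,b)}|g|dt\big)dx$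 if $u\in W^{1,1}(a,b)$, $\|u\|_{L^\infty}\le K$, $\gamma=g\mathcal L^1$ with $g\in L^1(a,b)$, $u'-g\in L^2(a,b)$; $+\infty$ otherwise. *)

theory Defs
  imports "HOL-Analysis.Analysis"
begin

text \<open>A finite signed (Radon) measure on the open interval (a,b) is represented by a pair
  (P,N) of finite Borel measures on (a,b); the signed measure is A \<mapsto> P A - N A.
  (On an interval of the real line, every finite signed Borel measure is Radon and has
  such a representation, e.g. its Jordan decomposition.)\<close>

type_synonym smeasure = "real measure \<times> real measure"

definition finite_smeasure :: "real \<Rightarrow> real \<Rightarrow> smeasure \<Rightarrow> bool" where
  "finite_smeasure a b \<gamma> \<longleftrightarrow>
     finite_measure (fst \<gamma>) \<and> finite_measure (snd \<gamma>) \<and>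
     sets (fst \<gamma>) = sets (restrict_space borel {a<..<b}) \<and>
     sets (snd \<gamma>) = sets (restrict_space borel {a<..<b})"

definition sval :: "smeasure \<Rightarrow> real set \<Rightarrow> real" where
  "sval \<gamma> A = measure (fst \<gamma>) A - measure (snd \<gamma>) A"

definition sint :: "smeasure \<Rightarrow> (real \<Rightarrow> real) \<Rightarrow> real" where
  "sint \<gamma> \<phi> = (\<integral>x. \<phi> x \<partial>(fst \<gamma>)) - (\<integral>x. \<phi> x \<partial>(snd \<gamma>))"

definition has_density :: "real \<Rightarrow> real \<Rightarrow> smeasure \<Rightarrow> (real \<Rightarrow> real) \<Rightarrow> bool" where
  "has_density a b \<gamma> g \<longleftrightarrow>
     set_integrable lborel {a<..<b} g \<and>
     (\<forall>A \<in> sets borel. A \<subseteq> {a<..<b} \<longrightarrow> sval \<gamma> A = (LINT x:A|lborel. g x))"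

definition lebesgue_decomp ::
  "real \<Rightarrow> real \<Rightarrow> smeasure \<Rightarrow> smeasure \<Rightarrow> (real \<Rightarrow> real) \<Rightarrow> bool" where
  "lebesgue_decomp a b \<gamma> \<gamma>s g \<longleftrightarrow>
     finite_smeasure a b \<gamma>s \<and> set_integrable lborel {a<..<b} g \<and>
     (\<forall>A \<in> sets borel. A \<subseteq> {a<..<b} \<longrightarrow>
        sval \<gamma> A = sval \<gamma>s A + (LINT x:A|lborel. g x)) \<and>
     (\<exists>N \<in> sets borel. N \<subseteq> {a<..<b} \<and> emeasure lborel N = 0 \<and>
        (\<forall>A \<in> sets borel. A \<subseteq> {a<..<b} - N \<longrightarrow> sval \<gamma>s A = 0))"

definition Cc1 :: "real \<Rightarrow> real \<Rightarrow> (real \<Rightarrow> real) \<Rightarrow> bool" where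
  "Cc1 a b \<phi> \<longleftrightarrow> \<phi> C1_differentiable_on UNIV \<and>
     (\<exists>c d. a < c \<and> c \<le> d \<and> d < b \<and> (\<forall>x. x \<notin> {c..d} \<longrightarrow> \<phi> x = 0))"

definition weak_deriv :: "real \<Rightarrow> real \<Rightarrow> (real \<Rightarrow> real) \<Rightarrow> (real \<Rightarrow> real) \<Rightarrow> bool" where
  "weak_deriv a b u v \<longleftrightarrow>
     set_integrable lborel {a<..<b} u \<and> set_integrable lborel {a<..<b} v \<and>
     (\<forall>\<phi>. Cc1 a b \<phi> \<longrightarrow>
        (LINT x:{a<..<b}|lborel. u x * deriv \<phi> x) = - (LINT x:{a<..<b}|lborel. v x * \<phi> x))"

definition BV_deriv :: "real \<Rightarrow> real \<Rightarrow> (real \<Rightarrow> real) \<Rightarrow> smeasure \<Rightarrow> bool" where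
  "BV_deriv a b u Du \<longleftrightarrow>
     finite_smeasure a b Du \<and>
     (\<forall>\<phi>. Cc1 a b \<phi> \<longrightarrow> (LINT x:{a<..<b}|lborel. u x * deriv \<phi> x) = - sint Du \<phi>)"

definition BV :: "real \<Rightarrow> real \<Rightarrow> (real \<Rightarrow> real) \<Rightarrow> bool" where
  "BV a b u \<longleftrightarrow> set_integrable lborel {a<..<b} u \<and> (\<exists>Du. BV_deriv a b u Du)"

definition Linf_bound :: "real \<Rightarrow> real \<Rightarrow> real \<Rightarrow> (real \<Rightarrow> real) \<Rightarrow> bool" where
  "Linf_bound a b K u \<longleftrightarrow> (AE x in lborel. x \<in> {a<..<b} \<longrightarrow> \<bar>u x\<bar> \<le> K)"

text \<open>Unit ball of W^{1,p}_0(a,b), 1<p<\<infinity>: in one dimension, \<phi> \<in> W^{1,p}_0(a,b)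
  iff \<phi>(x) = \<integral>_a^x \<psi> with \<psi> \<in> L^p(a,b) and \<integral>_a^b \<psi> = 0 (\<psi> = \<phi>').
  Norm: (\<parallel>\<phi>\<parallel>_p^p + \<parallel>\<phi>'\<parallel>_p^p)^{1/p}.\<close>
definition W1p0_ball :: "real \<Rightarrow> real \<Rightarrow> real \<Rightarrow> (real \<Rightarrow> real) \<Rightarrow> bool" where
  "W1p0_ball a b p \<phi> \<longleftrightarrow>
     (\<exists>\<psi>. set_integrable lborel {a<..<b} \<psi> \<and>
          set_integrable lborel {a<..<b} (\<lambda>x. \<bar>\<psi> x\<bar> powr p) \<and>
          (LINT x:{a<..<b}|lborel. \<psi> x) = 0 \<and>
          (\<forall>x \<in> {a<..<b}. \<phi> x = (LINT t:{a<..x}|lborel. \<psi> t)) \<and>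
          (LINT x:{a<..<b}|lborel. \<bar>\<phi> x\<bar> powr p) +
            (LINT x:{a<..<b}|lborel. \<bar>\<psi> x\<bar> powr p) \<le> 1)"

definition conv_Wm1q :: "real \<Rightarrow> real \<Rightarrow> real \<Rightarrow> (nat \<Rightarrow> smeasure) \<Rightarrow> smeasure \<Rightarrow> bool" where
  "conv_Wm1q a b q \<gamma>s \<gamma> \<longleftrightarrow>
     (\<forall>e>0. eventually (\<lambda>n. \<forall>\<phi>. W1p0_ball a b (q / (q - 1)) \<phi> \<longrightarrow>
                 \<bar>sint (\<gamma>s n) \<phi> - sint \<gamma> \<phi>\<bar> \<le> e) sequentially)"

text \<open>Unit ball of W^{1,\<infinity>}_0(a,b) with norm max(\<parallel>\<phi>\<parallel>_\<infinity>, \<parallel>\<phi>'\<parallel>_\<infinity>):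
  1-Lipschitz functions on [a,b] vanishing at a and b, bounded by 1.\<close>
definition W1inf0_ball :: "real \<Rightarrow> real \<Rightarrow> (real \<Rightarrow> real) \<Rightarrow> bool" where
  "W1inf0_ball a b \<phi> \<longleftrightarrow>
     \<phi> a = 0 \<and> \<phi> b = 0 \<and> (\<forall>x\<in>{a..b}. \<bar>\<phi> x\<bar> \<le> 1) \<and>
     (\<forall>x\<in>{a..b}. \<forall>y\<in>{a..b}. \<bar>\<phi> x - \<phi> y\<bar> \<le> \<bar>x - y\<bar>)"

definition conv_flat :: "real \<Rightarrow> real \<Rightarrow> (nat \<Rightarrow> smeasure) \<Rightarrow> smeasure \<Rightarrow> bool" where
  "conv_flat a b \<gamma>s \<gamma> \<longleftrightarrow>
     (\<forall>e>0. eventually (\<lambda>n. \<forall>\<phi>. W1inf0_ball a b \<phi> \<longrightarrow>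
                 \<bar>sint (\<gamma>s n) \<phi> - sint \<gamma> \<phi>\<bar> \<le> e) sequentially)"

definition fcut :: "real \<Rightarrow> real \<Rightarrow> real" where
  "fcut c0 t = c0 * min t 1"

definition avg_abs :: "real \<Rightarrow> real \<Rightarrow> real \<Rightarrow> (real \<Rightarrow> real) \<Rightarrow> real \<Rightarrow> real" where
  "avg_abs a b \<epsilon> g x =
     (LINT t:({x-\<epsilon><..<x+\<epsilon>} \<inter> {a<..<b})|lborel. \<bar>g t\<bar>) /
       measure lborel ({x-\<epsilon><..<x+\<epsilon>} \<inter> {a<..<b})"

definition admissible ::
  "real \<Rightarrow> real \<Rightarrow> real \<Rightarrow> (real \<Rightarrow> real) \<Rightarrow> smeasure \<Rightarrow> (real \<Rightarrow> real) \<Rightarrow> (real \<Rightarrow> real) \<Rightarrow> bool" where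
  "admissible a b K u \<gamma> v g \<longleftrightarrow>
     weak_deriv a b u v \<and> Linf_bound a b K u \<and> finite_smeasure a b \<gamma> \<and> has_density a b \<gamma> g \<and>
     set_integrable lborel {a<..<b} (\<lambda>x. (v x - g x)\<^sup>2)"

definition energy_val ::
  "real \<Rightarrow> real \<Rightarrow> real \<Rightarrow> real \<Rightarrow> (real \<Rightarrow> real) \<Rightarrow> (real \<Rightarrow> real) \<Rightarrow> real" where
  "energy_val a b c0 \<epsilon> v g =
     (LINT x:{a<..<b}|lborel. (v x - g x)\<^sup>2) +
     (1 / \<epsilon>) * (LINT x:{a<..<b}|lborel. fcut c0 (\<epsilon> * avg_abs a b \<epsilon> g x))"

text \<open>E_\<epsilon>(u,\<gamma>); the value does not depend on the (a.e.-determined) choice of v and g.\<close>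
definition energy ::
  "real \<Rightarrow> real \<Rightarrow> real \<Rightarrow> real \<Rightarrow> real \<Rightarrow> (real \<Rightarrow> real) \<Rightarrow> smeasure \<Rightarrow> ereal" where
  "energy a b c0 K \<epsilon> u \<gamma> =
     (if \<exists>v g. admissible a b K u \<gamma> v g
      then ereal (energy_val a b c0 \<epsilon>
                   (fst (SOME p. admissible a b K u \<gamma> (fst p) (snd p)))
                   (snd (SOME p. admissible a b K u \<gamma> (fst p) (snd p))))
      else \<infinity>)"

end

theory Submission
  imports Defs "HOL-Probability.Helly_Selection"
begin

text \<open>
  On \<open>(a,b)\<close> write \<open>u\<^sub>n = c\<^sub>n + Z\<^sub>n + W\<^sub>n\<close>, where \<open>Z\<^sub>n\<close> and \<open>W\<^sub>n\<close> are the primitives of \<open>g\<^sub>n\<close> and of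
  \<open>w\<^sub>n = u\<^sub>n' - g\<^sub>n\<close>. Since \<open>u\<^sub>n\<close> and \<open>W\<^sub>n\<close> are bounded, so is the oscillation of \<open>Z\<^sub>n\<close>; as it is also at
  most the integral of \<open>\<bar>g\<^sub>n\<bar>\<close>, the nonlocal term of the energy gives
  \<open>\<integral> \<bar>Z\<^sub>n(x + \<epsilon>\<^sub>n) - Z\<^sub>n(x)\<bar> dx \<le> V \<epsilon>\<^sub>n\<close>. Hence the averages of \<open>Z\<^sub>n\<close> over \<open>(x, x + \<epsilon>\<^sub>n)\<close> have uniformly
  bounded variation and are \<open>V \<epsilon>\<^sub>n\<close>-close to \<open>Z\<^sub>n\<close> in \<open>L\<^sup>1\<close>, and Helly's theorem yields, up to additive constants,
  an \<open>L\<^sup>1\<close> limit \<open>F - G\<close> of \<open>Z\<^sub>n\<close> with \<open>F\<close> and \<open>G\<close> monotone. Its derivative is the limit measure \<open>\<gamma>\<close>. The functions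
  \<open>W\<^sub>n\<close> converge to the primitive of some \<open>w\<close> in \<open>L\<^sup>2\<close>, so \<open>Du = \<gamma> + w dx\<close>.

  A test function \<open>\<phi>\<close> with derivative \<open>\<psi>\<close> of mean zero satisfies
  \<open>\<integral> \<phi> d\<gamma> = - \<integral> \<psi>(t) \<gamma>((a,t]) dt\<close>. Thus convergence of measures in \<open>W\<^sup>-\<^sup>1\<^sup>,\<^sup>q\<close> and in the flat norm reduces to
  convergence of the bounded functions \<open>\<gamma>\<^sub>n((a,t])\<close> in \<open>L\<^sup>1\<close> modulo constants.
\<close>

subsection \<open>Primitives and countably additive set functions\<close>

text \<open>The obstacle is that the energy does not bound the mass of the measures: the cut-off
  saturates at \<open>c0\<close>, so places where \<open>\<bar>g\<bar>\<close> concentrates cost no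
  more when they carry more mass. Weak compactness of measures is therefore out of reach. What can
  be controlled is the signed primitive, because cancellation is allowed there and
  \<open>\<bar>u\<bar> \<le> K\<close> limits its oscillation by \<open>L\<close>. At each point the
  better of two bounds is used, the local mass of \<open>\<bar>g\<bar>\<close> or \<open>L\<close>,
  and this is the origin of the factor \<open>2 + L\<close> in \<open>V\<close>. Additive constants
  enter because mass may escape through the endpoint \<open>a\<close>, where distribution functions
  are normalised to zero. Integrands are extended by zero and \<open>prim\<close> starts at minus
  infinity, so that primitives are bounded continuous functions on the whole line; shifts past
  \<open>b\<close> and Helly's theorem ask for this. The last claim ranges over every decomposition
  and every derivative measure, so it is derived by comparing distribution functions and not from
  the particular measures constructed.\<close>

definition prim :: "(real \<Rightarrow> real) \<Rightarrow> real \<Rightarrow> real" where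
  "prim f x = (LINT t:{..x}|lborel. f t)"

lemma set_integrable_of_integrable:
  fixes f :: "real \<Rightarrow> real"
  assumes "integrable lborel f" "A \<in> sets borel"
  shows "set_integrable lborel A f"
  using assms unfolding set_integrable_def by (intro integrable_mult_indicator) auto

lemma prim_diff:
  assumes f: "integrable lborel f" and "x \<le> y"
  shows "prim f y - prim f x = (LINT t:{x<..y}|lborel. f t)"
proof -
  have "{..y} = {..x} \<union> {x<..y}" using assms by auto
  moreover have "(LINT t:{..x} \<union> {x<..y}|lborel. f t)
      = (LINT t:{..x}|lborel. f t) + (LINT t:{x<..y}|lborel. f t)"
    by (intro set_integral_Un set_integrable_of_integrable f) auto
  ultimately show ?thesis by (simp add: prim_def)
qed

lemma set_integral_abs_le:
  fixes f :: "real \<Rightarrow> real"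
  assumes f: "integrable lborel f" and A: "A \<in> sets borel"
  shows "\<bar>LINT t:A|lborel. f t\<bar> \<le> (LINT t:A|lborel. \<bar>f t\<bar>)"
  using set_integral_norm_bound[OF set_integrable_of_integrable[OF f A]] by simp

lemma set_integral_le_integral:
  fixes f :: "real \<Rightarrow> real"
  assumes f: "integrable lborel f" and A: "A \<in> sets borel" and nn: "\<And>x. 0 \<le> f x"
  shows "(LINT t:A|lborel. f t) \<le> (\<integral>t. f t \<partial>lborel)"
  unfolding set_lebesgue_integral_def
  by (intro integral_mono integrable_mult_indicator f) (auto simp: A indicator_def nn)

lemma prim_abs_diff_le:
  assumes f: "integrable lborel f" and "x \<le> y"
  shows "\<bar>prim f y - prim f x\<bar> \<le> (LINT t:{x<..y}|lborel. \<bar>f t\<bar>)"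
  unfolding prim_diff[OF assms] by (rule set_integral_abs_le[OF f]) auto

lemma prim_abs_diff_le_integral:
  assumes f: "integrable lborel f"
  shows "\<bar>prim f y - prim f x\<bar> \<le> (\<integral>t. \<bar>f t\<bar> \<partial>lborel)"
proof -
  have *: "\<bar>prim f y - prim f x\<bar> \<le> (\<integral>t. \<bar>f t\<bar> \<partial>lborel)" if "x \<le> y" for x y
  proof -
    have "\<bar>prim f y - prim f x\<bar> \<le> (LINT t:{x<..y}|lborel. \<bar>f t\<bar>)"
      by (rule prim_abs_diff_le[OF f that])
    also have "\<dots> \<le> (\<integral>t. \<bar>f t\<bar> \<partial>lborel)"
      using f by (intro set_integral_le_integral) auto
    finally show ?thesis .
  qed
  show ?thesis
    using *[of x y] *[of y x] by (cases "x \<le> y") (auto simp: abs_minus_commute)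
qed

lemma prim_abs_le_integral:
  assumes f: "integrable lborel f"
  shows "\<bar>prim f x\<bar> \<le> (\<integral>t. \<bar>f t\<bar> \<partial>lborel)"
proof -
  have "\<bar>prim f x\<bar> \<le> (LINT t:{..x}|lborel. \<bar>f t\<bar>)"
    unfolding prim_def by (rule set_integral_abs_le[OF f]) auto
  also have "\<dots> \<le> (\<integral>t. \<bar>f t\<bar> \<partial>lborel)"
    using f by (intro set_integral_le_integral) auto
  finally show ?thesis .
qed

lemma mono_prim:
  assumes f: "integrable lborel f" and nn: "\<And>x. 0 \<le> f x"
  shows "mono (prim f)"
proof
  fix x y :: real assume "x \<le> y"
  have "0 \<le> (LINT t:{x<..y}|lborel. f t)"
    unfolding set_lebesgue_integral_def by (rule integral_nonneg_AE) (auto simp: nn)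
  then show "prim f x \<le> prim f y" using prim_diff[OF f \<open>x \<le> y\<close>] by simp
qed

lemma isCont_prim:
  assumes f: "integrable lborel f"
  shows "isCont (prim f) x"
  unfolding continuous_at_sequentially
proof (intro allI impI)
  fix X :: "nat \<Rightarrow> real" assume X: "X \<longlonglongrightarrow> x"
  have "(\<lambda>n. \<integral>t. indicator {..X n} t *\<^sub>R f t \<partial>lborel) \<longlonglongrightarrow> (\<integral>t. indicator {..x} t *\<^sub>R f t \<partial>lborel)"
  proof (rule integral_dominated_convergence[where w="\<lambda>t. \<bar>f t\<bar>"])
    have "AE t in lborel. t \<noteq> x" by (rule AE_lborel_singleton)
    then show "AE t in lborel. (\<lambda>n. indicator {..X n} t *\<^sub>R f t) \<longlonglongrightarrow> indicator {..x} t *\<^sub>R f t"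
    proof eventually_elim
      case (elim t)
      show ?case
      proof (cases "t < x")
        case True
        then have "\<forall>\<^sub>F n in sequentially. t < X n" using X by (simp add: order_tendsto_iff)
        then show ?thesis
          by (intro tendsto_eventually, rule eventually_mono) (use True in \<open>auto simp: indicator_def\<close>)
      next
        case False
        then have "t > x" using elim by simp
        then have "\<forall>\<^sub>F n in sequentially. t > X n" using X by (simp add: order_tendsto_iff)
        then show ?thesis
          by (intro tendsto_eventually, rule eventually_mono) (use \<open>t > x\<close> in \<open>auto simp: indicator_def\<close>)
      qed
    qed
  qed (use f in \<open>auto simp: indicator_def\<close>)
  then show "((prim f) \<circ> X) \<longlonglongrightarrow> prim f x"
    by (simp add: prim_def set_lebesgue_integral_def comp_def)
qed

lemma continuous_on_prim: "integrable lborel f \<Longrightarrow> continuous_on A (prim f)"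
  by (simp add: isCont_prim continuous_at_imp_continuous_on)

lemma borel_measurable_prim: "integrable lborel f \<Longrightarrow> prim f \<in> borel_measurable borel"
  by (intro borel_measurable_continuous_onI continuous_on_prim)

lemma prim_diff_fun:
  assumes "integrable lborel f" "integrable lborel g"
  shows "prim (\<lambda>x. f x - g x) x = prim f x - prim g x"
  unfolding prim_def
  by (intro set_integral_diff(2) set_integrable_of_integrable assms) auto

lemma AE_lborel_ex_between:
  assumes "AE x in lborel. P x" and "(p::real) < q"
  shows "\<exists>x. p < x \<and> x < q \<and> P x"
proof (rule ccontr)
  assume "\<not> ?thesis"
  then have sub: "{p<..<q} \<subseteq> {x. \<not> P x}" by auto
  obtain N where N: "N \<in> null_sets lborel" "{x \<in> space lborel. \<not> P x} \<subseteq> N"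
    using assms(1) by (auto simp: eventually_ae_filter)
  have "{p<..<q} \<in> null_sets lborel"
    by (rule null_sets_subset[OF N(1)]) (use N(2) sub in auto)
  then show False using \<open>p < q\<close> by (auto simp: null_sets_def)
qed

text \<open>Pairs of measures have no subtraction, so differences of signed measures are treated as set functions.\<close>

definition countably_additive_on :: "real \<Rightarrow> real \<Rightarrow> (real set \<Rightarrow> real) \<Rightarrow> bool" where
  "countably_additive_on a b d \<longleftrightarrow>
     (\<forall>A :: nat \<Rightarrow> real set. range A \<subseteq> sets borel \<longrightarrow> (\<forall>i. A i \<subseteq> {a<..<b}) \<longrightarrow> disjoint_family A \<longrightarrow>
        (\<lambda>i. d (A i)) sums d (\<Union>i. A i))"

lemma countably_additive_onD:
  "countably_additive_on a b d \<Longrightarrow> (\<And>i. A i \<in> sets borel) \<Longrightarrow> (\<And>i. A i \<subseteq> {a<..<b}) \<Longrightarrow>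
    disjoint_family (A :: nat \<Rightarrow> real set) \<Longrightarrow> (\<lambda>i. d (A i)) sums d (\<Union>i. A i)"
  unfolding countably_additive_on_def by blast

lemma countably_additive_on_diff:
  "countably_additive_on a b d \<Longrightarrow> countably_additive_on a b e \<Longrightarrow>
    countably_additive_on a b (\<lambda>A. d A - e A)"
  unfolding countably_additive_on_def
proof (intro allI impI)
  fix A :: "nat \<Rightarrow> real set"
  assume d: "\<forall>A. range A \<subseteq> sets borel \<longrightarrow> (\<forall>i. A i \<subseteq> {a<..<b}) \<longrightarrow> disjoint_family A \<longrightarrow>
        (\<lambda>i::nat. d (A i)) sums d (\<Union>i. A i)"
    and e: "\<forall>A. range A \<subseteq> sets borel \<longrightarrow> (\<forall>i. A i \<subseteq> {a<..<b}) \<longrightarrow> disjoint_family A \<longrightarrow>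
        (\<lambda>i::nat. e (A i)) sums e (\<Union>i. A i)"
    and A: "range A \<subseteq> sets borel" "\<forall>i. A i \<subseteq> {a<..<b}" "disjoint_family A"
  from sums_diff[OF d[rule_format, OF A(1) A(2)[rule_format] A(3)] e[rule_format, OF A(1) A(2)[rule_format] A(3)]]
  show "(\<lambda>i. d (A i) - e (A i)) sums (d (\<Union>i. A i) - e (\<Union>i. A i))" .
qed

lemma countably_additive_on_sval:
  assumes "finite_smeasure a b \<gamma>"
  shows "countably_additive_on a b (sval \<gamma>)"
proof -
  have *: "(\<lambda>i. measure M (A i)) sums measure M (\<Union>i. A i)"
    if "finite_measure M" "sets M = sets (restrict_space borel {a<..<b})"
      "range A \<subseteq> sets borel" "\<forall>i. A i \<subseteq> {a<..<b}" "disjoint_family A"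
    for M and A :: "nat \<Rightarrow> real set"
    using that by (intro finite_measure.finite_measure_UNION) (auto simp: sets_restrict_space_iff)
  show ?thesis
    unfolding countably_additive_on_def sval_def
    using assms by (auto simp: finite_smeasure_def intro!: sums_diff *)
qed

lemma countably_additive_on_integral:
  assumes f: "integrable lborel f"
  shows "countably_additive_on a b (\<lambda>A. LINT x:A|lborel. f x)"
  unfolding countably_additive_on_def
proof (intro allI impI)
  fix A :: "nat \<Rightarrow> real set"
  assume A: "range A \<subseteq> sets borel" "\<forall>i. A i \<subseteq> {a<..<b}" "disjoint_family A"
  have [measurable]: "A i \<in> sets borel" for i using A by auto
  define F where "F n t = (indicator (\<Union>i<n. A i) t *\<^sub>R f t)" for n t
  have Fsum: "(\<Sum>i<n. LINT x:A i|lborel. f x) = (\<integral>t. F n t \<partial>lborel)" for n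
  proof -
    have "(\<Sum>i<n. LINT x:A i|lborel. f x) = (LINT x:(\<Union>i<n. A i)|lborel. f x)"
      using A(3)
      by (intro set_integral_finite_Union[symmetric] set_integrable_of_integrable[OF f])
         (auto simp: disjoint_family_on_def)
    then show ?thesis by (simp add: F_def set_lebesgue_integral_def)
  qed
  have "(\<lambda>n. \<integral>t. F n t \<partial>lborel) \<longlonglongrightarrow> (\<integral>t. indicator (\<Union>i. A i) t *\<^sub>R f t \<partial>lborel)"
  proof (rule integral_dominated_convergence[where w="\<lambda>t. \<bar>f t\<bar>"])
    show "AE t in lborel. (\<lambda>n. F n t) \<longlonglongrightarrow> indicator (\<Union>i. A i) t *\<^sub>R f t"
    proof (rule AE_I2)
      fix t
      show "(\<lambda>n. F n t) \<longlonglongrightarrow> indicator (\<Union>i. A i) t *\<^sub>R f t"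
        unfolding F_def by (intro tendsto_scaleR tendsto_const LIMSEQ_indicator_UN)
    qed
  qed (use f in \<open>auto simp: indicator_def F_def\<close>)
  then show "(\<lambda>i. LINT x:A i|lborel. f x) sums (LINT x:(\<Union>i. A i)|lborel. f x)"
    unfolding sums_def Fsum by (simp add: set_lebesgue_integral_def)
qed

lemma countably_additive_on_empty:
  assumes "countably_additive_on a b d" shows "d {} = 0"
proof -
  have "(\<lambda>i::nat. d {}) sums d (\<Union>i::nat. {})"
    using assms by (rule countably_additive_onD) (auto simp: disjoint_family_on_def)
  then have "summable (\<lambda>i::nat. d {})" by (rule sums_summable)
  then show ?thesis by (simp add: summable_const_iff)
qed

lemma countably_additive_on_Un:
  assumes d: "countably_additive_on a b d" and A: "A \<in> sets borel" "A \<subseteq> {a<..<b}"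
    and B: "B \<in> sets borel" "B \<subseteq> {a<..<b}" and AB: "A \<inter> B = {}"
  shows "d (A \<union> B) = d A + d B"
proof -
  define X where "X = (\<lambda>i::nat. if i = 0 then A else if i = 1 then B else {})"
  have "(\<lambda>i. d (X i)) sums d (\<Union>i. X i)"
    using A B AB by (intro countably_additive_onD[OF d]) (auto simp: disjoint_family_on_def X_def)
  moreover have "(\<lambda>i. d (X i)) sums (\<Sum>i\<in>{0,1}. d (X i))"
    by (rule sums_finite) (auto simp: X_def countably_additive_on_empty[OF d])
  moreover have "(\<Union>i. X i) = A \<union> B"
  proof -
    have "A = X 0" "B = X 1" "\<And>i. X i \<subseteq> A \<union> B" by (auto simp: X_def)
    then show ?thesis by blast
  qed
  ultimately have "d (A \<union> B) = (\<Sum>i\<in>{0,1}. d (X i))" using sums_unique2 by metis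
  then show ?thesis by (simp add: X_def)
qed

text \<open>Countable additivity makes \<open>d {a<..t}\<close> right continuous in
  \<open>t\<close>, which upgrades the hypothesis from almost every \<open>t\<close> to every
  \<open>t\<close>. At \<open>t = a\<close> the interval is empty, so \<kappa> = 0, and half-lines
  generate the Borel sets. The lemma turns equality of distribution functions up to a constant,
  almost everywhere, into equality of set functions.\<close>

lemma countably_additive_on_eq_zero:
  assumes ab: "a < b" and d: "countably_additive_on a b d"
    and AE: "AE t in lborel. t \<in> {a<..<b} \<longrightarrow> d {a<..t} = \<kappa>"
    and A: "A \<in> sets borel" "A \<subseteq> {a<..<b}"
  shows "d A = 0"
proof -
  define good where "good t \<longleftrightarrow> a < t \<and> t < b \<and> d {a<..t} = \<kappa>" for t
  have good_ex: "\<exists>t. p < t \<and> t < q \<and> good t" if "a \<le> p" "p < q" "q \<le> b" for p q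
    using AE_lborel_ex_between[OF AE that(2)] that unfolding good_def by force
  have zero: "d {s<..t} = 0" if "good s" "good t" "s < t" for s t
  proof -
    have "{a<..t} = {a<..s} \<union> {s<..t}" using that by (auto simp: good_def)
    moreover have "d ({a<..s} \<union> {s<..t}) = d {a<..s} + d {s<..t}"
      using that by (intro countably_additive_on_Un[OF d]) (auto simp: good_def)
    ultimately show ?thesis using that by (simp add: good_def)
  qed
  have key: "d {a<..t} = \<kappa>" if t: "a \<le> t" "t < b" for t
  proof -
    define \<delta> where "\<delta> = b - t"
    have "\<delta> > 0" using t by (simp add: \<delta>_def)
    \<comment> \<open>Good points picked between consecutive terms of the sequence t +
      \<delta>/(n+1) form a strictly decreasing sequence with limit \<open>t\<close>.\<close>
    have "\<exists>x. t + \<delta> / real (n + 2) < x \<and> x < t + \<delta> / real (n + 1) \<and> good x" for n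
    proof (rule good_ex)
      show "t + \<delta> / real (n + 2) < t + \<delta> / real (n + 1)"
        using \<open>\<delta> > 0\<close> by (simp add: divide_strict_left_mono)
      have "\<delta> / real (n + 1) \<le> \<delta>" using \<open>\<delta> > 0\<close> by (simp add: field_simps)
      then show "t + \<delta> / real (n + 1) \<le> b" by (simp add: \<delta>_def)
      have "0 < \<delta> / real (n + 2)" using \<open>\<delta> > 0\<close> by simp
      then show "a \<le> t + \<delta> / real (n + 2)" using t by simp
    qed
    then obtain X where X: "\<And>n. t + \<delta> / real (n + 2) < X n" "\<And>n. X n < t + \<delta> / real (n + 1)"
      "\<And>n. good (X n)" by metis
    have Xdec: "X (Suc n) < X n" for n
      using X(2)[of "Suc n"] X(1)[of n] by (simp add: add.commute)
    have Xgt: "t < X n" for n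
    proof -
      have "0 < \<delta> / real (n + 2)" using \<open>\<delta> > 0\<close> by simp
      then show ?thesis using X(1)[of n] by simp
    qed
    have "decseq X" by (rule decseq_SucI) (use Xdec in \<open>simp add: less_imp_le\<close>)
    have Xlim: "X \<longlonglongrightarrow> t"
    proof (rule tendsto_sandwich)
      show "\<forall>\<^sub>F n in sequentially. t \<le> X n" using Xgt by (simp add: less_imp_le)
      show "\<forall>\<^sub>F n in sequentially. X n \<le> t + \<delta> / real (n + 1)" using X(2) by (simp add: less_imp_le)
      have "(\<lambda>n. \<delta> / real (Suc n)) \<longlonglongrightarrow> 0" by (rule LIMSEQ_Suc[OF lim_const_over_n])
      from tendsto_add[OF tendsto_const[of t] this]
      show "(\<lambda>n. t + \<delta> / real (n + 1)) \<longlonglongrightarrow> t" by simp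
    qed simp
    \<comment> \<open>The slices between consecutive good points have value 0, so countable
      additivity leaves only the piece \<open>{a<..t}\<close> of \<open>{a<..X 0}\<close>.\<close>
    define Y where "Y n = (case n of 0 \<Rightarrow> {a<..t} | Suc i \<Rightarrow> {X (Suc i)<..X i})" for n
    have lt: "X n < b" "a < X n" for n using X(3)[of n] by (auto simp: good_def)
    have YU: "(\<Union>n. Y n) = {a<..X 0}"
    proof (intro equalityI subsetI)
      fix x assume "x \<in> (\<Union>n. Y n)"
      then obtain n where n: "x \<in> Y n" by blast
      show "x \<in> {a<..X 0}"
      proof (cases n)
        case 0 then show ?thesis using n Xgt[of 0] by (auto simp: Y_def)
      next
        case (Suc i)
        then show ?thesis using n lt[of "Suc i"] decseqD[OF \<open>decseq X\<close>, of 0 i]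
          by (auto simp: Y_def)
      qed
    next
      fix x assume x: "x \<in> {a<..X 0}"
      show "x \<in> (\<Union>n. Y n)"
      proof (cases "x \<le> t")
        case True
        then have "x \<in> Y 0" using x by (auto simp: Y_def)
        then show ?thesis by blast
      next
        case False
        then have "\<forall>\<^sub>F n in sequentially. X n < x" using Xlim by (simp add: order_tendsto_iff)
        then obtain n where n: "X n < x" by (auto simp: eventually_sequentially)
        define m where "m = (LEAST n. X n < x)"
        have m: "X m < x" unfolding m_def by (rule LeastI[of _ n]) (rule n)
        have "m \<noteq> 0" using m x by (auto intro: ccontr)
        then obtain i where i: "m = Suc i" using not0_implies_Suc by blast
        have "\<not> X i < x" using not_less_Least[of i "\<lambda>n. X n < x"] i by (simp add: m_def)
        then have "x \<in> Y m" using m by (auto simp: Y_def i)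
        then show ?thesis by blast
      qed
    qed
    have disj: "disjoint_family Y"
    proof -
      have *: "Y i \<inter> Y j = {}" if "i < j" for i j
      proof -
        obtain k where k: "j = Suc k" using \<open>i < j\<close> by (cases j) auto
        show ?thesis
        proof (cases i)
          case 0 then show ?thesis using Xgt[of "Suc k"] by (auto simp: Y_def k)
        next
          case (Suc l)
          then have "X k \<le> X (Suc l)" using that k by (intro decseqD[OF \<open>decseq X\<close>]) auto
          then show ?thesis by (auto simp: Y_def k Suc)
        qed
      qed
      show ?thesis unfolding disjoint_family_on_def
        by (metis * Int_commute linorder_neqE_nat)
    qed
    have "(\<lambda>n. d (Y n)) sums d (\<Union>n. Y n)"
    proof (rule countably_additive_onD[OF d _ _ disj])
      show "Y i \<in> sets borel" for i by (cases i) (auto simp: Y_def)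
      show "Y i \<subseteq> {a<..<b}" for i
      proof (cases i)
        case 0 then show ?thesis using t by (auto simp: Y_def)
      next
        case (Suc j)
        then show ?thesis using lt(1)[of j] lt(2)[of "Suc j"] by (auto simp: Y_def)
      qed
    qed
    moreover have "(\<lambda>n. d (Y n)) sums (\<Sum>i\<in>{0}. d (Y i))"
    proof (rule sums_finite)
      fix n :: nat assume "n \<notin> {0}"
      then obtain i where "n = Suc i" using not0_implies_Suc by auto
      then show "d (Y n) = 0" using zero[OF X(3) X(3) Xdec] by (simp add: Y_def)
    qed simp
    ultimately have "d {a<..X 0} = d (Y 0)" unfolding YU using sums_unique2 by fastforce
    then show ?thesis using X(3)[of 0] by (simp add: Y_def good_def)
  qed
  have \<kappa>: "\<kappa> = 0" using key[of a] ab countably_additive_on_empty[OF d] by simp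
  have full: "d {a<..<b} = 0"
  proof -
    define \<delta> where "\<delta> = b - a"
    have "\<delta> > 0" using ab by (simp add: \<delta>_def)
    define X where "X n = b - \<delta> / real (n + 1)" for n
    define Y where "Y n = {X n<..X (Suc n)}" for n
    have X0: "X 0 = a" by (simp add: X_def \<delta>_def)
    have Xinc: "X n < X (Suc n)" for n
      using \<open>\<delta> > 0\<close> by (simp add: X_def divide_strict_left_mono)
    have "incseq X" by (rule incseq_SucI) (use Xinc in \<open>simp add: less_imp_le\<close>)
    have Xb: "X n < b" for n using \<open>\<delta> > 0\<close> by (simp add: X_def)
    have Xa: "a \<le> X n" for n using incseqD[OF \<open>incseq X\<close>, of 0 n] X0 by simp
    have "(\<lambda>n. \<delta> / real (Suc n)) \<longlonglongrightarrow> 0" by (rule LIMSEQ_Suc[OF lim_const_over_n])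
    from tendsto_diff[OF tendsto_const[of b] this] have Xlim: "X \<longlonglongrightarrow> b"
      unfolding X_def by simp
    have YU: "(\<Union>n. Y n) = {a<..<b}"
    proof (intro equalityI subsetI)
      fix x assume "x \<in> (\<Union>n. Y n)"
      then obtain n where "X n < x" "x \<le> X (Suc n)" by (auto simp: Y_def)
      then show "x \<in> {a<..<b}" using Xa[of n] Xb[of "Suc n"] by simp
    next
      fix x assume x: "x \<in> {a<..<b}"
      then have "\<forall>\<^sub>F n in sequentially. x < X n" using Xlim by (simp add: order_tendsto_iff)
      then obtain n where n: "x < X n" by (auto simp: eventually_sequentially)
      define m where "m = (LEAST n. x \<le> X n)"
      have m: "x \<le> X m" unfolding m_def by (rule LeastI[of _ n]) (use n in simp)
      have "m \<noteq> 0" using m x X0 by (auto intro: ccontr)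
      then obtain i where i: "m = Suc i" using not0_implies_Suc by blast
      have "\<not> x \<le> X i" using not_less_Least[of i "\<lambda>n. x \<le> X n"] i by (simp add: m_def)
      then have "x \<in> Y i" using m by (auto simp: Y_def i)
      then show "x \<in> (\<Union>n. Y n)" by blast
    qed
    have disj: "disjoint_family Y"
    proof -
      have *: "Y i \<inter> Y j = {}" if "i < j" for i j
        using incseqD[OF \<open>incseq X\<close>, of "Suc i" j] that by (auto simp: Y_def)
      show ?thesis unfolding disjoint_family_on_def
        by (metis * Int_commute linorder_neqE_nat)
    qed
    have "d (Y n) = 0" for n
    proof -
      have "{a<..X (Suc n)} = {a<..X n} \<union> Y n" using Xa[of n] Xinc[of n] by (auto simp: Y_def)
      moreover have "d ({a<..X n} \<union> Y n) = d {a<..X n} + d (Y n)"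
        using Xa[of n] Xb[of n] Xb[of "Suc n"]
        by (intro countably_additive_on_Un[OF d]) (auto simp: Y_def)
      ultimately show ?thesis using key[OF Xa[of n] Xb[of n]] key[OF Xa[of "Suc n"] Xb[of "Suc n"]] by simp
    qed
    moreover have "(\<lambda>n. d (Y n)) sums d (\<Union>n. Y n)"
      using YU by (intro countably_additive_onD[OF d _ _ disj]) (auto simp: Y_def)
    ultimately show ?thesis unfolding YU using sums_unique2[OF sums_zero] by fastforce
  qed
  \<comment> \<open>Dynkin's argument on the intersection-stable family of half-lines. Intersecting
    with the interval lets complements be taken in the whole line, with \<open>full\<close> as the
    total value.\<close>
  have "d (B \<inter> {a<..<b}) = 0" if "B \<in> sets borel" for B
  proof -
    have "Int_stable (range (\<lambda>t::real. {..t}))"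
      by (auto simp: Int_stable_def Int_atMost)
    moreover have "range (\<lambda>t::real. {..t}) \<subseteq> Pow UNIV" by simp
    moreover have "B \<in> sigma_sets UNIV (range (\<lambda>t::real. {..t}))"
      using that by (simp add: borel_eq_atMost)
    ultimately show ?thesis
    proof (induction rule: sigma_sets_induct_disjoint)
      case (basic A)
      then obtain t where A: "A = {..t}" by auto
      consider "t \<le> a" | "a < t" "t < b" | "b \<le> t" by linarith
      then show ?case
      proof cases
        case 1
        then have "A \<inter> {a<..<b} = {}" by (auto simp: A)
        then show ?thesis using countably_additive_on_empty[OF d] by simp
      next
        case 2
        then have "A \<inter> {a<..<b} = {a<..t}" by (auto simp: A)
        then show ?thesis using key[of t] 2 \<kappa> by simp
      next
        case 3
        then have "A \<inter> {a<..<b} = {a<..<b}" by (auto simp: A)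
        then show ?thesis using full by simp
      qed
    next
      case empty show ?case using countably_additive_on_empty[OF d] by simp
    next
      case (compl A)
      have A: "A \<in> sets borel" using compl by (simp add: borel_eq_atMost)
      have "{a<..<b} = (A \<inter> {a<..<b}) \<union> ((UNIV - A) \<inter> {a<..<b})" by auto
      moreover have "d ((A \<inter> {a<..<b}) \<union> ((UNIV - A) \<inter> {a<..<b}))
          = d (A \<inter> {a<..<b}) + d ((UNIV - A) \<inter> {a<..<b})"
        using A by (intro countably_additive_on_Un[OF d]) auto
      ultimately show ?case using full compl by simp
    next
      case (union A)
      have A: "A i \<in> sets borel" for i using union by (auto simp: borel_eq_atMost)
      have "(\<lambda>i. d (A i \<inter> {a<..<b})) sums d (\<Union>i. A i \<inter> {a<..<b})"
        using A union(1) by (intro countably_additive_onD[OF d]) (auto simp: disjoint_family_on_def)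
      then have "(\<lambda>i::nat. 0::real) sums d (\<Union>i. A i \<inter> {a<..<b})" using union by simp
      moreover have "(\<Union>i. A i \<inter> {a<..<b}) = (\<Union>i. A i) \<inter> {a<..<b}" by auto
      ultimately show ?case using sums_unique2[OF sums_zero] by fastforce
    qed
  qed
  from this[OF A(1)] show ?thesis using A(2) by (simp add: Int_absorb2)
qed

subsection \<open>Test functions and the du Bois-Reymond lemma\<close>

lemma integrable_zero_ext:
  "set_integrable lborel A f \<longleftrightarrow> integrable lborel (\<lambda>x. indicator A x * (f x :: real))"
  by (simp add: set_integrable_def)

lemma borel_measurable_ident_restrict:
  assumes "sets M = sets (restrict_space borel {a<..<b::real})"
  shows "(\<lambda>x. x) \<in> borel_measurable M"
  unfolding measurable_cong_sets[OF assms refl]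
  by (rule measurable_restrict_space1) simp

lemma space_eq_Ioo:
  assumes "sets M = sets (restrict_space borel {a<..<b::real})"
  shows "space M = {a<..<b}"
  using sets_eq_imp_space_eq[OF assms] by (simp add: space_restrict_space)

lemma integrable_mult_cdf:
  fixes M :: "real measure"
  assumes M: "finite_measure M" "sets M = sets (restrict_space borel {a<..<b})"
    and \<psi>: "set_integrable lborel {a<..<b} \<psi>"
  shows "set_integrable lborel {a<..<b} (\<lambda>t. \<psi> t * measure M {a<..t})"
proof -
  interpret finite_measure M by fact
  have sp: "space M = {a<..<b}" by (rule space_eq_Ioo[OF M(2)])
  \<comment> \<open>\<open>measure M {a<..t}\<close> itself need not be monotone in
    \<open>t\<close>: once the set leaves the space of \<open>M\<close>, its measure is 0 by
    default. \<open>C\<close> avoids this and agrees with it inside the interval.\<close>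
  define C where "C t = measure M ({..t} \<inter> {a<..<b})" for t
  have "mono C" unfolding C_def
    by (intro monoI finite_measure_mono) (auto simp: M(2) sets_restrict_space_iff)
  then have [measurable]: "C \<in> borel_measurable borel" by (rule borel_measurable_mono)
  have \<psi>': "integrable lborel (\<lambda>x. indicator {a<..<b} x * \<psi> x)" using \<psi> integrable_zero_ext by blast
  have "integrable lborel (\<lambda>x. C x * (indicator {a<..<b} x * \<psi> x))"
  proof (rule Bochner_Integration.integrable_bound)
    show "integrable lborel (\<lambda>x. measure M (space M) * (indicator {a<..<b} x * \<psi> x))"
      using \<psi>' by (intro integrable_mult_right) auto
    show "(\<lambda>x. C x * (indicator {a<..<b} x * \<psi> x)) \<in> borel_measurable lborel"
      by (rule borel_measurable_times[OF _ borel_measurable_integrable[OF \<psi>']]) simp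
    show "AE x in lborel. norm (C x * (indicator {a<..<b} x * \<psi> x))
        \<le> norm (measure M (space M) * (indicator {a<..<b} x * \<psi> x))"
    proof (rule AE_I2)
      fix x
      have "C x \<le> measure M (space M)" unfolding C_def by (rule bounded_measure)
      moreover have "0 \<le> C x" by (simp add: C_def)
      ultimately show "norm (C x * (indicator {a<..<b} x * \<psi> x))
        \<le> norm (measure M (space M) * (indicator {a<..<b} x * \<psi> x))"
        unfolding norm_mult by (intro mult_right_mono) auto
    qed
  qed
  moreover have "C x * (indicator {a<..<b} x * \<psi> x)
      = indicator {a<..<b} x * (\<psi> x * measure M {a<..x})" for x
  proof -
    have "x \<in> {a<..<b} \<Longrightarrow> {..x} \<inter> {a<..<b} = {a<..x}" by auto
    then show ?thesis by (auto simp: C_def indicator_def)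
  qed
  ultimately show ?thesis by (simp add: integrable_zero_ext)
qed

text \<open>As \<open>\<psi>\<close> has mean zero, \<open>\<phi> x\<close> is minus the integral of
  \<open>\<psi>\<close> over [x,b). Exchanging the order of integration leaves the measure of the
  points \<open>x \<le> t\<close>, that is of \<open>{a<..t}\<close>.\<close>

lemma integral_eq_neg_integral_cdf:
  fixes M :: "real measure"
  assumes M: "finite_measure M" "sets M = sets (restrict_space borel {a<..<b})"
    and \<psi>: "set_integrable lborel {a<..<b} \<psi>"
    and zero: "(LINT x:{a<..<b}|lborel. \<psi> x) = 0"
    and \<phi>: "\<forall>x\<in>{a<..<b}. \<phi> x = (LINT t:{a<..x}|lborel. \<psi> t)"
  shows "(\<integral>x. \<phi> x \<partial>M) = - (LINT t:{a<..<b}|lborel. \<psi> t * measure M {a<..t})"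
proof -
  interpret M: finite_measure M by fact
  interpret pair_sigma_finite lborel M ..
  have sp: "space M = {a<..<b}" by (rule space_eq_Ioo[OF M(2)])
  have id[measurable]: "(\<lambda>x. x) \<in> borel_measurable M" by (rule borel_measurable_ident_restrict[OF M(2)])
  define p where "p t = indicator {a<..<b} t * \<psi> t" for t
  have p: "integrable lborel p" using \<psi> unfolding integrable_zero_ext p_def .
  have [measurable]: "p \<in> borel_measurable lborel" using p by auto
  define f where "f t x = (if x \<le> t then 1 else 0) * p t" for t x
  have fm: "case_prod f \<in> borel_measurable (lborel \<Otimes>\<^sub>M M)"
    unfolding f_def case_prod_beta
  proof (intro borel_measurable_times measurable_If borel_measurable_const)
    show "(\<lambda>w. p (fst w)) \<in> borel_measurable (lborel \<Otimes>\<^sub>M M)"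
      by (rule measurable_compose[OF measurable_fst]) simp
    have "(\<lambda>w. fst w) \<in> borel_measurable (lborel \<Otimes>\<^sub>M M)"
      by (rule measurable_compose[OF measurable_fst]) simp
    moreover have "(\<lambda>w. snd w) \<in> borel_measurable (lborel \<Otimes>\<^sub>M M)"
      by (rule measurable_compose[OF measurable_snd id])
    ultimately show "{w \<in> space (lborel \<Otimes>\<^sub>M M). snd w \<le> fst w} \<in> sets (lborel \<Otimes>\<^sub>M M)"
      by (rule borel_measurable_le[rotated])
  qed
  have inner: "(\<integral>x. f t x \<partial>M) = indicator {a<..<b} t * (\<psi> t * measure M {a<..t})" for t
  proof (cases "t \<in> {a<..<b}")
    case True
    have "(\<integral>x. f t x \<partial>M) = (\<integral>x. indicator {a<..t} x * p t \<partial>M)"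
      using True by (intro Bochner_Integration.integral_cong) (auto simp: f_def indicator_def sp)
    also have "\<dots> = measure M ({a<..t} \<inter> space M) * p t" by simp
    also have "{a<..t} \<inter> space M = {a<..t}" unfolding sp using True by force
    finally show ?thesis using True by (simp add: p_def)
  qed (auto simp: f_def p_def)
  have fi: "integrable (lborel \<Otimes>\<^sub>M M) (case_prod f)"
  proof (rule Fubini_integrable[OF fm])
    \<comment> \<open>For fixed \<open>t\<close> the sign of \<open>f t y\<close> is that of
      \<open>p t\<close>, so the integral of the norm is the modulus of \<open>inner\<close>, which
      is integrable by \<open>integrable_mult_cdf\<close>.\<close>
    have "(\<integral>y. norm (case_prod f (t, y)) \<partial>M) = \<bar>\<integral>y. f t y \<partial>M\<bar>" for t
    proof (cases "p t \<ge> 0")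
      case True
      then have "(\<integral>y. f t y \<partial>M) \<ge> 0" by (intro integral_nonneg_AE) (auto simp: f_def)
      moreover have "norm (case_prod f (t, y)) = f t y" for y using True by (simp add: f_def)
      ultimately show ?thesis by simp
    next
      case False
      have "(\<integral>y. - f t y \<partial>M) \<ge> 0" using False by (intro integral_nonneg_AE) (auto simp: f_def)
      moreover have "norm (case_prod f (t, y)) = - f t y" for y using False by (simp add: f_def)
      ultimately show ?thesis by simp
    qed
    then show "integrable lborel (\<lambda>x. \<integral>y. norm (case_prod f (x, y)) \<partial>M)"
      using integrable_mult_cdf[OF M \<psi>] unfolding inner integrable_zero_ext
      by (simp add: integrable_abs)
    show "AE x in lborel. integrable M (\<lambda>y. case_prod f (x, y))"
    proof (rule AE_I2)
      fix t
      show "integrable M (\<lambda>y. case_prod f (t, y))"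
        by (rule M.integrable_const_bound[where B="\<bar>p t\<bar>"]) (auto simp: f_def)
    qed
  qed
  have \<phi>': "\<phi> x = - (\<integral>t. f t x \<partial>lborel)" if x: "x \<in> space M" for x
  proof -
    have x': "x \<in> {a<..<b}" using x sp by simp
    have "\<phi> x = (LINT t:{a<..x}|lborel. \<psi> t)" using \<phi> x' by blast
    also have "\<dots> = (\<integral>t. indicator {..x} t *\<^sub>R p t \<partial>lborel)"
      unfolding set_lebesgue_integral_def p_def
      using x' by (intro Bochner_Integration.integral_cong) (auto simp: indicator_def)
    \<comment> \<open>The conditions \<open>t \<le> x\<close> and \<open>x \<le> t\<close> overlap
      only at the single point \<open>t = x\<close>.\<close>
    also have "\<dots> = (\<integral>t. p t - f t x \<partial>lborel)"
    proof (rule integral_cong_AE)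
      have "AE t in lborel. t \<noteq> x" by (rule AE_lborel_singleton)
      then show "AE t in lborel. indicator {..x} t *\<^sub>R p t = p t - f t x"
        by eventually_elim (auto simp: f_def indicator_def)
    qed (auto simp: f_def)
    also have "\<dots> = (\<integral>t. p t \<partial>lborel) - (\<integral>t. f t x \<partial>lborel)"
    proof (rule Bochner_Integration.integral_diff[OF p])
      show "integrable lborel (\<lambda>t. f t x)"
        by (rule Bochner_Integration.integrable_bound[OF p]) (auto simp: f_def)
    qed
    also have "(\<integral>t. p t \<partial>lborel) = 0" using zero by (simp add: p_def set_lebesgue_integral_def)
    finally show ?thesis by simp
  qed
  have "(\<integral>x. \<phi> x \<partial>M) = - (\<integral>x. (\<integral>t. f t x \<partial>lborel) \<partial>M)"
    using \<phi>' by (simp cong: Bochner_Integration.integral_cong)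
  also have "(\<integral>x. (\<integral>t. f t x \<partial>lborel) \<partial>M) = (\<integral>t. (\<integral>x. f t x \<partial>M) \<partial>lborel)"
    by (rule Fubini_integral[OF fi])
  finally show ?thesis unfolding inner by (simp add: set_lebesgue_integral_def)
qed

lemma sint_eq_neg_integral:
  assumes \<gamma>: "finite_smeasure a b \<gamma>"
    and \<psi>: "set_integrable lborel {a<..<b} \<psi>"
    and zero: "(LINT x:{a<..<b}|lborel. \<psi> x) = 0"
    and \<phi>: "\<forall>x\<in>{a<..<b}. \<phi> x = (LINT t:{a<..x}|lborel. \<psi> t)"
  shows "set_integrable lborel {a<..<b} (\<lambda>t. \<psi> t * sval \<gamma> {a<..t})"
    and "sint \<gamma> \<phi> = - (LINT t:{a<..<b}|lborel. \<psi> t * sval \<gamma> {a<..t})"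
proof -
  have 1: "finite_measure (fst \<gamma>)" "sets (fst \<gamma>) = sets (restrict_space borel {a<..<b})"
    and 2: "finite_measure (snd \<gamma>)" "sets (snd \<gamma>) = sets (restrict_space borel {a<..<b})"
    using \<gamma> by (auto simp: finite_smeasure_def)
  note i1 = integrable_mult_cdf[OF 1 \<psi>] and i2 = integrable_mult_cdf[OF 2 \<psi>]
  show "set_integrable lborel {a<..<b} (\<lambda>t. \<psi> t * sval \<gamma> {a<..t})"
    using set_integral_diff(1)[OF i1 i2] by (simp add: sval_def right_diff_distrib)
  show "sint \<gamma> \<phi> = - (LINT t:{a<..<b}|lborel. \<psi> t * sval \<gamma> {a<..t})"
    using set_integral_diff(2)[OF i1 i2]
    by (simp add: sval_def right_diff_distrib sint_def
        integral_eq_neg_integral_cdf[OF 1 \<psi> zero \<phi>] integral_eq_neg_integral_cdf[OF 2 \<psi> zero \<phi>])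
qed

lemma set_integral_Icc_eq:
  fixes f :: "real \<Rightarrow> real"
  assumes [measurable]: "f \<in> borel_measurable borel"
  shows "(LINT t:{p<..q}|lborel. f t) = (LINT t:{p..q}|lborel. f t)"
    and "(LINT t:{p<..<q}|lborel. f t) = (LINT t:{p..q}|lborel. f t)"
proof -
  have "AE t in lborel. indicator {p<..q} t *\<^sub>R f t = indicator {p..q} t *\<^sub>R f t"
    using AE_lborel_singleton[of p] by eventually_elim (auto simp: indicator_def)
  then show "(LINT t:{p<..q}|lborel. f t) = (LINT t:{p..q}|lborel. f t)"
    unfolding set_lebesgue_integral_def by (intro integral_cong_AE) auto
  have "AE t in lborel. indicator {p<..<q} t *\<^sub>R f t = indicator {p..q} t *\<^sub>R f t"
    using AE_lborel_singleton[of p] AE_lborel_singleton[of q]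
    by eventually_elim (auto simp: indicator_def)
  then show "(LINT t:{p<..<q}|lborel. f t) = (LINT t:{p..q}|lborel. f t)"
    unfolding set_lebesgue_integral_def by (intro integral_cong_AE) auto
qed

lemma set_integral_FTC:
  fixes F f :: "real \<Rightarrow> real"
  assumes "p \<le> q" "\<And>x. (F has_real_derivative f x) (at x)" "\<And>x. isCont f x"
  shows "(LINT t:{p<..q}|lborel. f t) = F q - F p"
proof -
  have "continuous_on UNIV f" using assms(3) by (simp add: continuous_at_imp_continuous_on)
  then have [measurable]: "f \<in> borel_measurable borel" by (rule borel_measurable_continuous_onI)
  have "(\<integral>x. f x * indicator {p..q} x \<partial>lborel) = F q - F p"
    using assms by (intro integral_FTC_Icc_real) auto
  then have "(LINT t:{p..q}|lborel. f t) = F q - F p"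
    by (simp add: set_lebesgue_integral_def mult.commute)
  then show ?thesis by (simp add: set_integral_Icc_eq)
qed

lemma Cc1_deriv:
  assumes "Cc1 a b \<phi>"
  shows "\<And>x. (\<phi> has_real_derivative deriv \<phi> x) (at x)" "\<And>x. isCont (deriv \<phi>) x"
proof -
  from assms obtain D where D: "\<And>x. (\<phi> has_vector_derivative D x) (at x)" "continuous_on UNIV D"
    unfolding Cc1_def C1_differentiable_on_def by auto
  then have D': "(\<phi> has_real_derivative D x) (at x)" for x
    by (simp add: has_real_derivative_iff_has_vector_derivative)
  then have "deriv \<phi> = D" by (auto intro!: ext DERIV_imp_deriv)
  then show "\<And>x. (\<phi> has_real_derivative deriv \<phi> x) (at x)" "\<And>x. isCont (deriv \<phi>) x"
    using D' D(2) by (auto simp: continuous_on_eq_continuous_at)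
qed

text \<open>Compact support gives value 0 at both endpoints, so the derivative has mean zero and
  \<open>\<phi>\<close> is its primitive from \<open>a\<close>. Smooth test functions thereby meet
  the hypotheses of \<open>sint_eq_neg_integral\<close>, just as the functions of
  \<open>W1p0_ball\<close> do.\<close>

lemma Cc1_rep:
  assumes "Cc1 a b \<phi>"
  shows "deriv \<phi> \<in> borel_measurable borel" "\<exists>B. \<forall>x. \<bar>deriv \<phi> x\<bar> \<le> B"
    "set_integrable lborel {a<..<b} (deriv \<phi>)"
    "(LINT x:{a<..<b}|lborel. deriv \<phi> x) = 0"
    "\<forall>x\<in>{a<..<b}. \<phi> x = (LINT t:{a<..x}|lborel. deriv \<phi> t)"
proof -
  note d = Cc1_deriv[OF assms]
  have co: "continuous_on A (deriv \<phi>)" for A using d(2) by (simp add: continuous_at_imp_continuous_on)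
  then show m[measurable]: "deriv \<phi> \<in> borel_measurable borel" by (intro borel_measurable_continuous_onI)
  obtain c e where c: "a < c" "c \<le> e" "e < b" "\<And>x. x \<notin> {c..e} \<Longrightarrow> \<phi> x = 0"
    using assms unfolding Cc1_def by blast
  have z: "deriv \<phi> x = 0" if "x \<notin> {c..e}" for x
  proof -
    have "((\<lambda>x. 0) has_real_derivative deriv \<phi> x) (at x)"
    proof (rule has_field_derivative_transform_within_open[OF d(1)])
      show "open (- {c..e})" by auto
    qed (use that c in auto)
    then show ?thesis using DERIV_const DERIV_unique by blast
  qed
  have "compact (deriv \<phi> ` {c..e})" by (intro compact_continuous_image co compact_Icc)
  then obtain B where B: "\<And>x. x \<in> {c..e} \<Longrightarrow> \<bar>deriv \<phi> x\<bar> \<le> B"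
    using compact_imp_bounded bounded_iff by (metis imageI real_norm_def)
  have B': "\<bar>deriv \<phi> x\<bar> \<le> max B 0" for x using B[of x] z[of x] by (cases "x \<in> {c..e}") auto
  then show "\<exists>B. \<forall>x. \<bar>deriv \<phi> x\<bar> \<le> B" by blast
  show "set_integrable lborel {a<..<b} (deriv \<phi>)"
    unfolding set_integrable_def
  proof (rule Bochner_Integration.integrable_bound)
    show "integrable lborel (\<lambda>x. max B 0 * indicator {a<..<b} x)"
      using c by (intro integrable_mult_right integrable_real_indicator) auto
  qed (use B' in \<open>auto simp: indicator_def\<close>)
  have "\<phi> a = 0" "\<phi> b = 0" using c by auto
  then show "(LINT x:{a<..<b}|lborel. deriv \<phi> x) = 0"
    using set_integral_FTC[OF _ d, of a b] c by (simp add: set_integral_Icc_eq)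
  show "\<forall>x\<in>{a<..<b}. \<phi> x = (LINT t:{a<..x}|lborel. deriv \<phi> t)"
    using set_integral_FTC[OF _ d, of a] \<open>\<phi> a = 0\<close> by simp
qed

text \<open>Supplies test functions with a prescribed derivative: the primitive from
  \<open>c\<close> vanishes to the left by the support condition and to the right by the zero
  mean.\<close>

lemma Cc1_exists:
  assumes cd: "a < c" "c < e" "e < b" and cont: "\<And>x. isCont \<psi> x"
    and supp: "\<And>x. x \<notin> {c<..<e} \<Longrightarrow> \<psi> x = (0::real)"
    and zero: "(\<integral>x. \<psi> x \<partial>lborel) = 0"
  shows "\<exists>\<phi>. Cc1 a b \<phi> \<and> deriv \<phi> = \<psi>"
proof -
  obtain F where "\<And>x. (F has_vector_derivative \<psi> x) (at x)"
    using einterval_antiderivative[of "-\<infinity>" "\<infinity>" \<psi>] cont by auto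
  then have F: "(F has_real_derivative \<psi> x) (at x)" for x
    by (simp add: has_real_derivative_iff_has_vector_derivative)
  define \<phi> where "\<phi> x = F x - F c" for x
  have D: "(\<phi> has_real_derivative \<psi> x) (at x)" for x
    unfolding \<phi>_def by (auto intro!: derivative_eq_intros F)
  have "\<phi> x = 0" if "x \<notin> {c..e}" for x
  proof (cases "x < c")
    case True
    have "(LINT t:{x<..c}|lborel. \<psi> t) = 0"
      unfolding set_lebesgue_integral_def
      by (rule integral_eq_zero_AE) (auto simp: supp indicator_def)
    then show ?thesis using set_integral_FTC[OF _ F cont, of x c] True by (simp add: \<phi>_def)
  next
    case False
    then have "x > e" using that by auto
    have "indicator {c<..x} t *\<^sub>R \<psi> t = \<psi> t" for t
      using \<open>x > e\<close> supp[of t] by (cases "t \<in> {c<..<e}") auto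
    then have "(LINT t:{c<..x}|lborel. \<psi> t) = (\<integral>t. \<psi> t \<partial>lborel)"
      unfolding set_lebesgue_integral_def by presburger
    then show ?thesis using set_integral_FTC[OF _ F cont, of c x] \<open>x > e\<close> cd zero by (simp add: \<phi>_def)
  qed
  moreover have "\<phi> C1_differentiable_on UNIV"
    unfolding C1_differentiable_on_def using D cont
    by (auto simp: has_real_derivative_iff_has_vector_derivative[symmetric]
        intro!: exI[of _ \<psi>] continuous_at_imp_continuous_on)
  ultimately have "Cc1 a b \<phi>" unfolding Cc1_def using cd by (intro conjI exI[of _ c] exI[of _ e]) auto
  moreover have "deriv \<phi> = \<psi>" using D by (auto intro!: ext DERIV_imp_deriv)
  ultimately show ?thesis by blast
qed

text \<open>A product of two clipped ramps of slope \<open>k\<close>. It is continuous, vanishes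
  outside (s,t) and tends to the indicator of (s,t), so combinations of tents may serve as
  derivatives of test functions.\<close>

definition tent :: "real \<Rightarrow> real \<Rightarrow> nat \<Rightarrow> real \<Rightarrow> real" where
  "tent s t k x = min 1 (max 0 (real k * (x - s))) * min 1 (max 0 (real k * (t - x)))"

lemma isCont_tent: "isCont (tent s t k) x"
  unfolding tent_def by (intro continuous_intros)

lemma borel_measurable_tent [measurable]: "tent s t k \<in> borel_measurable borel"
  by (intro borel_measurable_continuous_onI continuous_at_imp_continuous_on ballI isCont_tent)

lemma tent_bounds: "0 \<le> tent s t k x" "tent s t k x \<le> 1"
  by (auto simp: tent_def intro!: mult_le_one)

lemma tent_eq_0:
  assumes "x \<notin> {s<..<t}"
  shows "tent s t k x = 0"
proof -
  have "real k * (x - s) \<le> 0 \<or> real k * (t - x) \<le> 0"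
    using assms by (auto simp: mult_nonneg_nonpos)
  then show ?thesis by (auto simp: tent_def)
qed

lemma tent_tendsto: "(\<lambda>k. tent s t k x) \<longlonglongrightarrow> indicator {s<..<t} x"
proof (cases "x \<in> {s<..<t}")
  case True
  have *: "\<forall>\<^sub>F k in sequentially. 1 \<le> real k * y" if "0 < y" for y
  proof -
    obtain N :: nat where N: "1 < real N * y" using ex_less_of_nat_mult[OF \<open>0 < y\<close>] by blast
    show ?thesis unfolding eventually_sequentially
    proof (intro exI allI impI)
      fix k assume "N \<le> k"
      then have "real N * y \<le> real k * y" using \<open>0 < y\<close> by (intro mult_right_mono) auto
      then show "1 \<le> real k * y" using N by linarith
    qed
  qed
  have "\<forall>\<^sub>F k in sequentially. tent s t k x = 1"
    using eventually_conj[OF *[of "x - s"] *[of "t - x"]] True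
    by (auto elim!: eventually_mono simp: tent_def)
  then show ?thesis using True by (simp add: tendsto_eventually)
next
  case False
  then show ?thesis by (simp add: tent_eq_0)
qed

lemma integral_tent_tendsto:
  fixes f :: "real \<Rightarrow> real"
  assumes f: "integrable lborel f"
  shows "(\<lambda>k. \<integral>x. f x * tent s t k x \<partial>lborel) \<longlonglongrightarrow> (LINT x:{s<..<t}|lborel. f x)"
proof -
  have [measurable]: "f \<in> borel_measurable borel" using f by auto
  have "(\<lambda>k. \<integral>x. f x * tent s t k x \<partial>lborel) \<longlonglongrightarrow> (\<integral>x. f x * indicator {s<..<t} x \<partial>lborel)"
  proof (rule integral_dominated_convergence[where w="\<lambda>x. \<bar>f x\<bar>"])
    show "AE x in lborel. (\<lambda>k. f x * tent s t k x) \<longlonglongrightarrow> f x * indicator {s<..<t} x"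
      by (intro AE_I2 tendsto_mult tendsto_const tent_tendsto)
    show "AE x in lborel. norm (f x * tent s t k x) \<le> \<bar>f x\<bar>" for k
      using tent_bounds[of s t k] by (auto simp: abs_mult intro!: mult_left_le)
  qed (use f in auto)
  then show ?thesis by (simp add: set_lebesgue_integral_def mult.commute)
qed

lemma integrable_mult_tent:
  fixes f :: "real \<Rightarrow> real"
  assumes "integrable lborel f"
  shows "integrable lborel (\<lambda>x. f x * tent s t k x)"
  by (rule Bochner_Integration.integrable_bound[OF assms])
     (use assms tent_bounds[of s t k] in \<open>auto simp: abs_mult intro!: mult_left_le\<close>)

text \<open>Two tents combined so that the mean is zero form the derivative of a test function.
  Hence the integral of \<open>z\<close> against a tent is a fixed multiple \<open>c\<close> of the
  integral of the tent. In the limit \<open>z - c\<close> integrates to zero over every inner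
  interval, then over every Borel set.\<close>

lemma du_Bois_Reymond:
  assumes ab: "a < b" and z: "set_integrable lborel {a<..<b} z"
    and orth: "\<And>\<phi>. Cc1 a b \<phi> \<Longrightarrow> (LINT x:{a<..<b}|lborel. z x * deriv \<phi> x) = 0"
  shows "\<exists>c. AE x in lborel. x \<in> {a<..<b} \<longrightarrow> z x = c"
proof -
  define y where "y x = indicator {a<..<b} x * z x" for x
  have y: "integrable lborel y" using z unfolding integrable_zero_ext y_def .
  \<comment> \<open>Multiplying by \<open>J\<close> changes no tent supported in [a,b] but supplies
    an integrable factor, so the lemmas on products with a tent also cover the tent alone.\<close>
  define J where "J x = (indicator {a<..<b} x :: real)" for x
  have J: "integrable lborel J" unfolding J_def using ab by (intro integrable_real_indicator) auto
  have Jt: "J x * tent s t k x = tent s t k x" if "a \<le> s" "t \<le> b" for s t k x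
    using that tent_eq_0[of x s t k] by (cases "x \<in> {s<..<t}") (auto simp: J_def indicator_def)
  define I where "I s t k = (\<integral>x. J x * tent s t k x \<partial>lborel)" for s t k
  have Ilim: "(\<lambda>k. I s t k) \<longlonglongrightarrow> t - s" if "a \<le> s" "s \<le> t" "t \<le> b" for s t
  proof -
    have "(LINT x:{s<..<t}|lborel. J x) = (\<integral>x. indicator {s<..<t} x \<partial>lborel)"
      unfolding set_lebesgue_integral_def
      using that by (intro Bochner_Integration.integral_cong) (auto simp: J_def indicator_def)
    also have "\<dots> = t - s" using that by simp
    finally show ?thesis using integral_tent_tendsto[OF J, of s t] by (simp add: I_def)
  qed
  \<comment> \<open>A reference tent on the middle third. \<open>k0\<close> is so large that its
    integral is positive, because that integral is the denominator of \<open>c\<close> and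
    \<open>r\<close>.\<close>
  define s0 t0 where "s0 = (2 * a + b) / 3" and "t0 = (a + 2 * b) / 3"
  have s0: "a < s0" "s0 < t0" "t0 < b" using ab by (auto simp: s0_def t0_def)
  have "\<forall>\<^sub>F k in sequentially. 0 < I s0 t0 k"
    using Ilim[of s0 t0] s0 by (intro order_tendstoD(1)) auto
  then obtain k0 where k0: "0 < I s0 t0 k0" by (auto simp: eventually_sequentially)
  define c where "c = (\<integral>x. y x * tent s0 t0 k0 x \<partial>lborel) / I s0 t0 k0"
  have key: "(\<integral>x. y x * tent s t k x \<partial>lborel) = c * I s t k" if st: "a < s" "s < t" "t < b" for s t k
  proof -
    \<comment> \<open>This ratio makes \<open>\<psi>\<close> integrate to zero.\<close>
    define r where "r = I s t k / I s0 t0 k0"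
    define \<psi> where "\<psi> x = tent s t k x - r * tent s0 t0 k0 x" for x
    have ti: "integrable lborel (tent s t k)" "(\<integral>x. tent s t k x \<partial>lborel) = I s t k"
      if "a < s" "t < b" for s t k
      using integrable_mult_tent[OF J, of s t k] that by (auto simp: Jt I_def)
    have "\<exists>\<phi>. Cc1 a b \<phi> \<and> deriv \<phi> = \<psi>"
    proof (rule Cc1_exists)
      show "a < min s s0" "min s s0 < max t t0" "max t t0 < b" using st s0 by auto
      show "isCont \<psi> x" for x unfolding \<psi>_def by (intro continuous_intros isCont_tent)
      show "\<psi> x = 0" if "x \<notin> {min s s0<..<max t t0}" for x
      proof -
        have "x \<notin> {s<..<t}" "x \<notin> {s0<..<t0}" using that by auto
        then show ?thesis by (simp add: \<psi>_def tent_eq_0)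
      qed
      have "(\<integral>x. \<psi> x \<partial>lborel) = I s t k - r * I s0 t0 k0"
        unfolding \<psi>_def using ti st s0 by simp
      then show "(\<integral>x. \<psi> x \<partial>lborel) = 0" using k0 by (simp add: r_def)
    qed
    then obtain \<phi> where \<phi>: "Cc1 a b \<phi>" "deriv \<phi> = \<psi>" by blast
    have "0 = (\<integral>x. y x * tent s t k x - r * (y x * tent s0 t0 k0 x) \<partial>lborel)"
      using orth[OF \<phi>(1)] unfolding \<phi>(2) set_lebesgue_integral_def
      by (simp add: y_def \<psi>_def algebra_simps)
    also have "\<dots> = (\<integral>x. y x * tent s t k x \<partial>lborel) - r * (\<integral>x. y x * tent s0 t0 k0 x \<partial>lborel)"
      using integrable_mult_tent[OF y] by simp
    finally show ?thesis by (simp add: c_def r_def)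
  qed
  have Ioo: "(LINT x:{s<..<t}|lborel. y x) = c * (t - s)" if st: "a < s" "s < t" "t < b" for s t
  proof (rule LIMSEQ_unique)
    show "(\<lambda>k. \<integral>x. y x * tent s t k x \<partial>lborel) \<longlonglongrightarrow> (LINT x:{s<..<t}|lborel. y x)"
      by (rule integral_tent_tendsto[OF y])
    show "(\<lambda>k. \<integral>x. y x * tent s t k x \<partial>lborel) \<longlonglongrightarrow> c * (t - s)"
      unfolding key[OF st] using Ilim[of s t] st by (intro tendsto_mult tendsto_const) auto
  qed
  define h where "h x = y x - c * J x" for x
  have h: "integrable lborel h" unfolding h_def using y J by auto
  have [measurable]: "y \<in> borel_measurable borel" "h \<in> borel_measurable borel" using y h by auto
  define m where "m = (a + b) / 2"
  have m: "a < m" "m < b" using ab by (auto simp: m_def)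
  have hz: "(LINT x:{s<..t}|lborel. h x) = 0" if st: "a < s" "s < t" "t < b" for s t
  proof -
    have "(LINT x:{s<..t}|lborel. h x) = (LINT x:{s<..<t}|lborel. h x)"
      by (simp add: set_integral_Icc_eq)
    also have "\<dots> = (LINT x:{s<..<t}|lborel. y x) - (LINT x:{s<..<t}|lborel. c * J x)"
      unfolding h_def by (intro set_integral_diff(2) set_integrable_of_integrable) (use y J in auto)
    also have "(LINT x:{s<..<t}|lborel. c * J x) = (LINT x:{s<..<t}|lborel. c)"
      using st by (intro set_lebesgue_integral_cong) (auto simp: J_def)
    also have "\<dots> = c * (t - s)" using st by (simp add: set_lebesgue_integral_def)
    finally show ?thesis using Ioo[OF st] by simp
  qed
  have "(LINT x:A|lborel. h x) = 0" if A: "A \<in> sets borel" "A \<subseteq> {a<..<b}" for A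
  proof (rule countably_additive_on_eq_zero[OF ab countably_additive_on_integral[OF h] _ A,
        where \<kappa>="LINT x:{a<..m}|lborel. h x"])
    \<comment> \<open>\<open>hz\<close> asks for a left end greater than \<open>a\<close>, so the
      distribution function is only shown to be constant, with its value at \<open>m\<close> in the
      role of \<kappa>.\<close>
    have "(LINT x:{a<..t}|lborel. h x) = (LINT x:{a<..m}|lborel. h x)" if "t \<in> {a<..<b}" for t
    proof -
      have *: "(LINT x:{a<..q}|lborel. h x) = (LINT x:{a<..p}|lborel. h x)" if "a < p" "p < q" "q < b" for p q
      proof -
        have "prim h q - prim h a = (LINT x:{a<..q}|lborel. h x)" "prim h p - prim h a = (LINT x:{a<..p}|lborel. h x)"
          "prim h q - prim h p = (LINT x:{p<..q}|lborel. h x)"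
          using that by (auto intro!: prim_diff h)
        then show ?thesis using hz[OF that] by simp
      qed
      show ?thesis using *[of t m] *[of m t] that m by (cases t m rule: linorder_cases) auto
    qed
    then show "AE t in lborel. t \<in> {a<..<b} \<longrightarrow> (LINT x:{a<..t}|lborel. h x) = (LINT x:{a<..m}|lborel. h x)"
      by simp
  qed
  then have hA: "(LINT x:A|lborel. h x) = 0" if "A \<in> sets borel" for A
  proof -
    have "(LINT x:A|lborel. h x) = (LINT x:A \<inter> {a<..<b}|lborel. h x)"
      unfolding set_lebesgue_integral_def
      by (intro Bochner_Integration.integral_cong) (auto simp: h_def y_def J_def indicator_def)
    then show ?thesis using \<open>\<And>A. A \<in> sets borel \<Longrightarrow> A \<subseteq> {a<..<b} \<Longrightarrow> (LINT x:A|lborel. h x) = 0\<close>[of "A \<inter> {a<..<b}"] that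
      by simp
  qed
  have "AE x in lborel. h x = 0"
    by (rule density_unique_real[OF h]) (auto simp: hA)
  then have "AE x in lborel. x \<in> {a<..<b} \<longrightarrow> z x = c"
    by eventually_elim (auto simp: h_def y_def J_def)
  then show ?thesis by blast
qed

subsection \<open>Compactness of primitives\<close>

text \<open>The primitives of the positive and negative parts are monotone and bounded by
  \<open>V\<close>, so Helly's theorem applies to each, the second time along the first subsequence.
  It gives convergence at continuity points of the limits, hence off a countable set.\<close>

lemma Helly_prim:
  fixes f :: "nat \<Rightarrow> real \<Rightarrow> real"
  assumes f: "\<And>n. integrable lborel (f n)" and V: "\<And>n. (\<integral>x. \<bar>f n x\<bar> \<partial>lborel) \<le> V"
  obtains s :: "nat \<Rightarrow> nat" and F G where "strict_mono s"
    "mono F" "\<And>x. continuous (at_right x) F" "\<And>x. \<bar>F x\<bar> \<le> V"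
    "mono G" "\<And>x. continuous (at_right x) G" "\<And>x. \<bar>G x\<bar> \<le> V"
    "AE x in lborel. (\<lambda>n. prim (f (s n)) x) \<longlonglongrightarrow> F x - G x"
proof -
  define p where "p n x = max 0 (f n x)" for n x
  define q where "q n x = max 0 (- f n x)" for n x
  have p: "integrable lborel (p n)" for n
    unfolding p_def by (rule Bochner_Integration.integrable_bound[OF f[of n]]) (use f in auto)
  have q: "integrable lborel (q n)" for n
    unfolding q_def by (rule Bochner_Integration.integrable_bound[OF f[of n]]) (use f in auto)
  have rc: "continuous (at_right x) (prim g)" if "integrable lborel g" for g x
    using isCont_prim[OF that] continuous_within_subset by blast
  have pq: "prim (f n) x = prim (p n) x - prim (q n) x" for n x
  proof -
    have "f n = (\<lambda>x. p n x - q n x)" by (auto simp: p_def q_def)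
    then show ?thesis using prim_diff_fun[OF p q] by metis
  qed
  have bp: "\<bar>prim (p n) x\<bar> \<le> V" for n x
  proof -
    have "\<bar>prim (p n) x\<bar> \<le> (\<integral>x. \<bar>p n x\<bar> \<partial>lborel)" by (rule prim_abs_le_integral[OF p])
    also have "\<dots> \<le> (\<integral>x. \<bar>f n x\<bar> \<partial>lborel)"
      using p f by (intro integral_mono integrable_abs) (auto simp: p_def)
    finally show ?thesis using V[of n] by linarith
  qed
  have bq: "\<bar>prim (q n) x\<bar> \<le> V" for n x
  proof -
    have "\<bar>prim (q n) x\<bar> \<le> (\<integral>x. \<bar>q n x\<bar> \<partial>lborel)" by (rule prim_abs_le_integral[OF q])
    also have "\<dots> \<le> (\<integral>x. \<bar>f n x\<bar> \<partial>lborel)"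
      using q f by (intro integral_mono integrable_abs) (auto simp: q_def)
    finally show ?thesis using V[of n] by linarith
  qed
  obtain s F where s: "strict_mono (s :: nat \<Rightarrow> nat)" "\<And>x. continuous (at_right x) F" "mono F" "\<And>x. \<bar>F x\<bar> \<le> V"
    "\<And>x. continuous (at x) F \<Longrightarrow> (\<lambda>n. prim (p (s n)) x) \<longlonglongrightarrow> F x"
    using Helly_selection[of "\<lambda>n. prim (p n)" V] rc[OF p] mono_prim[OF p] bp by (auto simp: p_def)
  obtain s' G where s': "strict_mono (s' :: nat \<Rightarrow> nat)" "\<And>x. continuous (at_right x) G" "mono G" "\<And>x. \<bar>G x\<bar> \<le> V"
    "\<And>x. continuous (at x) G \<Longrightarrow> (\<lambda>n. prim (q (s (s' n))) x) \<longlonglongrightarrow> G x"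
    using Helly_selection[of "\<lambda>n. prim (q (s n))" V] rc[OF q] mono_prim[OF q] bq by (auto simp: q_def)
  have AEc: "AE x in lborel. isCont H x" if "mono H" for H :: "real \<Rightarrow> real"
    using AE_not_in[OF countable_imp_null_set_lborel[OF mono_ctble_discont[OF that]]] by simp
  have "AE x in lborel. (\<lambda>n. prim (f (s (s' n))) x) \<longlonglongrightarrow> F x - G x"
    using AEc[OF s(3)] AEc[OF s'(3)]
  proof eventually_elim
    case (elim x)
    have "(\<lambda>n. prim (p (s (s' n))) x) \<longlonglongrightarrow> F x"
      using LIMSEQ_subseq_LIMSEQ[OF s(5)[OF elim(1)] s'(1)] by (simp add: comp_def)
    then show ?case unfolding pq by (intro tendsto_diff s'(5) elim)
  qed
  moreover have "strict_mono (s \<circ> s')" using s(1) s'(1) by (rule strict_mono_o)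
  ultimately show thesis
    by (intro that[of "s \<circ> s'" F G] s(2-4) s'(2-4)) (simp_all add: comp_def)
qed

text \<open>Midpoints suffice for the parallelogram identity, so this replaces the convex hull of a tail of \<open>w\<close>.\<close>

inductive_set midpoint_hull :: "(nat \<Rightarrow> real \<Rightarrow> real) \<Rightarrow> nat \<Rightarrow> (real \<Rightarrow> real) set" for w n where
  base: "n \<le> m \<Longrightarrow> w m \<in> midpoint_hull w n"
| mid: "f \<in> midpoint_hull w n \<Longrightarrow> g \<in> midpoint_hull w n \<Longrightarrow> (\<lambda>x. (f x + g x) / 2) \<in> midpoint_hull w n"

lemma midpoint_hull_antimono:
  assumes "n \<le> m"
  shows "midpoint_hull w m \<subseteq> midpoint_hull w n"
proof
  fix f assume "f \<in> midpoint_hull w m"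
  then show "f \<in> midpoint_hull w n"
    by induction (use assms in \<open>auto intro: midpoint_hull.intros\<close>)
qed

text \<open>The third part is the parallelogram identity: if \<open>f\<close> and \<open>g\<close>
  are nearly minimal and their midpoint cannot be much smaller, then \<open>f\<close> and
  \<open>g\<close> are close.\<close>

lemma square_integrable_midpoint:
  fixes f g :: "real \<Rightarrow> real"
  assumes "f \<in> borel_measurable borel" "g \<in> borel_measurable borel"
    and f: "integrable lborel (\<lambda>x. (f x)\<^sup>2)" and g: "integrable lborel (\<lambda>x. (g x)\<^sup>2)"
  shows "integrable lborel (\<lambda>x. ((f x + g x) / 2)\<^sup>2)" "integrable lborel (\<lambda>x. (f x - g x)\<^sup>2)"
    and "(\<integral>x. (f x - g x)\<^sup>2 \<partial>lborel)
      = 2 * (\<integral>x. (f x)\<^sup>2 \<partial>lborel) + 2 * (\<integral>x. (g x)\<^sup>2 \<partial>lborel) - 4 * (\<integral>x. ((f x + g x) / 2)\<^sup>2 \<partial>lborel)"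
proof -
  have [measurable]: "f \<in> borel_measurable borel" "g \<in> borel_measurable borel" by fact+
  have fg: "integrable lborel (\<lambda>x. 2 * (f x)\<^sup>2 + 2 * (g x)\<^sup>2)" using f g by auto
  have le: "((x + y) / 2)\<^sup>2 \<le> 2 * x\<^sup>2 + 2 * y\<^sup>2" for x y :: real
  proof -
    have "2 * x\<^sup>2 + 2 * y\<^sup>2 - ((x + y) / 2)\<^sup>2 = (x - y)\<^sup>2 / 4 + 3/2 * x\<^sup>2 + 3/2 * y\<^sup>2"
      by (simp add: power2_eq_square field_simps)
    moreover have "\<dots> \<ge> 0" by simp
    ultimately show ?thesis by linarith
  qed
  show i1: "integrable lborel (\<lambda>x. ((f x + g x) / 2)\<^sup>2)"
    by (rule Bochner_Integration.integrable_bound[OF fg]) (auto simp: le simp del: power_divide)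
  have eq: "(f x - g x)\<^sup>2 = 2 * (f x)\<^sup>2 + 2 * (g x)\<^sup>2 - 4 * ((f x + g x) / 2)\<^sup>2" for x
    by (simp add: power2_eq_square field_simps)
  show "integrable lborel (\<lambda>x. (f x - g x)\<^sup>2)" unfolding eq using f g i1 by auto
  show "(\<integral>x. (f x - g x)\<^sup>2 \<partial>lborel)
      = 2 * (\<integral>x. (f x)\<^sup>2 \<partial>lborel) + 2 * (\<integral>x. (g x)\<^sup>2 \<partial>lborel) - 4 * (\<integral>x. ((f x + g x) / 2)\<^sup>2 \<partial>lborel)"
    unfolding eq using f g i1 by (simp del: power_divide)
qed

text \<open>By Tonelli the sum of the moduli has finite integral, so it is finite almost everywhere.
  Applied to the increments of a rapidly converging subsequence.\<close>

lemma AE_summable_of_summable_integral: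
  fixes y :: "nat \<Rightarrow> real \<Rightarrow> real"
  assumes y: "\<And>j. integrable lborel (y j)" and S: "summable (\<lambda>j. \<integral>x. \<bar>y j x\<bar> \<partial>lborel)"
  shows "AE x in lborel. summable (\<lambda>j. \<bar>y j x\<bar>)"
proof -
  have [measurable]: "y j \<in> borel_measurable borel" for j using y[of j] by auto
  have "(\<integral>\<^sup>+x. (\<Sum>j. ennreal \<bar>y j x\<bar>) \<partial>lborel) = (\<Sum>j. \<integral>\<^sup>+x. ennreal \<bar>y j x\<bar> \<partial>lborel)"
    by (rule nn_integral_suminf) auto
  also have "\<dots> = (\<Sum>j. ennreal (\<integral>x. \<bar>y j x\<bar> \<partial>lborel))"
    using y by (simp add: nn_integral_eq_integral)
  also have "\<dots> = ennreal (\<Sum>j. \<integral>x. \<bar>y j x\<bar> \<partial>lborel)"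
    by (rule suminf_ennreal2[OF _ S]) auto
  finally have "(\<integral>\<^sup>+x. (\<Sum>j. ennreal \<bar>y j x\<bar>) \<partial>lborel) \<noteq> \<infinity>" by simp
  then have "AE x in lborel. (\<Sum>j. ennreal \<bar>y j x\<bar>) \<noteq> \<infinity>"
    by (intro nn_integral_noteq_infinite) auto
  then show ?thesis by eventually_elim (auto intro: summable_suminf_not_top)
qed

text \<open>Near-minimisers of the \<open>L\<^sup>2\<close> norm in the hulls of the tails form a Cauchy sequence; their primitives have
  the same pointwise limit as those of \<open>w\<close>, and a subsequence converges to the required \<open>w0\<close>.\<close>

lemma weak_L2_limit:
  fixes w :: "nat \<Rightarrow> real \<Rightarrow> real"
  assumes ab: "a < b" and w: "\<And>n. integrable lborel (w n)"
    and w2: "\<And>n. integrable lborel (\<lambda>x. (w n x)\<^sup>2)" and bd: "\<And>n. (\<integral>x. (w n x)\<^sup>2 \<partial>lborel) \<le> C"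
    and supp: "\<And>n x. x \<notin> {a<..<b} \<Longrightarrow> w n x = 0"
    and conv: "AE x in lborel. (\<lambda>n. prim (w n) x) \<longlonglongrightarrow> W x"
  shows "\<exists>w0. integrable lborel w0 \<and> integrable lborel (\<lambda>x. (w0 x)\<^sup>2) \<and>
    (\<forall>x. x \<notin> {a<..<b} \<longrightarrow> w0 x = 0) \<and> (AE x in lborel. W x = prim w0 x)"
proof -
  define N where "N f = (\<integral>x. (f x)\<^sup>2 \<partial>lborel)" for f :: "real \<Rightarrow> real"
  let ?H = "midpoint_hull w"
  have H: "integrable lborel f \<and> integrable lborel (\<lambda>x. (f x)\<^sup>2) \<and> N f \<le> C \<and> (\<forall>x. x \<notin> {a<..<b} \<longrightarrow> f x = 0)"
    if "f \<in> ?H n" for f n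
    using that
  proof induction
    case (base m)
    then show ?case using w w2 bd supp by (auto simp: N_def)
  next
    case (mid f g)
    have fm: "f \<in> borel_measurable borel" "g \<in> borel_measurable borel" using mid by auto
    note sq = square_integrable_midpoint[OF fm]
    have "0 \<le> N (\<lambda>x. f x - g x)" unfolding N_def by simp
    then have "N (\<lambda>x. (f x + g x) / 2) \<le> C" using sq(3) mid by (auto simp: N_def simp del: power_divide)
    then show ?case using mid sq(1) by auto
  qed
  have Hint: "f \<in> ?H n \<Longrightarrow> integrable lborel f" and Hsq: "f \<in> ?H n \<Longrightarrow> integrable lborel (\<lambda>x. (f x)\<^sup>2)"
    and HN: "f \<in> ?H n \<Longrightarrow> N f \<le> C" and Hsupp: "f \<in> ?H n \<Longrightarrow> x \<notin> {a<..<b} \<Longrightarrow> f x = 0" for f n x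
    using H by blast+
  \<comment> \<open>An interval is closed under midpoints, so bounds on the primitives of a tail
    pass to its whole hull.\<close>
  have Hprim: "l \<le> prim f x \<and> prim f x \<le> r"
    if "f \<in> ?H n" "\<And>m. n \<le> m \<Longrightarrow> l \<le> prim (w m) x \<and> prim (w m) x \<le> r" for f n x l r
    using that(1)
  proof induction
    case (base m) then show ?case using that(2) by blast
  next
    case (mid f g)
    have "prim (\<lambda>x. (f x + g x) / 2) x = (prim f x + prim g x) / 2"
      unfolding prim_def
      using set_integral_add(2)[OF set_integrable_of_integrable[OF Hint[OF mid(1)]]
          set_integrable_of_integrable[OF Hint[OF mid(2)]], of "{..x}"] by simp
    then show ?case using mid by auto
  qed
  define d where "d n = Inf (N ` ?H n)" for n
  have N0: "0 \<le> N f" for f unfolding N_def by simp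
  have ne: "N ` ?H n \<noteq> {}" for n using midpoint_hull.base[of n n w] by blast
  have bdd: "bdd_below (N ` ?H n)" for n using N0 by (intro bdd_belowI2[of _ 0]) auto
  have dle: "d n \<le> N f" if "f \<in> ?H n" for n f unfolding d_def by (intro cInf_lower bdd imageI that)
  have "incseq d" unfolding d_def
    by (intro incseq_SucI cInf_superset_mono ne bdd image_mono midpoint_hull_antimono) auto
  moreover have dC: "d n \<le> C" for n using dle[of "w n" n] HN[of "w n" n] midpoint_hull.base[of n n w] by force
  ultimately obtain L where L: "d \<longlonglongrightarrow> L" "\<And>n. d n \<le> L" using incseq_convergent[of d C] by blast
  have "\<exists>f. f \<in> ?H n \<and> N f < d n + 1 / real (Suc n)" for n
    using cInf_lessD[OF ne, of n "d n + 1 / real (Suc n)"] by (auto simp: d_def)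
  then obtain z where z: "\<And>n. z n \<in> ?H n" "\<And>n. N (z n) < d n + 1 / real (Suc n)" by metis
  \<comment> \<open>The squared norms of \<open>z n\<close> and \<open>z m\<close> are at most d n +
    1/(n+1) and L + 1/(n+1), while their midpoint lies in the hull of tail \<open>n\<close> and has
    squared norm at least \<open>d n\<close>. The parallelogram identity then yields
    \<open>e n\<close>.\<close>
  define e where "e n = 2 * (L - d n) + 4 / real (Suc n)" for n
  have zm: "z n \<in> borel_measurable borel" for n using Hint[OF z(1)[of n]] by auto
  have Ne: "N (\<lambda>x. z n x - z m x) \<le> e n" if "n \<le> m" for n m
  proof -
    have zmn: "z m \<in> ?H n" using midpoint_hull_antimono[OF that] z(1) by blast
    have "(\<lambda>x. (z n x + z m x) / 2) \<in> ?H n" by (rule midpoint_hull.mid[OF z(1) zmn])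
    then have "d n \<le> N (\<lambda>x. (z n x + z m x) / 2)" by (rule dle)
    moreover have "N (\<lambda>x. z n x - z m x) = 2 * N (z n) + 2 * N (z m) - 4 * N (\<lambda>x. (z n x + z m x) / 2)"
      unfolding N_def by (rule square_integrable_midpoint(3)[OF zm zm Hsq[OF z(1)] Hsq[OF z(1)]])
    moreover have "1 / real (Suc m) \<le> 1 / real (Suc n)" using that by (simp add: frac_le)
    ultimately show ?thesis using z(2)[of n] z(2)[of m] L(2)[of m] by (simp add: e_def)
  qed
  have "e \<longlonglongrightarrow> 0"
  proof -
    have "(\<lambda>n. 2 * (L - d n) + 4 / real (Suc n)) \<longlonglongrightarrow> 2 * (L - L) + 0"
      by (intro tendsto_intros L LIMSEQ_Suc[OF lim_const_over_n])
    then show ?thesis unfolding e_def by simp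
  qed
  then have "\<exists>K. \<forall>n\<ge>K. e n < (1/4) ^ j" for j :: nat
    using order_tendstoD(2)[of e 0 sequentially "(1/4)^j"] by (auto simp: eventually_sequentially)
  then obtain K where K: "\<And>j n. K j \<le> n \<Longrightarrow> e n < (1/4) ^ j" by metis
  \<comment> \<open>Summing makes \<open>k\<close> monotone, while \<open>k j\<close> is at least
    \<open>K j\<close> and at least \<open>j\<close>.\<close>
  define k where "k j = j + (\<Sum>i\<le>j. K i)" for j
  have kK: "K j \<le> k j" for j unfolding k_def by (intro trans_le_add2 member_le_sum) auto
  have kmono: "k j \<le> k (Suc j)" and kj: "j \<le> k j" for j by (auto simp: k_def)
  define y where "y j x = z (k (Suc j)) x - z (k j) x" for j x
  have y: "integrable lborel (y j)" for j unfolding y_def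
    by (intro Bochner_Integration.integrable_diff Hint[OF z(1)])
  have yN: "N (y j) \<le> (1/4) ^ j" for j
  proof -
    have "N (y j) = N (\<lambda>x. z (k j) x - z (k (Suc j)) x)" by (simp add: N_def y_def power2_commute)
    also have "\<dots> \<le> e (k j)" by (rule Ne[OF kmono])
    finally show ?thesis using K[OF kK, of j] by simp
  qed
  have yL1: "(\<integral>x. \<bar>y j x\<bar> \<partial>lborel) \<le> (b - a + 1) * (1/2) ^ j" for j
  proof -
    have J: "integrable lborel (indicator {a<..<b} :: real \<Rightarrow> real)"
      using ab by (intro integrable_real_indicator) auto
    have sq: "integrable lborel (\<lambda>x. (y j x)\<^sup>2)" unfolding y_def
      by (rule square_integrable_midpoint(2)[OF zm zm Hsq[OF z(1)] Hsq[OF z(1)]])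
    \<comment> \<open>The weights are balanced against \<open>N (y j) \<le> (1/4) ^ j\<close>: after
      integration both terms are multiples of (1/2)^j, which is summable.\<close>
    have pt: "\<bar>y j x\<bar> \<le> (1/2) ^ j * indicator {a<..<b} x + 2 ^ j * (y j x)\<^sup>2" for x
    proof (cases "x \<in> {a<..<b}")
      case True
      have "\<bar>t\<bar> \<le> (1/2) ^ j + 2 ^ j * t\<^sup>2" for t :: real
      proof (cases "\<bar>t\<bar> \<le> (1/2)^j")
        case True
        have "0 \<le> 2 ^ j * t\<^sup>2" by simp
        then show ?thesis using True by linarith
      next
        case False
        have "\<bar>t\<bar> = 2 ^ j * ((1/2) ^ j * \<bar>t\<bar>)" by (simp add: power_one_over)
        also have "\<dots> \<le> 2 ^ j * (\<bar>t\<bar> * \<bar>t\<bar>)" using False by (intro mult_left_mono mult_right_mono) auto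
        finally show ?thesis by (simp add: power2_eq_square add_increasing)
      qed
      then show ?thesis using True by simp
    next
      case False
      then show ?thesis using Hsupp[OF z(1), of x] by (simp add: y_def)
    qed
    have "(\<integral>x. \<bar>y j x\<bar> \<partial>lborel) \<le> (\<integral>x. (1/2) ^ j * indicator {a<..<b} x + 2 ^ j * (y j x)\<^sup>2 \<partial>lborel)"
      by (intro integral_mono pt) (use y J sq in auto)
    also have "\<dots> = (1/2) ^ j * (b - a) + 2 ^ j * N (y j)"
      using J sq ab by (simp add: N_def)
    also have "\<dots> \<le> (1/2) ^ j * (b - a) + 2 ^ j * (1/4) ^ j"
      by (intro add_left_mono mult_left_mono yN) auto
    also have "2 ^ j * (1/4) ^ j = (1/2 :: real) ^ j" by (simp flip: power_mult_distrib)
    finally show ?thesis by (simp add: algebra_simps)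
  qed
  have S: "summable (\<lambda>j. \<integral>x. \<bar>y j x\<bar> \<partial>lborel)"
  proof (rule summable_comparison_test'[of "\<lambda>j. (b - a + 1) * (1/2) ^ j" 0])
    show "summable (\<lambda>j. (b - a + 1) * (1/2 :: real) ^ j)" by (intro summable_mult summable_geometric) simp
  qed (use yL1 in auto)
  note AEs = AE_summable_of_summable_integral[OF y S]
  define g where "g x = \<bar>z (k 0) x\<bar> + (\<Sum>j. \<bar>y j x\<bar>)" for x
  have "integrable lborel (\<lambda>x. \<Sum>j. \<bar>y j x\<bar>)"
    using y AEs S by (intro integrable_suminf) auto
  then have g: "integrable lborel g" unfolding g_def using Hint[OF z(1)] by auto
  have tele: "z (k j) x = z (k 0) x + (\<Sum>i<j. y i x)" for j x
    by (induction j) (simp_all add: y_def)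
  \<comment> \<open>\<open>lim\<close> is total, so \<open>w0\<close> is defined and measurable
    everywhere and vanishes at every point outside the interval, not just almost everywhere.\<close>
  define w0 where "w0 x = lim (\<lambda>j. z (k j) x)" for x
  have w0m: "w0 \<in> borel_measurable lborel"
    unfolding w0_def using zm by (intro borel_measurable_lim_metric) simp
  have lim: "AE x in lborel. (\<lambda>j. z (k j) x) \<longlonglongrightarrow> w0 x \<and> (\<forall>j. \<bar>z (k j) x\<bar> \<le> g x)"
    using AEs
  proof eventually_elim
    case (elim x)
    have "summable (\<lambda>j. y j x)" by (rule summable_rabs_cancel[OF elim])
    then have "(\<lambda>j. \<Sum>i<j. y i x) \<longlonglongrightarrow> (\<Sum>i. y i x)" by (rule summable_LIMSEQ)
    then have "(\<lambda>j. z (k 0) x + (\<Sum>i<j. y i x)) \<longlonglongrightarrow> z (k 0) x + (\<Sum>i. y i x)"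
      by (intro tendsto_add tendsto_const)
    moreover have "(\<lambda>j. z (k j) x) = (\<lambda>j. z (k 0) x + (\<Sum>i<j. y i x))" using tele by blast
    ultimately have "(\<lambda>j. z (k j) x) \<longlonglongrightarrow> z (k 0) x + (\<Sum>i. y i x)" by simp
    then have 1: "(\<lambda>j. z (k j) x) \<longlonglongrightarrow> w0 x" unfolding w0_def by (metis limI)
    have "\<bar>z (k j) x\<bar> \<le> g x" for j
    proof -
      have "\<bar>z (k j) x\<bar> \<le> \<bar>z (k 0) x\<bar> + \<bar>\<Sum>i<j. y i x\<bar>" using tele[of j x] by linarith
      also have "\<bar>\<Sum>i<j. y i x\<bar> \<le> (\<Sum>i<j. \<bar>y i x\<bar>)" by (rule sum_abs)
      also have "\<dots> \<le> (\<Sum>i. \<bar>y i x\<bar>)" by (rule sum_le_suminf[OF elim]) auto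
      finally show ?thesis by (simp add: g_def)
    qed
    then show ?case using 1 by blast
  qed
  have w0: "integrable lborel w0"
    by (rule integrable_dominated_convergence[where w=g and s="\<lambda>j. z (k j)"])
       (use w0m zm g lim in \<open>auto elim: eventually_mono\<close>)
  have prim_lim: "(\<lambda>j. prim (z (k j)) x) \<longlonglongrightarrow> prim w0 x" for x
    unfolding prim_def set_lebesgue_integral_def
  proof (rule integral_dominated_convergence[where w=g])
    show "AE t in lborel. (\<lambda>j. indicator {..x} t *\<^sub>R z (k j) t) \<longlonglongrightarrow> indicator {..x} t *\<^sub>R w0 t"
      using lim by eventually_elim (intro tendsto_scaleR tendsto_const, blast)
    show "AE t in lborel. norm (indicator {..x} t *\<^sub>R z (k j) t) \<le> g t" for j
      using lim
    proof eventually_elim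
      case (elim t)
      then have "\<bar>z (k j) t\<bar> \<le> g t" by blast
      then show ?case by (cases "t \<le> x") auto
    qed
  qed (use w0m zm g in auto)
  have "(\<integral>\<^sup>+x. ennreal ((w0 x)\<^sup>2) \<partial>lborel) \<le> ennreal C"
  proof -
    have "(\<integral>\<^sup>+x. ennreal ((w0 x)\<^sup>2) \<partial>lborel) = (\<integral>\<^sup>+x. liminf (\<lambda>j. ennreal ((z (k j) x)\<^sup>2)) \<partial>lborel)"
    proof (rule nn_integral_cong_AE)
      show "AE x in lborel. ennreal ((w0 x)\<^sup>2) = liminf (\<lambda>j. ennreal ((z (k j) x)\<^sup>2))"
        using lim
      proof eventually_elim
        case (elim x)
        then have "(\<lambda>j. ennreal ((z (k j) x)\<^sup>2)) \<longlonglongrightarrow> ennreal ((w0 x)\<^sup>2)"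
          by (intro tendsto_ennrealI tendsto_power) auto
        then show ?case by (intro lim_imp_Liminf[symmetric]) auto
      qed
    qed
    also have "\<dots> \<le> liminf (\<lambda>j. \<integral>\<^sup>+x. ennreal ((z (k j) x)\<^sup>2) \<partial>lborel)"
      using zm by (intro nn_integral_liminf) auto
    also have "\<dots> \<le> liminf (\<lambda>j::nat. ennreal C)"
    proof (intro Liminf_mono always_eventually allI)
      fix j
      have "(\<integral>\<^sup>+x. ennreal ((z (k j) x)\<^sup>2) \<partial>lborel) = ennreal (N (z (k j)))"
        unfolding N_def by (intro nn_integral_eq_integral Hsq[OF z(1)]) auto
      also have "\<dots> \<le> ennreal C" by (intro ennreal_leI HN[OF z(1)])
      finally show "(\<integral>\<^sup>+x. ennreal ((z (k j) x)\<^sup>2) \<partial>lborel) \<le> ennreal C" .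
    qed
    finally show ?thesis by (simp add: Liminf_const)
  qed
  then have w02: "integrable lborel (\<lambda>x. (w0 x)\<^sup>2)"
    using w0m by (intro integrableI_nonneg) (auto simp: le_less_trans)
  have "AE x in lborel. W x = prim w0 x"
    using conv
  proof eventually_elim
    case (elim x)
    \<comment> \<open>Once the tail of \<open>prim (w m) x\<close> lies in a small interval around
      \<open>W x\<close>, \<open>Hprim\<close> confines \<open>prim (z n) x\<close> to the same
      interval.\<close>
    have "(\<lambda>n. prim (z n) x) \<longlonglongrightarrow> W x"
    proof (rule LIMSEQ_I)
      fix r :: real assume "0 < r"
      then obtain n0 where n0: "\<And>n. n \<ge> n0 \<Longrightarrow> \<bar>prim (w n) x - W x\<bar> < r / 2"
        using LIMSEQ_D[OF elim, of "r/2"] by auto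
      have "\<bar>prim (z n) x - W x\<bar> < r" if "n \<ge> n0" for n
      proof -
        have "W x - r/2 \<le> prim (z n) x \<and> prim (z n) x \<le> W x + r/2"
        proof (rule Hprim[OF z(1)])
          fix m assume "n \<le> m"
          then show "W x - r/2 \<le> prim (w m) x \<and> prim (w m) x \<le> W x + r/2"
            using n0[of m] \<open>n \<ge> n0\<close> unfolding abs_less_iff by linarith
        qed
        then show ?thesis using \<open>0 < r\<close> by auto
      qed
      then show "\<exists>no. \<forall>n\<ge>no. norm (prim (z n) x - W x) < r" by auto
    qed
    moreover have "filterlim k at_top sequentially"
      by (rule filterlim_at_top_mono[OF filterlim_ident]) (simp add: kj)
    ultimately have "(\<lambda>j. prim (z (k j)) x) \<longlonglongrightarrow> W x" by (rule filterlim_compose)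
    then show ?case using prim_lim LIMSEQ_unique by blast
  qed
  moreover have "w0 x = 0" if "x \<notin> {a<..<b}" for x
    using Hsupp[OF z(1) that] by (simp add: w0_def)
  ultimately show ?thesis using w0 w02 by blast
qed

section \<open>Averages over short intervals\<close>

text \<open>With an antiderivative F of \<open>f\<close>, both sides are the increment of F(t + h) -
  F(t) from \<open>p\<close> to \<open>x\<close>. After division by \<open>h\<close>, a difference
  quotient integrates to a difference of two averages.\<close>

lemma integral_shift_diff:
  fixes f :: "real \<Rightarrow> real"
  assumes f: "\<And>x. isCont f x" and "p \<le> x" "0 \<le> h"
  shows "(LINT t:{p<..x}|lborel. f (t + h) - f t)
    = (LINT t:{x<..x+h}|lborel. f t) - (LINT t:{p<..p+h}|lborel. f t)"
proof -
  obtain F where "\<And>x. (F has_vector_derivative f x) (at x)"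
    using einterval_antiderivative[of "-\<infinity>" "\<infinity>" f] f by auto
  then have F: "(F has_real_derivative f x) (at x)" for x
    by (simp add: has_real_derivative_iff_has_vector_derivative)
  have "(LINT t:{p<..x}|lborel. f (t + h) - f t) = (F (x + h) - F x) - (F (p + h) - F p)"
  proof (rule set_integral_FTC[OF \<open>p \<le> x\<close>])
    show "((\<lambda>t. F (t + h) - F t) has_real_derivative f (t + h) - f t) (at t)" for t
      by (intro derivative_intros F DERIV_shift[THEN iffD1])
    show "isCont (\<lambda>t. f (t + h) - f t) t" for t
    proof (intro continuous_intros f)
      show "isCont (\<lambda>t. f (t + h)) t"
        by (rule continuous_at_compose[where f="\<lambda>t. t + h" and g=f, unfolded comp_def])
           (auto intro: f continuous_intros)
    qed
  qed
  then show ?thesis using set_integral_FTC[OF _ F f, of x "x + h"] set_integral_FTC[OF _ F f, of p "p + h"] \<open>0 \<le> h\<close>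
    by simp
qed

text \<open>The reference value \<open>r\<close> is free: \<open>r = 0\<close> bounds the average
  itself, and \<open>r = f x\<close> compares it with the point value.\<close>

lemma average_near:
  fixes f :: "real \<Rightarrow> real"
  assumes [measurable]: "f \<in> borel_measurable borel" and h: "0 < h"
    and near: "\<And>t. x < t \<Longrightarrow> t \<le> x + h \<Longrightarrow> \<bar>f t - r\<bar> \<le> B"
  shows "\<bar>(LINT t:{x<..x+h}|lborel. f t) / h - r\<bar> \<le> B"
proof -
  have J: "set_integrable lborel {x<..x+h} (\<lambda>t. s)" for s :: real
    using h unfolding set_integrable_def by (simp add: integrable_real_indicator)
  have Ji: "(LINT t:{x<..x+h}|lborel. s) = h * s" for s :: real
    using h by (simp add: set_lebesgue_integral_def)
  have di: "set_integrable lborel {x<..x+h} (\<lambda>t. f t - r)"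
    unfolding set_integrable_def
    by (rule Bochner_Integration.integrable_bound[OF J[of B, unfolded set_integrable_def]])
       (use near in \<open>auto simp: indicator_def intro: order_trans[OF _ abs_ge_self]\<close>)
  have "(LINT t:{x<..x+h}|lborel. (f t - r) + r) = (LINT t:{x<..x+h}|lborel. f t - r) + h * r"
    using set_integral_add(2)[OF di J, of r] Ji by simp
  then have d: "(LINT t:{x<..x+h}|lborel. f t - r) = (LINT t:{x<..x+h}|lborel. f t) - h * r" by simp
  have "\<bar>LINT t:{x<..x+h}|lborel. f t - r\<bar> \<le> (LINT t:{x<..x+h}|lborel. \<bar>f t - r\<bar>)"
    using set_integral_norm_bound[OF di] by simp
  also have "\<dots> \<le> (LINT t:{x<..x+h}|lborel. B)"
    using near by (intro set_integral_mono set_integrable_abs di J) auto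
  finally have "\<bar>(LINT t:{x<..x+h}|lborel. f t) - h * r\<bar> / h \<le> B"
    unfolding d Ji using h by (simp add: field_simps)
  moreover have "(LINT t:{x<..x+h}|lborel. f t) / h - r = ((LINT t:{x<..x+h}|lborel. f t) - h * r) / h"
    using h by (simp add: field_simps)
  ultimately show ?thesis using h by simp
qed

subsection \<open>Primitives of weak derivatives\<close>

text \<open>A finite value forces the first branch of \<open>energy\<close>, and the pair picked
  there is itself the witness, so no two admissible pairs have to be compared.\<close>

lemma energy_leD:
  assumes "energy a b c0 K \<epsilon> u \<gamma> \<le> ereal C0"
  shows "\<exists>v g. admissible a b K u \<gamma> v g \<and> energy_val a b c0 \<epsilon> v g \<le> C0"
proof -
  let ?p = "SOME p. admissible a b K u \<gamma> (fst p) (snd p)"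
  have ex: "\<exists>v g. admissible a b K u \<gamma> v g" using assms by (auto simp: energy_def split: if_splits)
  then have "\<exists>p. admissible a b K u \<gamma> (fst p) (snd p)" by auto
  then have "admissible a b K u \<gamma> (fst ?p) (snd ?p)" by (rule someI_ex)
  moreover have "energy_val a b c0 \<epsilon> (fst ?p) (snd ?p) \<le> C0" using assms ex by (simp add: energy_def)
  ultimately show ?thesis by blast
qed

text \<open>This is \<open>integral_eq_neg_integral_cdf\<close> for the measure with density
  \<open>f\<close> on (a,b), whose distribution function is the integral of
  \<open>f\<close>.\<close>

lemma integral_mult_antideriv_nonneg:
  fixes f :: "real \<Rightarrow> real"
  assumes f: "integrable lborel f" "\<And>x. 0 \<le> f x"
    and \<phi>m: "\<phi> \<in> borel_measurable borel"
    and \<psi>: "set_integrable lborel {a<..<b} \<psi>"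
    and zero: "(LINT x:{a<..<b}|lborel. \<psi> x) = 0"
    and \<phi>: "\<forall>x\<in>{a<..<b}. \<phi> x = (LINT t:{a<..x}|lborel. \<psi> t)"
  shows "(LINT x:{a<..<b}|lborel. f x * \<phi> x) = - (LINT t:{a<..<b}|lborel. \<psi> t * (LINT x:{a<..t}|lborel. f x))"
    and "set_integrable lborel {a<..<b} (\<lambda>t. \<psi> t * (LINT x:{a<..t}|lborel. f x))"
proof -
  define R where "R = restrict_space lborel {a<..<b}"
  define M where "M = density R (\<lambda>x. ennreal (f x))"
  have [measurable]: "f \<in> borel_measurable borel" "\<phi> \<in> borel_measurable borel" using f \<phi>m by auto
  have fR: "f \<in> borel_measurable R" "\<phi> \<in> borel_measurable R" unfolding R_def
    by (auto intro!: measurable_restrict_space1)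
  have sM: "sets M = sets (restrict_space borel {a<..<b})"
    unfolding M_def R_def by (auto simp: sets_restrict_space)
  have int: "(\<integral>x. h x \<partial>M) = (LINT x:{a<..<b}|lborel. f x * h x)" if "h \<in> borel_measurable R" for h :: "real \<Rightarrow> real"
    unfolding M_def using that fR f(2)
    by (subst integral_real_density)
       (auto simp: R_def integral_restrict_space set_lebesgue_integral_def)
  have fin: "finite_measure M"
  proof
    have "emeasure M (space M) = (\<integral>\<^sup>+x. ennreal (f x) \<partial>R)"
      unfolding M_def using fR by (auto simp: emeasure_density intro!: nn_integral_cong)
    also have "\<dots> = (\<integral>\<^sup>+x. ennreal (f x) * indicator {a<..<b} x \<partial>lborel)"
      unfolding R_def by (subst nn_integral_restrict_space) auto
    also have "\<dots> \<le> (\<integral>\<^sup>+x. ennreal (f x) \<partial>lborel)"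
      by (intro nn_integral_mono) (auto simp: indicator_def)
    also have "\<dots> = ennreal (\<integral>x. f x \<partial>lborel)" using f by (intro nn_integral_eq_integral) auto
    finally show "emeasure M (space M) \<noteq> \<infinity>" by (auto simp: top_unique)
  qed
  have cdf: "measure M {a<..t} = (LINT x:{a<..t}|lborel. f x)" if "t \<in> {a<..<b}" for t
  proof -
    have "{a<..t} \<subseteq> space M" unfolding space_eq_Ioo[OF sM] using that by force
    then have "measure M {a<..t} = (\<integral>x. indicator {a<..t} x \<partial>M)" by (simp add: Int_absorb2)
    also have "\<dots> = (LINT x:{a<..<b}|lborel. f x * indicator {a<..t} x)"
      by (rule int) (auto simp: R_def intro!: measurable_restrict_space1)
    also have "\<dots> = (LINT x:{a<..t}|lborel. f x)"
      unfolding set_lebesgue_integral_def using that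
      by (intro Bochner_Integration.integral_cong) (auto simp: indicator_def)
    finally show ?thesis .
  qed
  have "(LINT x:{a<..<b}|lborel. f x * \<phi> x) = (\<integral>x. \<phi> x \<partial>M)" by (rule int[OF fR(2), symmetric])
  also have "\<dots> = - (LINT t:{a<..<b}|lborel. \<psi> t * measure M {a<..t})"
    by (rule integral_eq_neg_integral_cdf[OF fin sM \<psi> zero \<phi>])
  also have "(LINT t:{a<..<b}|lborel. \<psi> t * measure M {a<..t})
      = (LINT t:{a<..<b}|lborel. \<psi> t * (LINT x:{a<..t}|lborel. f x))"
    by (intro set_lebesgue_integral_cong) (auto simp: cdf)
  finally show "(LINT x:{a<..<b}|lborel. f x * \<phi> x) = - (LINT t:{a<..<b}|lborel. \<psi> t * (LINT x:{a<..t}|lborel. f x))" .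
  have "set_integrable lborel {a<..<b} (\<lambda>t. \<psi> t * measure M {a<..t})"
    by (rule integrable_mult_cdf[OF fin sM \<psi>])
  then show "set_integrable lborel {a<..<b} (\<lambda>t. \<psi> t * (LINT x:{a<..t}|lborel. f x))"
    by (rule set_integrable_cong[THEN iffD1, rotated 3]) (auto simp: cdf)
qed

lemma Cc1_bounded:
  assumes "Cc1 a b \<phi>"
  shows "\<phi> \<in> borel_measurable borel" "\<exists>B. \<forall>x. \<bar>\<phi> x\<bar> \<le> B"
proof -
  have co: "continuous_on A \<phi>" for A
    using Cc1_deriv(1)[OF assms] by (meson DERIV_isCont continuous_at_imp_continuous_on)
  then show "\<phi> \<in> borel_measurable borel" by (intro borel_measurable_continuous_onI)
  obtain c e where c: "\<And>x. x \<notin> {c..e} \<Longrightarrow> \<phi> x = 0" using assms unfolding Cc1_def by blast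
  have "compact (\<phi> ` {c..e})" by (intro compact_continuous_image co compact_Icc)
  then obtain B where B: "\<And>x. x \<in> {c..e} \<Longrightarrow> \<bar>\<phi> x\<bar> \<le> B"
    using compact_imp_bounded bounded_iff by (metis imageI real_norm_def)
  have "\<bar>\<phi> x\<bar> \<le> max B 0" for x using B[of x] c[of x] by (cases "x \<in> {c..e}") auto
  then show "\<exists>B. \<forall>x. \<bar>\<phi> x\<bar> \<le> B" by blast
qed

lemma set_integrable_mult_bounded:
  fixes f g :: "real \<Rightarrow> real"
  assumes f: "set_integrable lborel A f" and g: "g \<in> borel_measurable borel" "\<And>x. \<bar>g x\<bar> \<le> B"
  shows "set_integrable lborel A (\<lambda>x. f x * g x)"
proof -
  have "integrable lborel (\<lambda>x. (indicator A x * f x) * g x)"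
  proof (rule Bochner_Integration.integrable_bound)
    show "integrable lborel (\<lambda>x. B * (indicator A x * f x))"
      using f by (intro integrable_mult_right) (simp add: integrable_zero_ext)
    show "(\<lambda>x. (indicator A x * f x) * g x) \<in> borel_measurable lborel"
      using f g by (intro borel_measurable_times[of "\<lambda>x. indicator A x * f x"]) (auto simp: integrable_zero_ext)
    show "AE x in lborel. norm (indicator A x * f x * g x) \<le> norm (B * (indicator A x * f x))"
    proof (rule AE_I2)
      fix x
      have "\<bar>g x\<bar> \<le> \<bar>B\<bar>" using g(2)[of x] by linarith
      then have "\<bar>indicator A x * f x\<bar> * \<bar>g x\<bar> \<le> \<bar>indicator A x * f x\<bar> * \<bar>B\<bar>" by (intro mult_left_mono) auto
      then show "norm (indicator A x * f x * g x) \<le> norm (B * (indicator A x * f x))"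
        by (simp add: abs_mult mult.commute mult.left_commute)
    qed
  qed
  then show ?thesis by (simp add: integrable_zero_ext mult.assoc)
qed

text \<open>Integration by parts for an integrable \<open>f\<close>, applied to its positive and
  negative parts as densities. The support condition makes the primitive from minus infinity agree
  with the one from \<open>a\<close>.\<close>

lemma integral_Cc1_eq_neg_prim:
  fixes f :: "real \<Rightarrow> real"
  assumes f: "integrable lborel f" and supp: "\<And>x. x \<notin> {a<..<b} \<Longrightarrow> f x = 0" and \<phi>: "Cc1 a b \<phi>"
  shows "(LINT x:{a<..<b}|lborel. f x * \<phi> x) = - (LINT t:{a<..<b}|lborel. deriv \<phi> t * prim f t)"
proof -
  define p where "p x = max 0 (f x)" for x
  define q where "q x = max 0 (- f x)" for x
  have p: "integrable lborel p" unfolding p_def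
    by (rule Bochner_Integration.integrable_bound[OF f]) (use f in auto)
  have q: "integrable lborel q" unfolding q_def
    by (rule Bochner_Integration.integrable_bound[OF f]) (use f in auto)
  have nn: "0 \<le> p x" "0 \<le> q x" for x by (auto simp: p_def q_def)
  have fpq: "f x = p x - q x" for x by (auto simp: p_def q_def)
  note rep = Cc1_rep(3-5)[OF \<phi>] and bd = Cc1_bounded[OF \<phi>]
  obtain B where B: "\<And>x. \<bar>\<phi> x\<bar> \<le> B" using bd(2) by blast
  note P = integral_mult_antideriv_nonneg[OF p nn(1) bd(1) rep]
  note Q = integral_mult_antideriv_nonneg[OF q nn(2) bd(1) rep]
  have "(LINT x:{a<..<b}|lborel. f x * \<phi> x) = (LINT x:{a<..<b}|lborel. p x * \<phi> x - q x * \<phi> x)"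
    by (simp add: fpq left_diff_distrib)
  also have "\<dots> = (LINT x:{a<..<b}|lborel. p x * \<phi> x) - (LINT x:{a<..<b}|lborel. q x * \<phi> x)"
    by (intro set_integral_diff(2) set_integrable_mult_bounded[OF _ bd(1) B] set_integrable_of_integrable p q) auto
  also have "\<dots> = - ((LINT t:{a<..<b}|lborel. deriv \<phi> t * (LINT x:{a<..t}|lborel. p x))
      - (LINT t:{a<..<b}|lborel. deriv \<phi> t * (LINT x:{a<..t}|lborel. q x)))"
    unfolding P(1) Q(1) by simp
  also have "\<dots> = - (LINT t:{a<..<b}|lborel. deriv \<phi> t * (LINT x:{a<..t}|lborel. p x)
      - deriv \<phi> t * (LINT x:{a<..t}|lborel. q x))"
    by (subst set_integral_diff(2)[OF P(2) Q(2)]) simp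
  also have "\<dots> = - (LINT t:{a<..<b}|lborel. deriv \<phi> t * prim f t)"
  proof -
    have "deriv \<phi> t * (LINT x:{a<..t}|lborel. p x) - deriv \<phi> t * (LINT x:{a<..t}|lborel. q x) = deriv \<phi> t * prim f t"
      if "t \<in> {a<..<b}" for t
    proof -
      have "prim f t = (LINT x:{a<..t}|lborel. f x)"
        unfolding prim_def set_lebesgue_integral_def
        using that supp by (intro Bochner_Integration.integral_cong) (auto simp: indicator_def)
      also have "\<dots> = (LINT x:{a<..t}|lborel. p x) - (LINT x:{a<..t}|lborel. q x)"
        unfolding fpq by (intro set_integral_diff(2) set_integrable_of_integrable p q) auto
      finally show ?thesis by (simp add: right_diff_distrib)
    qed
    then have "(LINT t:{a<..<b}|lborel. deriv \<phi> t * (LINT x:{a<..t}|lborel. p x)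
      - deriv \<phi> t * (LINT x:{a<..t}|lborel. q x)) = (LINT t:{a<..<b}|lborel. deriv \<phi> t * prim f t)"
      by (intro set_lebesgue_integral_cong) auto
    then show ?thesis by simp
  qed
  finally show ?thesis .
qed

lemma set_integrable_bounded:
  fixes f :: "real \<Rightarrow> real"
  assumes "f \<in> borel_measurable borel" "\<And>x. x \<in> {a<..<b} \<Longrightarrow> \<bar>f x\<bar> \<le> B"
  shows "set_integrable lborel {a<..<b} f"
  unfolding set_integrable_def
proof (rule Bochner_Integration.integrable_bound)
  have "emeasure lborel {a<..<b} < \<infinity>" by (cases "a \<le> b") auto
  then show "integrable lborel (\<lambda>x. B * indicator {a<..<b} x)"
    by (intro integrable_mult_right integrable_real_indicator) auto
qed (use assms in \<open>auto simp: indicator_def intro: order_trans[OF _ abs_ge_self]\<close>)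

text \<open>The primitive of \<open>v\<close> has the same weak derivative as \<open>u\<close>, so
  their difference is orthogonal to all derivatives of test functions.\<close>

lemma weak_deriv_prim:
  assumes ab: "a < b" and uv: "weak_deriv a b u v"
  shows "\<exists>c. AE x in lborel. x \<in> {a<..<b} \<longrightarrow> u x = c + prim (\<lambda>x. indicator {a<..<b} x * v x) x"
proof -
  define y where "y x = indicator {a<..<b} x * v x" for x
  have u: "set_integrable lborel {a<..<b} u" and v: "set_integrable lborel {a<..<b} v"
    and w: "\<And>\<phi>. Cc1 a b \<phi> \<Longrightarrow> (LINT x:{a<..<b}|lborel. u x * deriv \<phi> x) = - (LINT x:{a<..<b}|lborel. v x * \<phi> x)"
    using uv unfolding weak_deriv_def by auto
  have y: "integrable lborel y" using v unfolding y_def integrable_zero_ext .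
  have P: "set_integrable lborel {a<..<b} (prim y)"
    by (rule set_integrable_bounded[OF borel_measurable_prim[OF y] prim_abs_le_integral[OF y]])
  have "\<exists>c. AE x in lborel. x \<in> {a<..<b} \<longrightarrow> u x - prim y x = c"
  proof (rule du_Bois_Reymond[OF ab set_integral_diff(1)[OF u P]])
    fix \<phi> assume \<phi>: "Cc1 a b \<phi>"
    obtain B where B: "\<And>x. \<bar>deriv \<phi> x\<bar> \<le> B" using Cc1_rep(2)[OF \<phi>] by blast
    note m = set_integrable_mult_bounded[OF _ Cc1_rep(1)[OF \<phi>] B]
    have "(LINT x:{a<..<b}|lborel. v x * \<phi> x) = (LINT x:{a<..<b}|lborel. y x * \<phi> x)"
      by (intro set_lebesgue_integral_cong) (auto simp: y_def)
    also have "\<dots> = - (LINT t:{a<..<b}|lborel. deriv \<phi> t * prim y t)"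
      by (rule integral_Cc1_eq_neg_prim[OF y _ \<phi>]) (auto simp: y_def)
    finally have "(LINT x:{a<..<b}|lborel. u x * deriv \<phi> x) = (LINT t:{a<..<b}|lborel. prim y t * deriv \<phi> t)"
      using w[OF \<phi>] by (simp add: mult.commute)
    then show "(LINT x:{a<..<b}|lborel. (u x - prim y x) * deriv \<phi> x) = 0"
      using set_integral_diff(2)[OF m[OF u] m[OF P]] by (simp add: left_diff_distrib)
  qed
  then obtain c where "AE x in lborel. x \<in> {a<..<b} \<longrightarrow> u x - prim y x = c" by blast
  then have "AE x in lborel. x \<in> {a<..<b} \<longrightarrow> u x = c + prim y x"
    by eventually_elim auto
  then show ?thesis unfolding y_def by blast
qed

text \<open>A violation would persist on a neighbourhood of \<open>x\<close>, whose trace on (a,b)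
  has positive measure even when \<open>x\<close> is an endpoint. The value at \<open>a\<close>
  later bounds the constant of integration.\<close>

lemma AE_bound_continuous:
  fixes U :: "real \<Rightarrow> real"
  assumes ab: "a < b" and U: "\<And>x. isCont U x" and AE: "AE x in lborel. x \<in> {a<..<b} \<longrightarrow> \<bar>U x\<bar> \<le> K"
    and x: "x \<in> {a..b}"
  shows "\<bar>U x\<bar> \<le> K"
proof (rule ccontr)
  assume "\<not> ?thesis"
  then have "K < \<bar>U x\<bar>" by simp
  moreover have "((\<lambda>y. \<bar>U y\<bar>) \<longlongrightarrow> \<bar>U x\<bar>) (nhds x)"
    using U[of x] by (intro tendsto_rabs) (simp add: continuous_at_imp_continuous_at_within isCont_def tendsto_at_iff_tendsto_nhds)
  ultimately have "\<forall>\<^sub>F y in nhds x. K < \<bar>U y\<bar>" using order_tendstoD(1) by blast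
  then obtain r where r: "r > 0" "\<And>y. dist y x < r \<Longrightarrow> K < \<bar>U y\<bar>" by (auto simp: eventually_nhds_metric)
  have "max a (x - r) < min b (x + r)" using x r ab by auto
  from AE_lborel_ex_between[OF AE this] obtain y where
    "max a (x - r) < y" "y < min b (x + r)" "y \<in> {a<..<b} \<longrightarrow> \<bar>U y\<bar> \<le> K" by blast
  then have "\<bar>U y\<bar> \<le> K" "dist y x < r" by (auto simp: dist_real_def)
  then show False using r(2) by force
qed

subsection \<open>The energy estimate\<close>

text \<open>The window has length at most 2 \<epsilon>, and less near the endpoints, so \<epsilon>
  times the average is at least half the mass of \<open>\<bar>g\<bar>\<close> in it. Only the right
  half of the window is kept, to match forward differences.\<close>

lemma integral_avg_lower_bound:
  fixes g :: "real \<Rightarrow> real"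
  assumes ab: "a < b" and c0: "c0 > 0" and \<epsilon>: "\<epsilon> > 0" and g: "set_integrable lborel {a<..<b} g"
  defines "G \<equiv> prim (\<lambda>x. \<bar>indicator {a<..<b} x * g x\<bar>)"
  shows "set_integrable lborel {a<..<b} (\<lambda>x. fcut c0 (\<epsilon> * avg_abs a b \<epsilon> g x))"
    and "\<And>x. x \<in> {a<..<b} \<Longrightarrow> c0 * min ((G (x + \<epsilon>) - G x) / 2) 1 \<le> fcut c0 (\<epsilon> * avg_abs a b \<epsilon> g x)"
    and "\<And>x. 0 \<le> fcut c0 (\<epsilon> * avg_abs a b \<epsilon> g x)"
proof -
  define h where "h x = \<bar>indicator {a<..<b} x * g x\<bar>" for x
  have h: "integrable lborel h" using g unfolding h_def integrable_zero_ext by (rule integrable_abs)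
  have [measurable]: "h \<in> borel_measurable borel" using h by auto
  have G: "G = prim h" by (simp add: G_def h_def[abs_def])
  have Gm[measurable]: "G \<in> borel_measurable borel" unfolding G by (rule borel_measurable_prim[OF h])
  have "mono G" unfolding G by (rule mono_prim[OF h]) (simp add: h_def)
  have num: "(LINT t:({x-\<epsilon><..<x+\<epsilon>} \<inter> {a<..<b})|lborel. \<bar>g t\<bar>) = G (x + \<epsilon>) - G (x - \<epsilon>)" for x
  proof -
    have "(LINT t:({x-\<epsilon><..<x+\<epsilon>} \<inter> {a<..<b})|lborel. \<bar>g t\<bar>) = (LINT t:{x-\<epsilon><..<x+\<epsilon>}|lborel. h t)"
      unfolding set_lebesgue_integral_def
      by (intro Bochner_Integration.integral_cong) (auto simp: indicator_def h_def)
    also have "\<dots> = (LINT t:{x-\<epsilon><..x+\<epsilon>}|lborel. h t)" by (simp add: set_integral_Icc_eq)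
    also have "\<dots> = G (x + \<epsilon>) - G (x - \<epsilon>)" unfolding G using \<epsilon> by (intro prim_diff[OF h, symmetric]) auto
    finally show ?thesis .
  qed
  have nn: "0 \<le> avg_abs a b \<epsilon> g x" for x
    unfolding avg_abs_def num using monoD[OF \<open>mono G\<close>, of "x - \<epsilon>" "x + \<epsilon>"] \<epsilon> by simp
  then show "0 \<le> fcut c0 (\<epsilon> * avg_abs a b \<epsilon> g x)" for x
    unfolding fcut_def using c0 \<epsilon> by simp
  define D where "D x = min (x + \<epsilon>) b - max (x - \<epsilon>) a" for x
  have Dm: "measure lborel ({x-\<epsilon><..<x+\<epsilon>} \<inter> {a<..<b}) = D x" "0 < D x" "D x \<le> 2 * \<epsilon>" if "x \<in> {a<..<b}" for x
  proof -
    show "0 < D x" "D x \<le> 2 * \<epsilon>" using that \<epsilon> by (auto simp: D_def)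
    then show "measure lborel ({x-\<epsilon><..<x+\<epsilon>} \<inter> {a<..<b}) = D x"
      unfolding D_def Int_greaterThanLessThan by (intro measure_lborel_Ioo) linarith
  qed
  have avg: "avg_abs a b \<epsilon> g x = (G (x + \<epsilon>) - G (x - \<epsilon>)) / D x" if "x \<in> {a<..<b}" for x
    unfolding avg_abs_def num Dm(1)[OF that] ..
  show "c0 * min ((G (x + \<epsilon>) - G x) / 2) 1 \<le> fcut c0 (\<epsilon> * avg_abs a b \<epsilon> g x)" if "x \<in> {a<..<b}" for x
  proof -
    have n0: "0 \<le> G (x + \<epsilon>) - G (x - \<epsilon>)" using monoD[OF \<open>mono G\<close>, of "x - \<epsilon>" "x + \<epsilon>"] \<epsilon> by simp
    have "(G (x + \<epsilon>) - G x) / 2 \<le> (G (x + \<epsilon>) - G (x - \<epsilon>)) / 2"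
      using monoD[OF \<open>mono G\<close>, of "x - \<epsilon>" x] \<epsilon> by simp
    also have "\<dots> = \<epsilon> * ((G (x + \<epsilon>) - G (x - \<epsilon>)) / (2 * \<epsilon>))" using \<epsilon> by simp
    also have "\<dots> \<le> \<epsilon> * ((G (x + \<epsilon>) - G (x - \<epsilon>)) / D x)"
      using \<epsilon> n0 Dm(2,3)[OF that] by (intro mult_left_mono divide_left_mono) auto
    finally have "(G (x + \<epsilon>) - G x) / 2 \<le> \<epsilon> * avg_abs a b \<epsilon> g x" unfolding avg[OF that] .
    then show ?thesis unfolding fcut_def using c0 by (intro mult_left_mono min.mono) auto
  qed
  \<comment> \<open>\<open>A\<close> agrees with the integrand on the interval and is visibly
    measurable on the whole line.\<close>
  define A where "A x = fcut c0 (\<epsilon> * ((G (x + \<epsilon>) - G (x - \<epsilon>)) / D x))" for x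
  have Am: "A \<in> borel_measurable borel" unfolding A_def fcut_def D_def by measurable
  have "\<bar>A x\<bar> \<le> c0" if "x \<in> {a<..<b}" for x
  proof -
    have "A x = fcut c0 (\<epsilon> * avg_abs a b \<epsilon> g x)" by (simp add: A_def avg[OF that])
    moreover have "0 \<le> min (\<epsilon> * avg_abs a b \<epsilon> g x) 1" "min (\<epsilon> * avg_abs a b \<epsilon> g x) 1 \<le> 1" using nn[of x] \<epsilon> by auto
    ultimately show ?thesis using c0 by (simp add: fcut_def abs_mult)
  qed
  then have "set_integrable lborel {a<..<b} A" by (rule set_integrable_bounded[OF Am])
  then show "set_integrable lborel {a<..<b} (\<lambda>x. fcut c0 (\<epsilon> * avg_abs a b \<epsilon> g x))"
    by (rule set_integrable_cong[THEN iffD1, rotated 3]) (auto simp: A_def avg)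
qed

text \<open>Here \<open>f\<close> is the difference quotient of \<open>Z\<close> with step \<open>\<epsilon>\<close>, so that \<open>k + prim f x\<close> is the average of \<open>Z\<close>
  over \<open>(x, x + \<epsilon>)\<close>.\<close>

lemma energy_estimate:
  assumes ab: "a < b" and c0: "c0 > 0" and K: "K > 0" and C0: "C0 > 0" and \<epsilon>: "\<epsilon> > 0"
    and E: "energy a b c0 K \<epsilon> u \<gamma> \<le> ereal C0"
  defines "L \<equiv> 2 * K + (b - a) + C0"
  defines "V \<equiv> (2 + L) * C0 / c0"
  shows "\<exists>c k Z f w. \<bar>c\<bar> \<le> K \<and> \<bar>k\<bar> \<le> L \<and>
     integrable lborel w \<and> integrable lborel (\<lambda>x. (w x)\<^sup>2) \<and> (\<forall>x. x \<notin> {a<..<b} \<longrightarrow> w x = 0) \<and>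
     (\<integral>x. (w x)\<^sup>2 \<partial>lborel) \<le> C0 \<and> (\<integral>x. \<bar>w x\<bar> \<partial>lborel) \<le> b - a + C0 \<and>
     integrable lborel f \<and> (\<integral>x. \<bar>f x\<bar> \<partial>lborel) \<le> V \<and>
     Z \<in> borel_measurable borel \<and> (\<forall>x. \<bar>Z x\<bar> \<le> L) \<and>
     (LINT x:{a<..<b}|lborel. \<bar>Z x - k - prim f x\<bar>) \<le> \<epsilon> * V \<and>
     (AE x in lborel. x \<in> {a<..<b} \<longrightarrow> u x = c + Z x + prim w x) \<and>
     (\<forall>t\<in>{a<..<b}. sval \<gamma> {a<..t} = Z t)"
proof -
  obtain v g where adm: "admissible a b K u \<gamma> v g" and ev: "energy_val a b c0 \<epsilon> v g \<le> C0"
    using energy_leD[OF E] by blast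
  have uv: "weak_deriv a b u v" and uK: "Linf_bound a b K u" and dens: "has_density a b \<gamma> g"
    and sq: "set_integrable lborel {a<..<b} (\<lambda>x. (v x - g x)\<^sup>2)"
    using adm by (auto simp: admissible_def)
  have v: "set_integrable lborel {a<..<b} v" and g: "set_integrable lborel {a<..<b} g"
    using uv dens by (auto simp: weak_deriv_def has_density_def)
  define vh gh w where "vh = (\<lambda>x. indicator {a<..<b} x * v x)" and "gh = (\<lambda>x. indicator {a<..<b} x * g x)"
    and "w = (\<lambda>x. vh x - gh x)"
  have vh: "integrable lborel vh" using v unfolding vh_def integrable_zero_ext .
  have gh: "integrable lborel gh" using g unfolding gh_def integrable_zero_ext .
  have w: "integrable lborel w" unfolding w_def using vh gh by auto
  have wsq: "(w x)\<^sup>2 = indicator {a<..<b} x * (v x - g x)\<^sup>2" for x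
    by (auto simp: w_def vh_def gh_def indicator_def)
  have w2: "integrable lborel (\<lambda>x. (w x)\<^sup>2)" using sq unfolding wsq integrable_zero_ext .
  note avg = integral_avg_lower_bound[OF ab c0 \<epsilon> g]
  define T1 where "T1 = (LINT x:{a<..<b}|lborel. (v x - g x)\<^sup>2)"
  define T2 where "T2 = (LINT x:{a<..<b}|lborel. fcut c0 (\<epsilon> * avg_abs a b \<epsilon> g x))"
  have T: "T1 + 1 / \<epsilon> * T2 \<le> C0" using ev by (simp add: energy_val_def T1_def T2_def)
  have T1: "T1 = (\<integral>x. (w x)\<^sup>2 \<partial>lborel)" unfolding wsq T1_def set_lebesgue_integral_def by simp
  have "0 \<le> T1" unfolding T1 by simp
  have "0 \<le> T2" unfolding T2_def set_lebesgue_integral_def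
    using avg(3) by (intro integral_nonneg_AE) auto
  have w2C: "(\<integral>x. (w x)\<^sup>2 \<partial>lborel) \<le> C0"
  proof -
    have "0 \<le> 1 / \<epsilon> * T2" using \<open>0 \<le> T2\<close> \<epsilon> by simp
    then show ?thesis using T unfolding T1 by linarith
  qed
  have T2: "T2 \<le> \<epsilon> * C0"
  proof -
    have "1 / \<epsilon> * T2 \<le> C0" using T \<open>0 \<le> T1\<close> by linarith
    then show ?thesis using \<epsilon> by (simp add: field_simps)
  qed
  have J: "integrable lborel (indicator {a<..<b} :: real \<Rightarrow> real)"
    using ab by (intro integrable_real_indicator) auto
  \<comment> \<open>The summand \<open>b - a + C0\<close> of \<open>L\<close> comes from integrating
    \<open>\<bar>w\<bar> \<le> 1 + w\<^sup>2\<close> over the interval.\<close>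
  have wL1: "(\<integral>x. \<bar>w x\<bar> \<partial>lborel) \<le> b - a + C0"
  proof -
    have abs_le: "\<bar>t\<bar> \<le> 1 + t\<^sup>2" for t :: real
    proof -
      have "0 \<le> (\<bar>t\<bar> - 1/2)\<^sup>2" by simp
      then show ?thesis by (simp add: power2_diff power_divide)
    qed
    have "\<bar>w x\<bar> \<le> indicator {a<..<b} x + (w x)\<^sup>2" for x
      using abs_le[of "w x"] by (cases "x \<in> {a<..<b}") (auto simp: w_def vh_def gh_def)
    then have "(\<integral>x. \<bar>w x\<bar> \<partial>lborel) \<le> (\<integral>x. indicator {a<..<b} x + (w x)\<^sup>2 \<partial>lborel)"
      using w w2 J by (intro integral_mono) auto
    also have "\<dots> = b - a + (\<integral>x. (w x)\<^sup>2 \<partial>lborel)" using w2 J ab by simp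
    finally show ?thesis using w2C by simp
  qed
  define Z where "Z = prim gh"
  have Zc: "isCont Z x" for x unfolding Z_def by (rule isCont_prim[OF gh])
  have Zm: "Z \<in> borel_measurable borel" unfolding Z_def by (rule borel_measurable_prim[OF gh])
  have vgw: "prim vh x = Z x + prim w x" for x
    unfolding Z_def w_def prim_diff_fun[OF vh gh] by simp
  have prim_le_a: "prim F x = 0" if "x \<le> a" "\<And>t. t \<notin> {a<..<b} \<Longrightarrow> F t = 0" for F x
    unfolding prim_def set_lebesgue_integral_def using that
    by (intro integral_eq_zero_AE AE_I2) (auto simp: indicator_def)
  have prim_ge_b: "prim F x = prim F b" if "x \<ge> b" "\<And>t. t \<notin> {a<..<b} \<Longrightarrow> F t = 0" for F x
  proof -
    have "indicator {..x} t *\<^sub>R F t = indicator {..b} t *\<^sub>R F t" for t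
      using that by (cases "t \<in> {a<..<b}") (auto simp: indicator_def)
    then show ?thesis unfolding prim_def set_lebesgue_integral_def by presburger
  qed
  have vsupp: "t \<notin> {a<..<b} \<Longrightarrow> vh t = 0" and gsupp: "t \<notin> {a<..<b} \<Longrightarrow> gh t = 0" for t
    by (auto simp: vh_def gh_def)
  obtain c where c: "AE x in lborel. x \<in> {a<..<b} \<longrightarrow> u x = c + prim vh x"
    using weak_deriv_prim[OF ab uv] unfolding vh_def by blast
  \<comment> \<open>The bound is wanted for all real \<open>x\<close>, since \<open>Z\<close> is
    shifted past \<open>b\<close>. Outside [a,b] the primitive keeps its value at the nearer
    endpoint.\<close>
  have Ub: "\<bar>c + prim vh x\<bar> \<le> K" for x
  proof -
    have in_ab: "\<bar>c + prim vh x\<bar> \<le> K" if "x \<in> {a..b}" for x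
    proof (rule AE_bound_continuous[OF ab _ _ that, of "\<lambda>x. c + prim vh x"])
      show "isCont (\<lambda>x. c + prim vh x) x" for x by (intro continuous_intros isCont_prim vh)
      show "AE x in lborel. x \<in> {a<..<b} \<longrightarrow> \<bar>c + prim vh x\<bar> \<le> K"
        using c uK[unfolded Linf_bound_def] by eventually_elim auto
    qed
    consider "x \<le> a" | "x \<in> {a..b}" | "x \<ge> b" by fastforce
    then show ?thesis
    proof cases
      case 1
      then show ?thesis using in_ab[of a] ab prim_le_a[of x vh] prim_le_a[of a vh] vsupp by simp
    next
      case 2 then show ?thesis by (rule in_ab)
    next
      case 3
      then show ?thesis using in_ab[of b] ab prim_ge_b[of x vh] vsupp by simp
    qed
  qed
  have cK: "\<bar>c\<bar> \<le> K" using Ub[of a] prim_le_a[of a vh] vsupp by simp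
  \<comment> \<open>\<open>Z\<close> is \<open>prim vh - prim w\<close>: the first term oscillates
    by at most \<open>2 * K\<close>, the second by at most \<open>b - a + C0\<close>.\<close>
  have Zosc: "\<bar>Z x - Z y\<bar> \<le> L" for x y
  proof -
    have "\<bar>prim w x - prim w y\<bar> \<le> b - a + C0"
      using prim_abs_diff_le_integral[OF w, of x y] wL1 by linarith
    then show ?thesis using Ub[of x] Ub[of y] vgw[of x] vgw[of y] unfolding L_def by linarith
  qed
  have Za: "Z a = 0" unfolding Z_def using prim_le_a[of a gh] gsupp by simp
  have Zb: "\<bar>Z x\<bar> \<le> L" for x using Zosc[of x a] Za by simp
  have L0: "0 < L" unfolding L_def using ab K C0 by simp
  define G where "G = prim (\<lambda>x. \<bar>gh x\<bar>)"
  have gha: "integrable lborel (\<lambda>x. \<bar>gh x\<bar>)" using gh by auto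
  have Gm[measurable]: "G \<in> borel_measurable borel" unfolding G_def by (rule borel_measurable_prim[OF gha])
  have "mono G" unfolding G_def by (rule mono_prim[OF gha]) simp
  \<comment> \<open>Half the mass of \<open>\<bar>g\<bar>\<close> on the forward window, truncated
    at 1. The prefactor 1/\<epsilon> in the energy is what makes its integral of order
    \<epsilon>.\<close>
  define m where "m x = min ((G (x + \<epsilon>) - G x) / 2) 1" for x
  have mm[measurable]: "m \<in> borel_measurable borel" unfolding m_def by measurable
  have m0: "0 \<le> m x" for x using monoD[OF \<open>mono G\<close>, of x "x + \<epsilon>"] \<epsilon> by (simp add: m_def)
  have m1: "\<bar>m x\<bar> \<le> 1" for x using m0[of x] by (simp add: m_def)
  have mi: "set_integrable lborel {a<..<b} m" by (rule set_integrable_bounded[OF mm m1])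
  have mint: "(LINT x:{a<..<b}|lborel. m x) \<le> \<epsilon> * C0 / c0"
  proof -
    have "c0 * (LINT x:{a<..<b}|lborel. m x) = (LINT x:{a<..<b}|lborel. c0 * m x)" by simp
    also have "\<dots> \<le> T2" unfolding T2_def
    proof (intro set_integral_mono avg(1) set_integrable_mult_right mi)
      show "c0 * m x \<le> fcut c0 (\<epsilon> * avg_abs a b \<epsilon> g x)" if "x \<in> {a<..<b}" for x
        using avg(2)[OF that] unfolding m_def G_def gh_def .
    qed
    finally show ?thesis using T2 c0 by (simp add: field_simps)
  qed
  \<comment> \<open>Below the truncation the mass on the window equals \<open>2 * m x\<close>; above
    it \<open>m x = 1\<close> and the oscillation bound \<open>L\<close> takes over. The sum
    \<open>2 + L\<close> covers both cases.\<close>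
  have Zm_le: "\<bar>Z y - Z x\<bar> \<le> (2 + L) * m x" if "x \<le> y" "y \<le> x + \<epsilon>" for x y
  proof -
    have "\<bar>Z y - Z x\<bar> \<le> (LINT t:{x<..y}|lborel. \<bar>gh t\<bar>)" unfolding Z_def by (rule prim_abs_diff_le[OF gh that(1)])
    also have "\<dots> = G y - G x" unfolding G_def by (rule prim_diff[OF gha that(1), symmetric])
    also have "\<dots> \<le> G (x + \<epsilon>) - G x" using monoD[OF \<open>mono G\<close> that(2)] by simp
    finally have 1: "\<bar>Z y - Z x\<bar> \<le> G (x + \<epsilon>) - G x" .
    show ?thesis
    proof (cases "(G (x + \<epsilon>) - G x) / 2 \<le> 1")
      case True
      then have "m x = (G (x + \<epsilon>) - G x) / 2" by (simp add: m_def)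
      then have "G (x + \<epsilon>) - G x = 2 * m x" by simp
      moreover have "0 \<le> L * m x" using L0 m0[of x] by simp
      ultimately show ?thesis using 1 by (simp add: distrib_right)
    next
      case False
      then show ?thesis using Zosc[of y x] by (simp add: m_def)
    qed
  qed
  define f where "f x = indicator {a<..<b} x * ((Z (x + \<epsilon>) - Z x) / \<epsilon>)" for x
  have [measurable]: "Z \<in> borel_measurable borel" by (rule Zm)
  have "set_integrable lborel {a<..<b} (\<lambda>x. (Z (x + \<epsilon>) - Z x) / \<epsilon>)"
  proof (rule set_integrable_bounded)
    show "(\<lambda>x. (Z (x + \<epsilon>) - Z x) / \<epsilon>) \<in> borel_measurable borel" by measurable
    show "\<bar>(Z (x + \<epsilon>) - Z x) / \<epsilon>\<bar> \<le> L / \<epsilon>" for x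
      using Zosc[of "x + \<epsilon>" x] \<epsilon> by (simp add: divide_right_mono)
  qed
  then have f: "integrable lborel f" unfolding f_def integrable_zero_ext .
  have Veq: "(2 + L) * (\<epsilon> * C0 / c0) = \<epsilon> * V" by (simp add: V_def)
  have fV: "(\<integral>x. \<bar>f x\<bar> \<partial>lborel) \<le> V"
  proof -
    have mi': "integrable lborel (\<lambda>x. indicator {a<..<b} x * m x)" using mi unfolding integrable_zero_ext .
    have "(\<integral>x. \<bar>f x\<bar> \<partial>lborel) \<le> (\<integral>x. (2 + L) / \<epsilon> * (indicator {a<..<b} x * m x) \<partial>lborel)"
    proof (rule integral_mono)
      show "\<bar>f x\<bar> \<le> (2 + L) / \<epsilon> * (indicator {a<..<b} x * m x)" for x
        using Zm_le[of x "x + \<epsilon>"] \<epsilon> by (simp add: f_def indicator_def divide_right_mono)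
    qed (use f mi' in auto)
    also have "\<dots> = (2 + L) / \<epsilon> * (LINT x:{a<..<b}|lborel. m x)" by (simp add: set_lebesgue_integral_def)
    also have "\<dots> \<le> (2 + L) / \<epsilon> * (\<epsilon> * C0 / c0)" using L0 \<epsilon> by (intro mult_left_mono mint) auto
    also have "\<dots> = V" using \<epsilon> by (simp add: V_def)
    finally show ?thesis .
  qed
  note near = average_near[OF Zm \<epsilon>]
  \<comment> \<open>The average at the left end is the constant lost when the averages are recovered
    by integrating their derivative \<open>f\<close> from \<open>a\<close>.\<close>
  define k where "k = (LINT t:{a<..a+\<epsilon>}|lborel. Z t) / \<epsilon>"
  have kL: "\<bar>k\<bar> \<le> L" using near[of a 0 L] Zb by (simp add: k_def)
  have pf: "\<bar>Z x - k - prim f x\<bar> \<le> (2 + L) * m x" if x: "x \<in> {a<..<b}" for x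
  proof -
    have "prim f x = (LINT t:{a<..x}|lborel. (Z (t + \<epsilon>) - Z t) / \<epsilon>)"
      unfolding prim_def set_lebesgue_integral_def f_def
      using x by (intro Bochner_Integration.integral_cong) (auto simp: indicator_def)
    also have "\<dots> = (LINT t:{a<..x}|lborel. Z (t + \<epsilon>) - Z t) / \<epsilon>" by simp
    also have "\<dots> = (LINT t:{x<..x+\<epsilon>}|lborel. Z t) / \<epsilon> - k"
      using integral_shift_diff[OF Zc, of a x \<epsilon>] x \<epsilon> by (simp add: k_def diff_divide_distrib)
    finally have "Z x - k - prim f x = - ((LINT t:{x<..x+\<epsilon>}|lborel. Z t) / \<epsilon> - Z x)" by simp
    moreover have "\<bar>(LINT t:{x<..x+\<epsilon>}|lborel. Z t) / \<epsilon> - Z x\<bar> \<le> (2 + L) * m x"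
      by (rule near) (use Zm_le in auto)
    ultimately show ?thesis by (simp only: abs_minus_cancel)
  qed
  have L1: "(LINT x:{a<..<b}|lborel. \<bar>Z x - k - prim f x\<bar>) \<le> \<epsilon> * V"
  proof -
    have "set_integrable lborel {a<..<b} (\<lambda>x. Z x - k - prim f x)"
    proof (rule set_integrable_bounded)
      show "(\<lambda>x. Z x - k - prim f x) \<in> borel_measurable borel"
        using borel_measurable_prim[OF f] by measurable
      show "\<bar>Z x - k - prim f x\<bar> \<le> 2 + L" if "x \<in> {a<..<b}" for x
      proof -
        have "(2 + L) * m x \<le> (2 + L) * 1" using m1[of x] L0 by (intro mult_left_mono) auto
        then show ?thesis using pf[OF that] by simp
      qed
    qed
    then have "(LINT x:{a<..<b}|lborel. \<bar>Z x - k - prim f x\<bar>) \<le> (LINT x:{a<..<b}|lborel. (2 + L) * m x)"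
      using pf mi by (intro set_integral_mono set_integrable_abs set_integrable_mult_right) auto
    also have "\<dots> = (2 + L) * (LINT x:{a<..<b}|lborel. m x)" by simp
    also have "\<dots> \<le> (2 + L) * (\<epsilon> * C0 / c0)" using L0 by (intro mult_left_mono mint) auto
    finally show ?thesis unfolding Veq .
  qed
  have sv: "sval \<gamma> {a<..t} = Z t" if "t \<in> {a<..<b}" for t
  proof -
    have "sval \<gamma> {a<..t} = (LINT x:{a<..t}|lborel. g x)"
      using dens[unfolded has_density_def, THEN conjunct2, rule_format, of "{a<..t}"] that by force
    also have "\<dots> = Z t" unfolding Z_def prim_def set_lebesgue_integral_def gh_def
      using that by (intro Bochner_Integration.integral_cong) (auto simp: indicator_def)
    finally show ?thesis .
  qed
  have "AE x in lborel. x \<in> {a<..<b} \<longrightarrow> u x = c + Z x + prim w x"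
    using c unfolding vgw by (simp add: add.assoc)
  moreover have "\<forall>x. x \<notin> {a<..<b} \<longrightarrow> w x = 0" by (simp add: w_def vsupp gsupp)
  ultimately show ?thesis using cK kL w w2 w2C wL1 f fV Zm Zb L1 sv by blast
qed

subsection \<open>Convergence of measures from convergence of distribution functions\<close>

text \<open>A mean-zero \<open>\<psi>\<close> annihilates the constant \<open>\<kappa>\<close>, so
  only the remainder \<open>D\<close> of the distribution functions enters the estimate.\<close>

lemma sint_diff_le:
  assumes \<gamma>: "finite_smeasure a b \<gamma>" "finite_smeasure a b \<gamma>'"
    and D: "\<And>t. t \<in> {a<..<b} \<Longrightarrow> sval \<gamma> {a<..t} - sval \<gamma>' {a<..t} - \<kappa> = D t"
    and Dm: "D \<in> borel_measurable borel" "\<And>t. t \<in> {a<..<b} \<Longrightarrow> \<bar>D t\<bar> \<le> B"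
    and \<psi>: "set_integrable lborel {a<..<b} \<psi>"
    and zero: "(LINT x:{a<..<b}|lborel. \<psi> x) = 0"
    and \<phi>: "\<forall>x\<in>{a<..<b}. \<phi> x = (LINT t:{a<..x}|lborel. \<psi> t)"
  shows "\<bar>sint \<gamma> \<phi> - sint \<gamma>' \<phi>\<bar> \<le> (LINT t:{a<..<b}|lborel. \<bar>\<psi> t\<bar> * \<bar>D t\<bar>)"
    and "set_integrable lborel {a<..<b} (\<lambda>t. \<bar>\<psi> t\<bar> * \<bar>D t\<bar>)"
proof -
  note r1 = sint_eq_neg_integral[OF \<gamma>(1) \<psi> zero \<phi>] and r2 = sint_eq_neg_integral[OF \<gamma>(2) \<psi> zero \<phi>]
  have i1: "set_integrable lborel {a<..<b} (\<lambda>t. \<psi> t * sval \<gamma> {a<..t} - \<psi> t * sval \<gamma>' {a<..t})"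
    by (rule set_integral_diff(1)[OF r1(1) r2(1)])
  have i2: "set_integrable lborel {a<..<b} (\<lambda>t. \<psi> t * \<kappa>)" using \<psi> by simp
  have i3: "set_integrable lborel {a<..<b} (\<lambda>t. \<psi> t * D t)"
    by (rule set_integrable_cong[THEN iffD1, OF refl refl _ set_integral_diff(1)[OF i1 i2]])
       (auto simp: algebra_simps simp flip: D)
  have "sint \<gamma> \<phi> - sint \<gamma>' \<phi>
      = - (LINT t:{a<..<b}|lborel. \<psi> t * sval \<gamma> {a<..t} - \<psi> t * sval \<gamma>' {a<..t})"
    unfolding r1(2) r2(2) set_integral_diff(2)[OF r1(1) r2(1)] by simp
  also have "(LINT t:{a<..<b}|lborel. \<psi> t * sval \<gamma> {a<..t} - \<psi> t * sval \<gamma>' {a<..t})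
      = (LINT t:{a<..<b}|lborel. \<psi> t * D t + \<psi> t * \<kappa>)"
    by (intro set_lebesgue_integral_cong) (auto simp: algebra_simps simp flip: D)
  also have "\<dots> = (LINT t:{a<..<b}|lborel. \<psi> t * D t)"
    unfolding set_integral_add(2)[OF i3 i2] using zero by simp
  finally have "\<bar>sint \<gamma> \<phi> - sint \<gamma>' \<phi>\<bar> = \<bar>LINT t:{a<..<b}|lborel. \<psi> t * D t\<bar>" by simp
  also have "\<dots> \<le> (LINT t:{a<..<b}|lborel. \<bar>\<psi> t * D t\<bar>)"
    using set_integral_norm_bound[OF i3] by simp
  finally show "\<bar>sint \<gamma> \<phi> - sint \<gamma>' \<phi>\<bar> \<le> (LINT t:{a<..<b}|lborel. \<bar>\<psi> t\<bar> * \<bar>D t\<bar>)"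
    by (simp add: abs_mult)
  show "set_integrable lborel {a<..<b} (\<lambda>t. \<bar>\<psi> t\<bar> * \<bar>D t\<bar>)"
    using set_integrable_abs[OF i3] by (simp add: abs_mult)
qed

text \<open>Replaces Hoelder's inequality: integrated against a bounded function that is small in \<open>L\<^sup>1\<close>, both terms are
  small once \<open>T\<close> is large.\<close>

lemma abs_le_powr_split:
  fixes y T p :: real
  assumes "0 < T" "1 < p"
  shows "\<bar>y\<bar> \<le> T + T powr (1 - p) * \<bar>y\<bar> powr p"
proof (cases "\<bar>y\<bar> \<le> T")
  case True
  have "0 \<le> T powr (1 - p) * \<bar>y\<bar> powr p" by simp
  then show ?thesis using True by linarith
next
  case False
  then have "\<bar>y\<bar> > 0" using assms by linarith
  then have "\<bar>y\<bar> = \<bar>y\<bar> powr (1 - p) * \<bar>y\<bar> powr p" by (simp flip: powr_add)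
  also have "\<dots> \<le> T powr (1 - p) * \<bar>y\<bar> powr p"
    using False assms by (intro mult_right_mono powr_mono2') auto
  finally show ?thesis using assms by linarith
qed

text \<open>The unit ball bounds the integral of \<open>\<bar>\<psi>\<bar> powr p\<close> by 1, so
  \<open>T\<close> can be fixed from \<open>e\<close>, \<open>B\<close> and \<open>p\<close> alone;
  afterwards \<open>n\<close> is taken large. This order makes the estimate uniform over the
  ball.\<close>

lemma conv_Wm1q_if_L1:
  assumes \<gamma>: "\<And>n. finite_smeasure a b (\<gamma>s n)" "finite_smeasure a b \<gamma>"
    and D: "\<And>n t. t \<in> {a<..<b} \<Longrightarrow> sval (\<gamma>s n) {a<..t} - sval \<gamma> {a<..t} - \<kappa> n = D n t"
    and Dm: "\<And>n. D n \<in> borel_measurable borel" "\<And>n t. \<bar>D n t\<bar> \<le> B"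
    and L1: "(\<lambda>n. LINT t:{a<..<b}|lborel. \<bar>D n t\<bar>) \<longlonglongrightarrow> 0" and q: "1 < q"
  shows "conv_Wm1q a b q \<gamma>s \<gamma>"
  unfolding conv_Wm1q_def
proof (intro allI impI)
  fix e :: real assume e: "e > 0"
  define p where "p = q / (q - 1)"
  have p: "1 < p" using q by (simp add: p_def)
  have "B \<ge> 0" using Dm(2)[of 0 0] by linarith
  have "((\<lambda>T. B * T powr (1 - p)) \<longlongrightarrow> B * 0) at_top"
    using p by (intro tendsto_mult tendsto_const tendsto_neg_powr filterlim_ident) auto
  then have "\<forall>\<^sub>F T in at_top. B * T powr (1 - p) < e / 2" using e by (intro order_tendstoD) auto
  then have "\<forall>\<^sub>F T in at_top. B * T powr (1 - p) < e / 2 \<and> 0 < T" using eventually_gt_at_top by (rule eventually_conj)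
  then obtain T where T: "B * T powr (1 - p) < e / 2" "0 < T" by (auto simp: eventually_at_top_linorder)
  have "(\<lambda>n. T * (LINT t:{a<..<b}|lborel. \<bar>D n t\<bar>)) \<longlonglongrightarrow> T * 0" by (intro tendsto_mult tendsto_const L1)
  then have "\<forall>\<^sub>F n in sequentially. T * (LINT t:{a<..<b}|lborel. \<bar>D n t\<bar>) < e / 2"
    using e by (intro order_tendstoD) auto
  then show "\<forall>\<^sub>F n in sequentially. \<forall>\<phi>. W1p0_ball a b (q / (q - 1)) \<phi> \<longrightarrow> \<bar>sint (\<gamma>s n) \<phi> - sint \<gamma> \<phi>\<bar> \<le> e"
  proof eventually_elim
    case (elim n)
    show ?case
    proof (intro allI impI)
      fix \<phi> assume "W1p0_ball a b (q / (q - 1)) \<phi>"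
      then obtain \<psi> where \<psi>: "set_integrable lborel {a<..<b} \<psi>"
          "set_integrable lborel {a<..<b} (\<lambda>x. \<bar>\<psi> x\<bar> powr p)"
          "(LINT x:{a<..<b}|lborel. \<psi> x) = 0"
          "\<forall>x \<in> {a<..<b}. \<phi> x = (LINT t:{a<..x}|lborel. \<psi> t)"
          "(LINT x:{a<..<b}|lborel. \<bar>\<phi> x\<bar> powr p) + (LINT x:{a<..<b}|lborel. \<bar>\<psi> x\<bar> powr p) \<le> 1"
        unfolding W1p0_ball_def p_def by blast
      have "0 \<le> (LINT x:{a<..<b}|lborel. \<bar>\<phi> x\<bar> powr p)"
        unfolding set_lebesgue_integral_def by (rule integral_nonneg_AE) auto
      then have \<psi>1: "(LINT x:{a<..<b}|lborel. \<bar>\<psi> x\<bar> powr p) \<le> 1" using \<psi>(5) by linarith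
      note dl = sint_diff_le[OF \<gamma>(1)[of n] \<gamma>(2) D Dm(1) Dm(2) \<psi>(1,3,4)]
      have Di: "set_integrable lborel {a<..<b} (\<lambda>t. \<bar>D n t\<bar>)"
        by (intro set_integrable_abs set_integrable_bounded[OF Dm(1) Dm(2)])
      have "\<bar>sint (\<gamma>s n) \<phi> - sint \<gamma> \<phi>\<bar> \<le> (LINT t:{a<..<b}|lborel. \<bar>\<psi> t\<bar> * \<bar>D n t\<bar>)" by (rule dl(1))
      also have "\<dots> \<le> (LINT t:{a<..<b}|lborel. T * \<bar>D n t\<bar> + B * T powr (1 - p) * \<bar>\<psi> t\<bar> powr p)"
      proof (rule set_integral_mono[OF dl(2)])
        show "set_integrable lborel {a<..<b} (\<lambda>t. T * \<bar>D n t\<bar> + B * T powr (1 - p) * \<bar>\<psi> t\<bar> powr p)"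
          by (intro set_integral_add(1) set_integrable_mult_right Di \<psi>(2))
        fix t
        have "\<bar>\<psi> t\<bar> * \<bar>D n t\<bar> \<le> (T + T powr (1 - p) * \<bar>\<psi> t\<bar> powr p) * \<bar>D n t\<bar>"
          by (intro mult_right_mono abs_le_powr_split T p) auto
        also have "\<dots> = T * \<bar>D n t\<bar> + (T powr (1 - p) * \<bar>\<psi> t\<bar> powr p) * \<bar>D n t\<bar>" by (simp add: distrib_right)
        also have "\<dots> \<le> T * \<bar>D n t\<bar> + (T powr (1 - p) * \<bar>\<psi> t\<bar> powr p) * B"
          by (intro add_left_mono mult_left_mono Dm(2)) auto
        finally show "\<bar>\<psi> t\<bar> * \<bar>D n t\<bar> \<le> T * \<bar>D n t\<bar> + B * T powr (1 - p) * \<bar>\<psi> t\<bar> powr p"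
          by (simp add: mult_ac)
      qed
      also have "\<dots> = T * (LINT t:{a<..<b}|lborel. \<bar>D n t\<bar>) + B * T powr (1 - p) * (LINT t:{a<..<b}|lborel. \<bar>\<psi> t\<bar> powr p)"
        by (subst set_integral_add(2)) (use Di \<psi>(2) in auto)
      also have "\<dots> \<le> e / 2 + B * T powr (1 - p) * 1"
        using elim \<open>B \<ge> 0\<close> \<psi>1 by (intro add_mono mult_left_mono) auto
      also have "\<dots> \<le> e" using T(1) by simp
      finally show "\<bar>sint (\<gamma>s n) \<phi> - sint \<gamma> \<phi>\<bar> \<le> e" .
    qed
  qed
qed

section \<open>Lipschitz test functions and the flat norm\<close>

lemma sint_close:
  assumes \<gamma>: "finite_smeasure a b \<gamma>"
    and f: "f \<in> borel_measurable borel" "g \<in> borel_measurable borel"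
    and B: "\<And>x. x \<in> {a<..<b} \<Longrightarrow> \<bar>g x\<bar> \<le> B"
    and fg: "\<And>x. x \<in> {a<..<b} \<Longrightarrow> \<bar>f x - g x\<bar> \<le> \<eta>"
  shows "\<bar>sint \<gamma> f - sint \<gamma> g\<bar> \<le> \<eta> * (measure (fst \<gamma>) {a<..<b} + measure (snd \<gamma>) {a<..<b})"
proof -
  have *: "\<bar>(\<integral>x. f x \<partial>M) - (\<integral>x. g x \<partial>M)\<bar> \<le> \<eta> * measure M {a<..<b}"
    if M: "finite_measure M" "sets M = sets (restrict_space borel {a<..<b})" for M
  proof -
    interpret finite_measure M by fact
    have sp: "space M = {a<..<b}" by (rule space_eq_Ioo[OF M(2)])
    have m: "h \<in> borel_measurable M" if "h \<in> borel_measurable borel" for h :: "real \<Rightarrow> real"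
      unfolding measurable_cong_sets[OF M(2) refl] by (rule measurable_restrict_space1[OF that])
    have gi: "integrable M g"
      by (rule integrable_const_bound[where B=B, OF AE_I2 m[OF f(2)]]) (simp add: sp B)
    have fi: "integrable M f"
    proof (rule integrable_const_bound[where B="B + \<eta>", OF AE_I2 m[OF f(1)]])
      fix x assume "x \<in> space M"
      then show "norm (f x) \<le> B + \<eta>" using B[of x] fg[of x] unfolding sp real_norm_def by linarith
    qed
    have "\<bar>(\<integral>x. f x \<partial>M) - (\<integral>x. g x \<partial>M)\<bar> = \<bar>\<integral>x. f x - g x \<partial>M\<bar>" using fi gi by simp
    also have "\<dots> \<le> (\<integral>x. \<bar>f x - g x\<bar> \<partial>M)" by (rule integral_abs_bound)
    also have "\<dots> \<le> (\<integral>x. \<eta> \<partial>M)"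
      using fi gi by (intro integral_mono) (auto simp: sp fg)
    finally show ?thesis by (simp add: sp mult.commute)
  qed
  have "\<bar>sint \<gamma> f - sint \<gamma> g\<bar> \<le> \<bar>(\<integral>x. f x \<partial>fst \<gamma>) - (\<integral>x. g x \<partial>fst \<gamma>)\<bar> + \<bar>(\<integral>x. f x \<partial>snd \<gamma>) - (\<integral>x. g x \<partial>snd \<gamma>)\<bar>"
    by (simp add: sint_def)
  also have "\<dots> \<le> \<eta> * measure (fst \<gamma>) {a<..<b} + \<eta> * measure (snd \<gamma>) {a<..<b}"
    using \<gamma> by (intro add_mono *) (auto simp: finite_smeasure_def)
  finally show ?thesis by (simp add: distrib_left)
qed

text \<open>The ball prescribes \<open>\<phi>\<close> only on [a,b]. Clamping the argument yields a
  Lipschitz extension to the line, which is 0 outside because \<open>\<phi>\<close> vanishes at both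
  endpoints.\<close>

lemma W1inf0_ball_clamp:
  assumes ab: "a < b" and \<phi>: "W1inf0_ball a b \<phi>"
  shows "\<And>x y. \<bar>\<phi> (max a (min b x)) - \<phi> (max a (min b y))\<bar> \<le> \<bar>x - y\<bar>"
    and "\<And>x. isCont (\<lambda>x. \<phi> (max a (min b x))) x"
    and "(\<lambda>x. \<phi> (max a (min b x))) \<in> borel_measurable borel"
proof -
  show L: "\<bar>\<phi> (max a (min b x)) - \<phi> (max a (min b y))\<bar> \<le> \<bar>x - y\<bar>" for x y
  proof -
    have "\<bar>\<phi> (max a (min b x)) - \<phi> (max a (min b y))\<bar> \<le> \<bar>max a (min b x) - max a (min b y)\<bar>"
      using ab \<phi> by (auto simp: W1inf0_ball_def)
    also have "\<dots> \<le> \<bar>x - y\<bar>" by (simp add: max_def min_def)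
    finally show ?thesis .
  qed
  then show C: "isCont (\<lambda>x. \<phi> (max a (min b x))) x" for x
    unfolding continuous_at_eps_delta by (auto simp: dist_real_def intro: le_less_trans)
  show "(\<lambda>x. \<phi> (max a (min b x))) \<in> borel_measurable borel"
    by (intro borel_measurable_continuous_onI continuous_at_imp_continuous_on ballI C)
qed

text \<open>Avoids almost everywhere differentiability of Lipschitz functions: the average over (x,
  x + h) has the difference quotient as derivative, and that is bounded by 1. A small linear
  correction restores the zero mean.\<close>

lemma Lipschitz_approx:
  assumes ab: "a < b" and \<phi>: "W1inf0_ball a b \<phi>" and h: "0 < h"
  shows "\<exists>\<psi> f. \<psi> \<in> borel_measurable borel \<and> f \<in> borel_measurable borel \<and>
    (\<forall>x. \<bar>\<psi> x\<bar> \<le> 1 + h / (b - a)) \<and> (LINT x:{a<..<b}|lborel. \<psi> x) = 0 \<and>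
    (\<forall>x\<in>{a<..<b}. f x = (LINT t:{a<..x}|lborel. \<psi> t)) \<and> (\<forall>x\<in>{a<..<b}. \<bar>f x - \<phi> x\<bar> \<le> 3 * h)"
proof -
  define P where "P x = \<phi> (max a (min b x))" for x
  have \<phi>0: "\<phi> a = 0" "\<phi> b = 0" using \<phi> unfolding W1inf0_ball_def by auto
  note PL = W1inf0_ball_clamp(1)[OF ab \<phi>, folded P_def]
    and PC = W1inf0_ball_clamp(2)[OF ab \<phi>, folded P_def]
    and Pm[measurable] = W1inf0_ball_clamp(3)[OF ab \<phi>, folded P_def]
  have Pa: "P x = 0" if "x \<le> a" for x using that ab \<phi>0 by (simp add: P_def max_def min_def)
  have Pb: "P x = 0" if "x \<ge> b" for x using that ab \<phi>0 by (simp add: P_def max_def min_def)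
  define I where "I x = (LINT t:{x<..x+h}|lborel. P t) / h" for x
  define p where "p x = (P (x + h) - P x) / h" for x
  have pm[measurable]: "p \<in> borel_measurable borel" unfolding p_def by measurable
  have p1: "\<bar>p x\<bar> \<le> 1" for x using PL[of "x + h" x] h by (simp add: p_def divide_le_eq)
  have pint: "(LINT t:{a<..x}|lborel. p t) = I x - I a" if "a \<le> x" for x
  proof -
    have "(LINT t:{a<..x}|lborel. p t) = (LINT t:{a<..x}|lborel. P (t + h) - P t) / h" by (simp add: p_def)
    also have "\<dots> = I x - I a"
      unfolding integral_shift_diff[OF PC that less_imp_le[OF h]] I_def diff_divide_distrib ..
    finally show ?thesis .
  qed
  have Inear: "\<bar>I x - P x\<bar> \<le> h" for x
    unfolding I_def
  proof (rule average_near[OF Pm h])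
    show "\<bar>P t - P x\<bar> \<le> h" if "x < t" "t \<le> x + h" for t using PL[of t x] that by simp
  qed
  have Ia: "\<bar>I a\<bar> \<le> h" using Inear[of a] Pa[of a] by simp
  have Ib: "I b = 0"
  proof -
    have "(LINT t:{b<..b+h}|lborel. P t) = (LINT t:{b<..b+h}|lborel. 0)"
      by (intro set_lebesgue_integral_cong) (auto simp: Pb)
    then show ?thesis by (simp add: I_def)
  qed
  \<comment> \<open>The mean of \<open>p\<close> over the interval, because its integral is
    \<open>I b - I a\<close> and \<open>I b = 0\<close>.\<close>
  define \<mu> where "\<mu> = - I a / (b - a)"
  have \<mu>: "\<bar>\<mu>\<bar> \<le> h / (b - a)" using Ia ab by (simp add: \<mu>_def divide_right_mono)
  define \<psi> where "\<psi> x = p x - \<mu>" for x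
  have \<psi>m[measurable]: "\<psi> \<in> borel_measurable borel" unfolding \<psi>_def by measurable
  have \<psi>1: "\<bar>\<psi> x\<bar> \<le> 1 + h / (b - a)" for x using p1[of x] \<mu> by (simp add: \<psi>_def)
  have \<psi>int: "(LINT t:{a<..x}|lborel. \<psi> t) = I x - I a - \<mu> * (x - a)" if "a \<le> x" for x
  proof -
    have pI: "set_integrable lborel {a<..x} f" if "f \<in> borel_measurable borel" "\<And>x. \<bar>f x\<bar> \<le> B" for f :: "real \<Rightarrow> real" and B
      by (rule set_integrable_subset[OF set_integrable_bounded[OF that, of a "x + 1"]]) auto
    have "(LINT t:{a<..x}|lborel. \<psi> t) = (LINT t:{a<..x}|lborel. p t) - (LINT t:{a<..x}|lborel. \<mu>)"
      unfolding \<psi>_def by (intro set_integral_diff(2) pI[OF pm p1] pI[of _ "\<bar>\<mu>\<bar>"]) auto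
    moreover have "(LINT t:{a<..x}|lborel. \<mu>) = \<mu> * (x - a)"
      using that by (simp add: set_lebesgue_integral_def mult.commute)
    ultimately show ?thesis using pint[OF that] by simp
  qed
  have zero: "(LINT x:{a<..<b}|lborel. \<psi> x) = 0"
    using \<psi>int[of b] ab Ib by (simp add: set_integral_Icc_eq \<mu>_def)
  define \<psi>h where "\<psi>h x = indicator {a<..<b} x * \<psi> x" for x
  have \<psi>h: "integrable lborel \<psi>h"
    using set_integrable_bounded[OF \<psi>m \<psi>1, of a b] unfolding \<psi>h_def integrable_zero_ext .
  have f: "prim \<psi>h x = (LINT t:{a<..x}|lborel. \<psi> t)" if "x \<in> {a<..<b}" for x
    unfolding prim_def set_lebesgue_integral_def \<psi>h_def using that
    by (intro Bochner_Integration.integral_cong) (auto simp: indicator_def)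
  \<comment> \<open>One \<open>h\<close> each for \<open>I x\<close> against \<open>P x\<close>, for
    the constant \<open>I a\<close>, and for the linear correction.\<close>
  have "\<bar>prim \<psi>h x - \<phi> x\<bar> \<le> 3 * h" if x: "x \<in> {a<..<b}" for x
  proof -
    have "P x = \<phi> x" using x by (simp add: P_def)
    moreover have "\<bar>\<mu> * (x - a)\<bar> \<le> h"
    proof -
      have "\<bar>\<mu> * (x - a)\<bar> \<le> h / (b - a) * (b - a)"
        unfolding abs_mult using x by (intro mult_mono \<mu>) (use h in auto)
      then show ?thesis using ab by simp
    qed
    ultimately show ?thesis using f[OF x] \<psi>int[of x] x Inear[of x] Ia by auto
  qed
  then show ?thesis using \<psi>m borel_measurable_prim[OF \<psi>h] \<psi>1 zero f by blast
qed

text \<open>The smoothing error carries the total masses of \<open>\<gamma>s n\<close>, which are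
  not assumed bounded in \<open>n\<close>. Hence \<open>h\<close> tends to 0 for each fixed
  \<open>n\<close> first, which leaves the L^1 norm of \<open>D n\<close> as a bound for the whole
  ball.\<close>

lemma conv_flat_if_L1:
  assumes ab: "a < b" and \<gamma>: "\<And>n. finite_smeasure a b (\<gamma>s n)" "finite_smeasure a b \<gamma>"
    and D: "\<And>n t. t \<in> {a<..<b} \<Longrightarrow> sval (\<gamma>s n) {a<..t} - sval \<gamma> {a<..t} - \<kappa> n = D n t"
    and Dm: "\<And>n. D n \<in> borel_measurable borel" "\<And>n t. \<bar>D n t\<bar> \<le> B"
    and L1: "(\<lambda>n. LINT t:{a<..<b}|lborel. \<bar>D n t\<bar>) \<longlonglongrightarrow> 0"
  shows "conv_flat a b \<gamma>s \<gamma>"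
  unfolding conv_flat_def
proof (intro allI impI)
  fix e :: real assume e: "e > 0"
  have "\<forall>\<^sub>F n in sequentially. (LINT t:{a<..<b}|lborel. \<bar>D n t\<bar>) < e" using L1 e by (rule order_tendstoD)
  then show "\<forall>\<^sub>F n in sequentially. \<forall>\<phi>. W1inf0_ball a b \<phi> \<longrightarrow> \<bar>sint (\<gamma>s n) \<phi> - sint \<gamma> \<phi>\<bar> \<le> e"
  proof eventually_elim
    case (elim n)
    show ?case
    proof (intro allI impI)
      fix \<phi> assume \<phi>: "W1inf0_ball a b \<phi>"
      define \<delta> where "\<delta> = (LINT t:{a<..<b}|lborel. \<bar>D n t\<bar>)"
      define m where "m \<gamma> = measure (fst \<gamma>) {a<..<b} + measure (snd \<gamma>) {a<..<b}" for \<gamma> :: smeasure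
      define P where "P x = \<phi> (max a (min b x))" for x
      have P\<phi>: "P x = \<phi> x" if "x \<in> {a<..<b}" for x using that by (simp add: P_def)
      note Pm = W1inf0_ball_clamp(3)[OF ab \<phi>, folded P_def]
      have P1: "\<bar>P x\<bar> \<le> 1" if "x \<in> {a<..<b}" for x using \<phi> that unfolding W1inf0_ball_def P\<phi>[OF that] by auto
      have sP: "sint \<gamma>' \<phi> = sint \<gamma>' P" if "finite_smeasure a b \<gamma>'" for \<gamma>'
      proof -
        have sp: "space (fst \<gamma>') = {a<..<b}" "space (snd \<gamma>') = {a<..<b}"
          using that by (auto simp: finite_smeasure_def intro!: space_eq_Ioo)
        show ?thesis unfolding sint_def
          by (intro arg_cong2[where f="(-)"] Bochner_Integration.integral_cong) (auto simp: sp P\<phi>)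
      qed
      have bound: "\<bar>sint (\<gamma>s n) \<phi> - sint \<gamma> \<phi>\<bar> \<le> (1 + h / (b - a)) * \<delta> + 3 * h * (m (\<gamma>s n) + m \<gamma>)"
        if h: "h > 0" for h
      proof -
        obtain \<psi> f where r: "\<psi> \<in> borel_measurable borel" "f \<in> borel_measurable borel"
          "\<And>x. \<bar>\<psi> x\<bar> \<le> 1 + h / (b - a)" "(LINT x:{a<..<b}|lborel. \<psi> x) = 0"
          "\<forall>x\<in>{a<..<b}. f x = (LINT t:{a<..x}|lborel. \<psi> t)" "\<And>x. x \<in> {a<..<b} \<Longrightarrow> \<bar>f x - \<phi> x\<bar> \<le> 3 * h"
          using Lipschitz_approx[OF ab \<phi> h] by blast
        have \<psi>: "set_integrable lborel {a<..<b} \<psi>" by (rule set_integrable_bounded[OF r(1) r(3)])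
        note dl = sint_diff_le[OF \<gamma>(1)[of n] \<gamma>(2) D Dm(1) Dm(2) \<psi> r(4,5)]
        have Di: "set_integrable lborel {a<..<b} (\<lambda>t. \<bar>D n t\<bar>)"
          by (intro set_integrable_abs set_integrable_bounded[OF Dm(1) Dm(2)])
        have "\<bar>sint (\<gamma>s n) f - sint \<gamma> f\<bar> \<le> (LINT t:{a<..<b}|lborel. \<bar>\<psi> t\<bar> * \<bar>D n t\<bar>)"
          by (rule dl(1))
        also have "\<dots> \<le> (LINT t:{a<..<b}|lborel. (1 + h / (b - a)) * \<bar>D n t\<bar>)"
          by (intro set_integral_mono dl(2) set_integrable_mult_right Di mult_right_mono r(3)) auto
        also have "\<dots> = (1 + h / (b - a)) * \<delta>" by (simp add: \<delta>_def)
        finally have 1: "\<bar>sint (\<gamma>s n) f - sint \<gamma> f\<bar> \<le> (1 + h / (b - a)) * \<delta>" .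
        have 2: "\<bar>sint \<gamma>' f - sint \<gamma>' \<phi>\<bar> \<le> 3 * h * m \<gamma>'" if "finite_smeasure a b \<gamma>'" for \<gamma>'
          unfolding m_def sP[OF that]
          by (rule sint_close[OF that r(2) Pm P1]) (use r(6) P\<phi> in auto)
        show ?thesis using 1 2[OF \<gamma>(1)[of n]] 2[OF \<gamma>(2)] by (simp add: distrib_left)
      qed
      have "\<bar>sint (\<gamma>s n) \<phi> - sint \<gamma> \<phi>\<bar> \<le> \<delta>"
      proof (rule tendsto_lowerbound)
        have "((\<lambda>h. (1 + h / (b - a)) * \<delta> + 3 * h * (m (\<gamma>s n) + m \<gamma>)) \<longlongrightarrow>
            (1 + 0 / (b - a)) * \<delta> + 3 * 0 * (m (\<gamma>s n) + m \<gamma>)) (at_right 0)"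
          using ab by (intro tendsto_intros) auto
        then show "((\<lambda>h. (1 + h / (b - a)) * \<delta> + 3 * h * (m (\<gamma>s n) + m \<gamma>)) \<longlongrightarrow> \<delta>) (at_right 0)" by simp
        show "\<forall>\<^sub>F h in at_right 0. \<bar>sint (\<gamma>s n) \<phi> - sint \<gamma> \<phi>\<bar> \<le> (1 + h / (b - a)) * \<delta> + 3 * h * (m (\<gamma>s n) + m \<gamma>)"
          using bound by (auto simp: eventually_at_right_field intro: exI[of _ 1])
      qed simp
      then show "\<bar>sint (\<gamma>s n) \<phi> - sint \<gamma> \<phi>\<bar> \<le> e" using elim by (simp add: \<delta>_def)
    qed
  qed
qed

subsection \<open>Identification of the limit\<close>

text \<open>The derivative of \<open>F - G\<close> on the open interval, as a pair of
  Lebesgue-Stieltjes measures. The restriction drops atoms at the endpoints, and the two measures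
  need not be mutually singular.\<close>

definition interval_smeasure :: "real \<Rightarrow> real \<Rightarrow> (real \<Rightarrow> real) \<Rightarrow> (real \<Rightarrow> real) \<Rightarrow> smeasure" where
  "interval_smeasure a b F G =
    (restrict_space (interval_measure F) {a<..<b}, restrict_space (interval_measure G) {a<..<b})"

lemma interval_smeasure:
  assumes ab: "a < b" and F: "mono F" "\<And>x. continuous (at_right x) F"
    and G: "mono G" "\<And>x. continuous (at_right x) G"
  shows "finite_smeasure a b (interval_smeasure a b F G)"
    and "\<And>t. t \<in> {a<..<b} \<Longrightarrow> sval (interval_smeasure a b F G) {a<..t} = (F t - F a) - (G t - G a)"
proof -
  have fin: "finite_measure (restrict_space (interval_measure H) {a<..<b})"
    if H: "mono H" "\<And>x. continuous (at_right x) H" for H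
  proof
    have "emeasure (restrict_space (interval_measure H) {a<..<b}) {a<..<b} = emeasure (interval_measure H) {a<..<b}"
      by (rule emeasure_restrict_space) auto
    also have "\<dots> \<le> emeasure (interval_measure H) {a<..b}" by (intro emeasure_mono) auto
    also have "\<dots> = ennreal (H b - H a)"
      using ab H by (intro emeasure_interval_measure_Ioc) (auto dest: monoD)
    finally show "emeasure (restrict_space (interval_measure H) {a<..<b}) (space (restrict_space (interval_measure H) {a<..<b})) \<noteq> \<infinity>"
      by (auto simp: space_restrict_space top_unique)
  qed
  have sets: "sets (restrict_space (interval_measure H) {a<..<b}) = sets (restrict_space borel {a<..<b})" for H
    by (simp add: sets_restrict_space)
  show "finite_smeasure a b (interval_smeasure a b F G)"
    unfolding finite_smeasure_def interval_smeasure_def using fin[OF F] fin[OF G] sets by simp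
  have val: "measure (restrict_space (interval_measure H) {a<..<b}) {a<..t} = H t - H a"
    if H: "mono H" "\<And>x. continuous (at_right x) H" and t: "t \<in> {a<..<b}" for H t
  proof -
    have "measure (restrict_space (interval_measure H) {a<..<b}) {a<..t} = measure (interval_measure H) {a<..t}"
      using t by (intro measure_restrict_space) auto
    also have "\<dots> = H t - H a" using t H by (intro measure_interval_measure_Ioc) (auto dest: monoD)
    finally show ?thesis .
  qed
  show "sval (interval_smeasure a b F G) {a<..t} = (F t - F a) - (G t - G a)" if "t \<in> {a<..<b}" for t
    unfolding sval_def interval_smeasure_def using val[OF F that] val[OF G that] by simp
qed

lemma BV_derivI_cdf:
  assumes Du: "finite_smeasure a b Du" and u: "set_integrable lborel {a<..<b} u"
    and cdf: "\<And>t. t \<in> {a<..<b} \<Longrightarrow> sval Du {a<..t} = u t - \<kappa>"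
  shows "BV_deriv a b u Du"
  unfolding BV_deriv_def
proof (intro conjI allI impI Du)
  fix \<phi> assume \<phi>: "Cc1 a b \<phi>"
  obtain B where B: "\<And>x. \<bar>deriv \<phi> x\<bar> \<le> B" using Cc1_rep(2)[OF \<phi>] by blast
  have i1: "set_integrable lborel {a<..<b} (\<lambda>x. u x * deriv \<phi> x)"
    by (rule set_integrable_mult_bounded[OF u Cc1_rep(1)[OF \<phi>] B])
  have i2: "set_integrable lborel {a<..<b} (\<lambda>x. \<kappa> * deriv \<phi> x)" using Cc1_rep(3)[OF \<phi>] by simp
  have "- sint Du \<phi> = (LINT t:{a<..<b}|lborel. deriv \<phi> t * sval Du {a<..t})"
    using sint_eq_neg_integral(2)[OF Du Cc1_rep(3-5)[OF \<phi>]] by simp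
  also have "\<dots> = (LINT t:{a<..<b}|lborel. u t * deriv \<phi> t - \<kappa> * deriv \<phi> t)"
    by (intro set_lebesgue_integral_cong) (auto simp: cdf algebra_simps)
  also have "\<dots> = (LINT t:{a<..<b}|lborel. u t * deriv \<phi> t)"
    unfolding set_integral_diff(2)[OF i1 i2] using Cc1_rep(4)[OF \<phi>] by simp
  finally show "(LINT x:{a<..<b}|lborel. u x * deriv \<phi> x) = - sint Du \<phi>" by simp
qed

text \<open>Every derivative measure of \<open>u\<close> has \<open>u\<close> as its distribution
  function up to a constant, almost everywhere. Together with
  \<open>countably_additive_on_eq_zero\<close> this determines \<open>Du\<close> as a set
  function.\<close>

lemma BV_deriv_cdf:
  assumes ab: "a < b" and u: "set_integrable lborel {a<..<b} u" and Du: "BV_deriv a b u Du"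
  shows "\<exists>c. AE t in lborel. t \<in> {a<..<b} \<longrightarrow> u t - sval Du {a<..t} = c"
proof -
  have fin: "finite_smeasure a b Du" using Du by (simp add: BV_deriv_def)
  then have f1: "finite_measure (fst Du)" "sets (fst Du) = sets (restrict_space borel {a<..<b})"
    and f2: "finite_measure (snd Du)" "sets (snd Du) = sets (restrict_space borel {a<..<b})"
    by (auto simp: finite_smeasure_def)
  have one: "set_integrable lborel {a<..<b} (\<lambda>_. 1::real)"
    by (rule set_integrable_bounded[where B=1]) auto
  have R: "set_integrable lborel {a<..<b} (\<lambda>t. sval Du {a<..t})"
    using set_integral_diff(1)[OF integrable_mult_cdf[OF f1 one] integrable_mult_cdf[OF f2 one]]
    by (simp add: sval_def)
  show ?thesis
  proof (rule du_Bois_Reymond[OF ab set_integral_diff(1)[OF u R]])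
    fix \<phi> assume \<phi>: "Cc1 a b \<phi>"
    obtain B where B: "\<And>x. \<bar>deriv \<phi> x\<bar> \<le> B" using Cc1_rep(2)[OF \<phi>] by blast
    note m = set_integrable_mult_bounded[OF _ Cc1_rep(1)[OF \<phi>] B]
    have "(LINT x:{a<..<b}|lborel. u x * deriv \<phi> x) = - sint Du \<phi>" using Du \<phi> by (simp add: BV_deriv_def)
    also have "\<dots> = (LINT t:{a<..<b}|lborel. sval Du {a<..t} * deriv \<phi> t)"
      using sint_eq_neg_integral(2)[OF fin Cc1_rep(3-5)[OF \<phi>]] by (simp add: mult.commute)
    finally show "(LINT x:{a<..<b}|lborel. (u x - sval Du {a<..x}) * deriv \<phi> x) = 0"
      using set_integral_diff(2)[OF m[OF u] m[OF R]] by (simp add: left_diff_distrib)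
  qed
qed

text \<open>Both \<open>Du\<close> and \<gamma> + w dx have distribution function \<open>u\<close>
  up to a constant, so they agree. Subtracting the decompositions, the density g - u' + w integrates
  over \<open>A\<close> to the difference of the singular parts. Off a common null set the singular
  parts vanish, and the null set does not affect the integral. So the density is 0 almost
  everywhere, which yields both claims, with u' - g = w.\<close>

lemma lebesgue_decomp_compare:
  assumes ab: "a < b" and \<gamma>: "finite_smeasure a b \<gamma>" and u: "set_integrable lborel {a<..<b} u"
    and w: "integrable lborel w" "integrable lborel (\<lambda>x. (w x)\<^sup>2)" "\<And>x. x \<notin> {a<..<b} \<Longrightarrow> w x = 0"
    and cdf: "\<And>t. t \<in> {a<..<b} \<Longrightarrow> sval \<gamma> {a<..t} = u t - prim w t - \<kappa>"
    and dec1: "lebesgue_decomp a b \<gamma> \<gamma>s g" and Du: "BV_deriv a b u Du" and dec2: "lebesgue_decomp a b Du Dsu u'"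
  shows "(\<forall>A \<in> sets borel. A \<subseteq> {a<..<b} \<longrightarrow> sval \<gamma>s A = sval Dsu A) \<and>
    set_integrable lborel {a<..<b} (\<lambda>x. (u' x - g x)\<^sup>2)"
proof -
  have Duf: "finite_smeasure a b Du" using Du by (simp add: BV_deriv_def)
  obtain c where c: "AE t in lborel. t \<in> {a<..<b} \<longrightarrow> u t - sval Du {a<..t} = c"
    using BV_deriv_cdf[OF ab u Du] by blast
  have wt: "(LINT x:{a<..t}|lborel. w x) = prim w t" if "t \<in> {a<..<b}" for t
    unfolding prim_def set_lebesgue_integral_def
    using that w(3) by (intro Bochner_Integration.integral_cong) (auto simp: indicator_def)
  have "AE t in lborel. t \<in> {a<..<b} \<longrightarrow>
      sval Du {a<..t} - sval \<gamma> {a<..t} - (LINT x:{a<..t}|lborel. w x) = \<kappa> - c"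
    using c
  proof eventually_elim
    case (elim t)
    show ?case
    proof
      assume t: "t \<in> {a<..<b}"
      then have "u t - sval Du {a<..t} = c" using elim by blast
      then show "sval Du {a<..t} - sval \<gamma> {a<..t} - (LINT x:{a<..t}|lborel. w x) = \<kappa> - c"
        using cdf[OF t] wt[OF t] by linarith
    qed
  qed
  then have "sval Du A - sval \<gamma> A - (LINT x:A|lborel. w x) = 0" if "A \<in> sets borel" "A \<subseteq> {a<..<b}" for A
    using that countably_additive_on_eq_zero[OF ab countably_additive_on_diff[OF countably_additive_on_diff
        [OF countably_additive_on_sval[OF Duf] countably_additive_on_sval[OF \<gamma>]] countably_additive_on_integral[OF w(1)]]]
    by blast
  then have eq: "sval \<gamma> A = sval Du A - (LINT x:A|lborel. w x)" if "A \<in> sets borel" "A \<subseteq> {a<..<b}" for A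
    using that by force
  note dec1' = dec1[unfolded lebesgue_decomp_def] and dec2' = dec2[unfolded lebesgue_decomp_def]
  have g: "set_integrable lborel {a<..<b} g" and u': "set_integrable lborel {a<..<b} u'"
    using dec1' dec2' by simp_all
  note d1 = dec1'[THEN conjunct2, THEN conjunct2, THEN conjunct1, rule_format]
    and d2 = dec2'[THEN conjunct2, THEN conjunct2, THEN conjunct1, rule_format]
  from dec1'[THEN conjunct2, THEN conjunct2, THEN conjunct2] obtain N1 where
    N1: "N1 \<in> sets borel" "emeasure lborel N1 = 0"
      "\<And>A. A \<in> sets borel \<Longrightarrow> A \<subseteq> {a<..<b} - N1 \<Longrightarrow> sval \<gamma>s A = 0" by metis
  from dec2'[THEN conjunct2, THEN conjunct2, THEN conjunct2] obtain N2 where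
    N2: "N2 \<in> sets borel" "emeasure lborel N2 = 0"
      "\<And>A. A \<in> sets borel \<Longrightarrow> A \<subseteq> {a<..<b} - N2 \<Longrightarrow> sval Dsu A = 0" by metis
  define gh uh where "gh x = indicator {a<..<b} x * g x" and "uh x = indicator {a<..<b} x * u' x" for x
  have gh: "integrable lborel gh" using g unfolding gh_def integrable_zero_ext .
  have uh: "integrable lborel uh" using u' unfolding uh_def integrable_zero_ext .
  define h where "h x = gh x - uh x + w x" for x
  have h: "integrable lborel h" unfolding h_def using gh uh w(1) by auto
  have hm: "h \<in> borel_measurable borel" using h by auto
  have hA: "(LINT x:A|lborel. h x) = sval Dsu A - sval \<gamma>s A" if A: "A \<in> sets borel" "A \<subseteq> {a<..<b}" for A
  proof -
    note i = set_integrable_of_integrable[OF _ A(1)]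
    have "(LINT x:A|lborel. h x) = (LINT x:A|lborel. gh x) - (LINT x:A|lborel. uh x) + (LINT x:A|lborel. w x)"
      unfolding h_def
      by (simp only: set_integral_add(2)[OF set_integral_diff(1)[OF i[OF gh] i[OF uh]] i[OF w(1)]]
          set_integral_diff(2)[OF i[OF gh] i[OF uh]])
    moreover have "(LINT x:A|lborel. gh x) = (LINT x:A|lborel. g x)"
      using A by (intro set_lebesgue_integral_cong) (auto simp: gh_def)
    moreover have "(LINT x:A|lborel. uh x) = (LINT x:A|lborel. u' x)"
      using A by (intro set_lebesgue_integral_cong) (auto simp: uh_def)
    ultimately show ?thesis using eq[OF A] d1[OF A] d2[OF A] by linarith
  qed
  define N where "N = N1 \<union> N2"
  have N: "N \<in> null_sets lborel" "N \<in> sets borel" unfolding N_def using N1 N2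
    by (auto intro!: null_sets.Un simp: null_setsI)
  have h0: "(LINT x:A|lborel. h x) = 0" if A: "A \<in> sets borel" "A \<subseteq> {a<..<b}" for A
  proof -
    \<comment> \<open>Removing \<open>N\<close> leaves the integral unchanged but makes both
      singular parts vanish.\<close>
    have "AE x in lborel. indicator A x *\<^sub>R h x = indicator (A - N) x *\<^sub>R h x"
      using AE_not_in[OF N(1)] by eventually_elim (auto simp: indicator_def)
    then have "(LINT x:A|lborel. h x) = (LINT x:A - N|lborel. h x)"
      unfolding set_lebesgue_integral_def using hm A N by (intro integral_cong_AE) auto
    also have "\<dots> = sval Dsu (A - N) - sval \<gamma>s (A - N)" using A N by (intro hA) auto
    also have "sval Dsu (A - N) = 0" using A N by (intro N2(3)) (auto simp: N_def)
    also have "sval \<gamma>s (A - N) = 0" using A N by (intro N1(3)) (auto simp: N_def)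
    finally show ?thesis by simp
  qed
  have "AE x in lborel. h x = 0"
  proof (rule density_unique_real[OF h])
    fix A :: "real set" assume "A \<in> sets lborel"
    then have A: "A \<in> sets borel" by simp
    have "(LINT x:A|lborel. h x) = (LINT x:A \<inter> {a<..<b}|lborel. h x)"
      unfolding set_lebesgue_integral_def
      by (intro Bochner_Integration.integral_cong) (auto simp: h_def gh_def uh_def w(3) indicator_def)
    also have "\<dots> = 0" using A by (intro h0) auto
    finally show "(LINT x:A|lborel. h x) = (LINT x:A|lborel. 0)" by simp
  qed auto
  then have AEw: "AE x in lborel. (w x)\<^sup>2 = (uh x - gh x)\<^sup>2"
  proof eventually_elim
    case (elim x)
    then have "w x = uh x - gh x" by (simp add: h_def)
    then show ?case by simp
  qed
  have "integrable lborel (\<lambda>x. (uh x - gh x)\<^sup>2)"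
    using w(2) AEw uh gh by (subst integrable_cong_AE[symmetric, where f="\<lambda>x. (w x)\<^sup>2"]) auto
  moreover have "(uh x - gh x)\<^sup>2 = indicator {a<..<b} x * (u' x - g x)\<^sup>2" for x
    by (simp add: uh_def gh_def indicator_def)
  ultimately have "set_integrable lborel {a<..<b} (\<lambda>x. (u' x - g x)\<^sup>2)" by (simp add: integrable_zero_ext)
  moreover have "sval \<gamma>s A = sval Dsu A" if "A \<in> sets borel" "A \<subseteq> {a<..<b}" for A
    using hA[OF that] h0[OF that] by simp
  ultimately show ?thesis by blast
qed

lemma L1_tendsto_zero_bounded:
  fixes X :: "nat \<Rightarrow> real \<Rightarrow> real"
  assumes "\<And>n. X n \<in> borel_measurable borel" "\<And>n x. \<bar>X n x\<bar> \<le> B" "AE x in lborel. (\<lambda>n. X n x) \<longlonglongrightarrow> 0"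
  shows "(\<lambda>n. LINT x:{a<..<b}|lborel. \<bar>X n x\<bar>) \<longlonglongrightarrow> 0"
proof -
  have "(\<lambda>n. \<integral>x. indicator {a<..<b} x *\<^sub>R \<bar>X n x\<bar> \<partial>lborel) \<longlonglongrightarrow> (\<integral>x. 0 \<partial>(lborel :: real measure))"
  proof (rule integral_dominated_convergence[where w="\<lambda>x. indicator {a<..<b} x *\<^sub>R B"])
    show "AE x in lborel. (\<lambda>n. indicator {a<..<b} x *\<^sub>R \<bar>X n x\<bar>) \<longlonglongrightarrow> 0"
      using assms(3) by eventually_elim (auto intro!: tendsto_eq_intros tendsto_rabs_zero)
    show "integrable lborel (\<lambda>x. indicator {a<..<b} x *\<^sub>R B)"
      using set_integrable_bounded[of "\<lambda>_. B" a b "\<bar>B\<bar>"] by (simp add: set_integrable_def)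
  qed (use assms in \<open>auto simp: indicator_def\<close>)
  then show ?thesis by (simp add: set_lebesgue_integral_def)
qed

text \<open>A subsequence converges almost everywhere, and the pointwise bound survives along
  it.\<close>

lemma Linf_bound_L1_limit:
  assumes u: "\<And>n. set_integrable lborel {a<..<b} (u n)" "set_integrable lborel {a<..<b} u0"
    and K: "\<And>n. Linf_bound a b K (u n)"
    and L1: "(\<lambda>n. LINT x:{a<..<b}|lborel. \<bar>u n x - u0 x\<bar>) \<longlonglongrightarrow> 0"
  shows "Linf_bound a b K u0"
proof -
  define d where "d n x = indicator {a<..<b} x * (u n x - u0 x)" for n x
  have d: "integrable lborel (d n)" for n
    unfolding d_def using set_integral_diff(1)[OF u(1)[of n] u(2)] by (simp add: integrable_zero_ext)
  have "norm (d n x) = indicator {a<..<b} x * \<bar>u n x - u0 x\<bar>" for n x by (simp add: d_def abs_mult)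
  then have "(\<lambda>n. \<integral>x. norm (d n x) \<partial>lborel) \<longlonglongrightarrow> 0" using L1 by (simp add: set_lebesgue_integral_def)
  from tendsto_L1_AE_subseq[OF d this] obtain r where r: "AE x in lborel. (\<lambda>n. d (r n) x) \<longlonglongrightarrow> 0" by blast
  have "AE x in lborel. \<forall>n. x \<in> {a<..<b} \<longrightarrow> \<bar>u n x\<bar> \<le> K"
    unfolding AE_all_countable using K by (simp add: Linf_bound_def)
  with r show ?thesis unfolding Linf_bound_def
  proof eventually_elim
    case (elim x)
    show ?case
    proof
      assume x: "x \<in> {a<..<b}"
      have "(\<lambda>n. u (r n) x - u0 x) \<longlonglongrightarrow> 0" using elim(1) x by (simp add: d_def)
      then have "(\<lambda>n. u (r n) x) \<longlonglongrightarrow> u0 x" by (simp add: LIM_zero_iff)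
      then have "(\<lambda>n. \<bar>u (r n) x\<bar>) \<longlonglongrightarrow> \<bar>u0 x\<bar>" by (rule tendsto_rabs)
      then show "\<bar>u0 x\<bar> \<le> K" by (rule LIMSEQ_le_const2) (use elim(2) x in auto)
    qed
  qed
qed

section \<open>Extraction of the subsequence and the limit pair\<close>

theorem mainTheorem5:
  fixes a b c0 K C0 :: real
    and \<epsilon> :: "nat \<Rightarrow> real"
    and u :: "nat \<Rightarrow> real \<Rightarrow> real"
    and \<gamma> :: "nat \<Rightarrow> smeasure"
  assumes "a < b" and "c0 > 0" and "K > 0" and "C0 > 0"
    and "\<forall>n. \<epsilon> n > 0" and "\<epsilon> \<longlonglongrightarrow> 0"
    and "\<forall>n. set_integrable lborel {a<..<b} (u n)"
    and "\<forall>n. finite_smeasure a b (\<gamma> n)"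
    and "\<forall>n. energy a b c0 K (\<epsilon> n) (u n) (\<gamma> n) \<le> ereal C0"
  shows "\<exists>(u0 :: real \<Rightarrow> real) (\<gamma>0 :: smeasure) (r :: nat \<Rightarrow> nat).
           BV a b u0 \<and> Linf_bound a b K u0 \<and> finite_smeasure a b \<gamma>0 \<and> strict_mono r \<and>
           (\<lambda>n. LINT x:{a<..<b}|lborel. \<bar>u (r n) x - u0 x\<bar>) \<longlonglongrightarrow> 0 \<and>
           (\<forall>q. 1 < q \<longrightarrow> conv_Wm1q a b q (\<gamma> \<circ> r) \<gamma>0) \<and>
           conv_flat a b (\<gamma> \<circ> r) \<gamma>0 \<and>
           (\<forall>\<gamma>s g Du u' Dsu.
              lebesgue_decomp a b \<gamma>0 \<gamma>s g \<longrightarrow> BV_deriv a b u0 Du \<longrightarrow>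
              lebesgue_decomp a b Du Dsu u' \<longrightarrow>
              (\<forall>A \<in> sets borel. A \<subseteq> {a<..<b} \<longrightarrow> sval \<gamma>s A = sval Dsu A) \<and>
              set_integrable lborel {a<..<b} (\<lambda>x. (u' x - g x)\<^sup>2))"
proof -
  note ab = \<open>a < b\<close>
  define L where "L = 2 * K + (b - a) + C0"
  define V where "V = (2 + L) * C0 / c0"
  have "\<forall>n. \<exists>c k Z f w. \<bar>c\<bar> \<le> K \<and> \<bar>k\<bar> \<le> L \<and>
     integrable lborel w \<and> integrable lborel (\<lambda>x. (w x)\<^sup>2) \<and> (\<forall>x. x \<notin> {a<..<b} \<longrightarrow> w x = 0) \<and>
     (\<integral>x. (w x)\<^sup>2 \<partial>lborel) \<le> C0 \<and> (\<integral>x. \<bar>w x\<bar> \<partial>lborel) \<le> b - a + C0 \<and>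
     integrable lborel f \<and> (\<integral>x. \<bar>f x\<bar> \<partial>lborel) \<le> V \<and>
     Z \<in> borel_measurable borel \<and> (\<forall>x. \<bar>Z x\<bar> \<le> L) \<and>
     (LINT x:{a<..<b}|lborel. \<bar>Z x - k - prim f x\<bar>) \<le> \<epsilon> n * V \<and>
     (AE x in lborel. x \<in> {a<..<b} \<longrightarrow> u n x = c + Z x + prim w x) \<and>
     (\<forall>t\<in>{a<..<b}. sval (\<gamma> n) {a<..t} = Z t)"
    (is "\<forall>n. \<exists>c k Z f w. ?est n c k Z f w")
    unfolding L_def V_def using assms by (intro allI energy_estimate) auto
  then obtain c k Z f w where est: "\<forall>n. ?est n (c n) (k n) (Z n) (f n) (w n)"
    unfolding choice_iff by (elim exE) (rule that)
  from est have c: "\<And>n. \<bar>c n\<bar> \<le> K" and k: "\<And>n. \<bar>k n\<bar> \<le> L"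
    and w: "\<And>n. integrable lborel (w n)" "\<And>n. integrable lborel (\<lambda>x. (w n x)\<^sup>2)"
      "\<And>n x. x \<notin> {a<..<b} \<Longrightarrow> w n x = 0" "\<And>n. (\<integral>x. (w n x)\<^sup>2 \<partial>lborel) \<le> C0"
      "\<And>n. (\<integral>x. \<bar>w n x\<bar> \<partial>lborel) \<le> b - a + C0"
    and f: "\<And>n. integrable lborel (f n)" "\<And>n. (\<integral>x. \<bar>f n x\<bar> \<partial>lborel) \<le> V"
    and Z: "\<And>n. Z n \<in> borel_measurable borel" "\<And>n x. \<bar>Z n x\<bar> \<le> L"
      "\<And>n. (LINT x:{a<..<b}|lborel. \<bar>Z n x - k n - prim (f n) x\<bar>) \<le> \<epsilon> n * V"
    and uZ: "\<And>n. AE x in lborel. x \<in> {a<..<b} \<longrightarrow> u n x = c n + Z n x + prim (w n) x"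
    and sv: "\<And>n t. t \<in> {a<..<b} \<Longrightarrow> sval (\<gamma> n) {a<..t} = Z n t"
    by simp_all
  obtain s1 F G where s1: "strict_mono s1" and F: "mono F" "\<And>x. continuous (at_right x) F" "\<And>x. \<bar>F x\<bar> \<le> V"
    and G: "mono G" "\<And>x. continuous (at_right x) G" "\<And>x. \<bar>G x\<bar> \<le> V"
    and FG: "AE x in lborel. (\<lambda>n. prim (f (s1 n)) x) \<longlonglongrightarrow> F x - G x"
    by (rule Helly_prim[of f, OF f]) (rule that)
  obtain s2 P Q where s2: "strict_mono s2"
    and PQ: "AE x in lborel. (\<lambda>n. prim (w (s1 (s2 n))) x) \<longlonglongrightarrow> P x - Q x"
    by (rule Helly_prim[of "\<lambda>n. w (s1 n)", OF w(1) w(5)]) (rule that)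
  \<comment> \<open>Only the sum \<open>c + k\<close> has to converge, since \<open>u\<close> is the
    sum of \<open>c + k\<close>, \<open>Z - k\<close> and \<open>prim w\<close>, and Helly's theorem
    takes care of the other two terms.\<close>
  have "bounded (range (\<lambda>n. c (s1 (s2 n)) + k (s1 (s2 n))))"
  proof (rule boundedI)
    fix y assume "y \<in> range (\<lambda>n. c (s1 (s2 n)) + k (s1 (s2 n)))"
    then obtain n where "y = c n + k n" by auto
    then show "norm y \<le> K + L" using c[of n] k[of n] by simp
  qed
  from bounded_imp_convergent_subsequence[OF this] obtain l s3 where
    s3: "strict_mono s3" and ck: "(\<lambda>n. c (s1 (s2 (s3 n))) + k (s1 (s2 (s3 n)))) \<longlonglongrightarrow> l"
    by (auto simp: comp_def)
  define r where "r n = s1 (s2 (s3 n))" for n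
  have r: "strict_mono r" unfolding r_def using s1 s2 s3 by (simp add: strict_mono_def)
  have ck: "(\<lambda>n. c (r n) + k (r n)) \<longlonglongrightarrow> l" using ck by (simp add: r_def)
  have fr: "AE x in lborel. (\<lambda>n. prim (f (r n)) x) \<longlonglongrightarrow> F x - G x"
    using FG
  proof eventually_elim
    case (elim x)
    have "strict_mono (\<lambda>n. s2 (s3 n))" using s2 s3 by (simp add: strict_mono_def)
    from LIMSEQ_subseq_LIMSEQ[OF elim this] show ?case by (simp add: comp_def r_def)
  qed
  have wr: "AE x in lborel. (\<lambda>n. prim (w (r n)) x) \<longlonglongrightarrow> P x - Q x"
    using PQ
  proof eventually_elim
    case (elim x)
    from LIMSEQ_subseq_LIMSEQ[OF elim s3] show ?case by (simp add: comp_def r_def)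
  qed
  \<comment> \<open>Helly's theorem presents this limit merely as a difference of monotone
    functions; the L^2 bound makes it the primitive of a square integrable function.\<close>
  obtain w0 where w0: "integrable lborel w0" "integrable lborel (\<lambda>x. (w0 x)\<^sup>2)"
      "\<And>x. x \<notin> {a<..<b} \<Longrightarrow> w0 x = 0" "AE x in lborel. P x - Q x = prim w0 x"
    using weak_L2_limit[OF ab, of "\<lambda>n. w (r n)", OF w(1) w(2) w(4) w(3) wr] by blast
  have wr0: "AE x in lborel. (\<lambda>n. prim (w (r n)) x) \<longlonglongrightarrow> prim w0 x"
    using wr w0(4) by eventually_elim simp

  define u0 where "u0 x = l + (F x - G x) + prim w0 x" for x
  define \<gamma>0 where "\<gamma>0 = interval_smeasure a b F G"
  note \<gamma>0 = interval_smeasure[OF ab F(1,2) G(1,2), folded \<gamma>0_def]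
  have [measurable]: "F \<in> borel_measurable borel" "G \<in> borel_measurable borel"
    "prim w0 \<in> borel_measurable borel" "\<And>n. prim (w n) \<in> borel_measurable borel"
    "\<And>n. prim (f n) \<in> borel_measurable borel" "\<And>n. Z n \<in> borel_measurable borel"
    using F G w0 w f Z by (auto intro: borel_measurable_mono borel_measurable_prim)
  have u0m: "u0 \<in> borel_measurable borel" unfolding u0_def by measurable
  have w0b: "\<bar>prim w0 x\<bar> \<le> (\<integral>t. \<bar>w0 t\<bar> \<partial>lborel)" for x by (rule prim_abs_le_integral[OF w0(1)])
  have u0i: "set_integrable lborel {a<..<b} u0"
  proof (rule set_integrable_bounded[OF u0m])
    show "\<bar>u0 x\<bar> \<le> \<bar>l\<bar> + 2 * V + (\<integral>t. \<bar>w0 t\<bar> \<partial>lborel)" for x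
      using F(3)[of x] G(3)[of x] w0b[of x] unfolding u0_def by linarith
  qed

  define D where "D n t = Z (r n) t - k (r n) - (F t - G t)" for n t
  have Dm: "D n \<in> borel_measurable borel" for n unfolding D_def by measurable
  have Db: "\<bar>D n t\<bar> \<le> 2 * L + 2 * V" for n t
    using Z(2)[of "r n" t] k[of "r n"] F(3)[of t] G(3)[of t] unfolding D_def by linarith
  have fb: "\<bar>prim (f n) x\<bar> \<le> V" for n x using prim_abs_le_integral[OF f(1), of n x] f(2)[of n] by linarith
  \<comment> \<open>\<open>Y\<close> is the distance of \<open>Z - k\<close> from the smoothed
    function, at most \<epsilon> V in L^1, and \<open>X\<close> that of the smoothed function from
    its limit, which tends to 0 by bounded convergence.\<close>
  have DL1: "(\<lambda>n. LINT t:{a<..<b}|lborel. \<bar>D n t\<bar>) \<longlonglongrightarrow> 0"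
  proof (rule tendsto_sandwich[where f="\<lambda>_. 0"])
    define X where "X n x = prim (f (r n)) x - (F x - G x)" for n x
    have Xm: "X n \<in> borel_measurable borel" for n unfolding X_def by measurable
    have Xb: "\<bar>X n x\<bar> \<le> 3 * V" for n x
      using fb[of "r n" x] F(3)[of x] G(3)[of x] unfolding X_def by linarith
    have X0: "(\<lambda>n. LINT x:{a<..<b}|lborel. \<bar>X n x\<bar>) \<longlonglongrightarrow> 0"
    proof (rule L1_tendsto_zero_bounded[OF Xm Xb])
      show "AE x in lborel. (\<lambda>n. X n x) \<longlonglongrightarrow> 0"
        using fr by eventually_elim (simp add: X_def LIM_zero)
    qed
    have "(\<lambda>n. \<epsilon> (r n)) \<longlonglongrightarrow> 0" using LIMSEQ_subseq_LIMSEQ[OF \<open>\<epsilon> \<longlonglongrightarrow> 0\<close> r] by (simp add: comp_def)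
    from tendsto_add[OF tendsto_mult[OF this tendsto_const[of V]] X0]
    show "(\<lambda>n. \<epsilon> (r n) * V + (LINT x:{a<..<b}|lborel. \<bar>X n x\<bar>)) \<longlonglongrightarrow> 0" by simp
    show "\<forall>\<^sub>F n in sequentially. (LINT t:{a<..<b}|lborel. \<bar>D n t\<bar>)
        \<le> \<epsilon> (r n) * V + (LINT x:{a<..<b}|lborel. \<bar>X n x\<bar>)"
    proof (intro always_eventually allI)
      fix n
      define Y where "Y x = Z (r n) x - k (r n) - prim (f (r n)) x" for x
      have Ym: "Y \<in> borel_measurable borel" unfolding Y_def by measurable
      have Yb: "\<bar>Y x\<bar> \<le> 2 * L + V" for x
        using Z(2)[of "r n" x] k[of "r n"] fb[of "r n" x] unfolding Y_def by linarith
      note Yi = set_integrable_abs[OF set_integrable_bounded[OF Ym Yb, of a b]]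
      note Xi = set_integrable_abs[OF set_integrable_bounded[OF Xm Xb, of a b]]
      note Di = set_integrable_abs[OF set_integrable_bounded[OF Dm Db, of a b]]
      have "(LINT t:{a<..<b}|lborel. \<bar>D n t\<bar>) \<le> (LINT t:{a<..<b}|lborel. \<bar>Y t\<bar> + \<bar>X n t\<bar>)"
        by (rule set_integral_mono[OF Di set_integral_add(1)[OF Yi Xi]]) (simp add: D_def X_def Y_def)
      also have "\<dots> = (LINT t:{a<..<b}|lborel. \<bar>Y t\<bar>) + (LINT t:{a<..<b}|lborel. \<bar>X n t\<bar>)"
        by (rule set_integral_add(2)[OF Yi Xi])
      finally show "(LINT t:{a<..<b}|lborel. \<bar>D n t\<bar>) \<le> \<epsilon> (r n) * V + (LINT x:{a<..<b}|lborel. \<bar>X n x\<bar>)"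
        using Z(3)[of "r n"] unfolding Y_def by linarith
    qed
    show "\<forall>\<^sub>F n in sequentially. 0 \<le> (LINT t:{a<..<b}|lborel. \<bar>D n t\<bar>)"
      unfolding set_lebesgue_integral_def by (intro always_eventually allI integral_nonneg_AE) auto
  qed simp
  \<comment> \<open>The Stieltjes measures are normalised at \<open>a\<close>, hence the values
    \<open>F a\<close> and \<open>G a\<close> in the constant next to \<open>k\<close>.\<close>
  have D: "sval ((\<gamma> \<circ> r) n) {a<..t} - sval \<gamma>0 {a<..t} - (k (r n) + F a - G a) = D n t"
    if "t \<in> {a<..<b}" for n t
    using sv[OF that, of "r n"] \<gamma>0(2)[OF that] by (simp add: D_def)
  have \<gamma>r: "finite_smeasure a b ((\<gamma> \<circ> r) n)" for n using assms by simp

  have uL1: "(\<lambda>n. LINT x:{a<..<b}|lborel. \<bar>u (r n) x - u0 x\<bar>) \<longlonglongrightarrow> 0"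
  proof (rule tendsto_sandwich[where f="\<lambda>_. 0"])
    define X where "X n x = (c (r n) + k (r n) - l) + (prim (w (r n)) x - prim w0 x)" for n x
    define M where "M = K + L + \<bar>l\<bar>"
    have M: "\<bar>c (r n) + k (r n) - l\<bar> \<le> M" for n
      using c[of "r n"] k[of "r n"] unfolding M_def by linarith
    have Xm: "X n \<in> borel_measurable borel" for n unfolding X_def by measurable
    have Xb: "\<bar>X n x\<bar> \<le> M + (b - a + C0) + (\<integral>t. \<bar>w0 t\<bar> \<partial>lborel)" for n x
      using M[of n] prim_abs_le_integral[OF w(1), of "r n" x] w(5)[of "r n"] w0b[of x] unfolding X_def by linarith
    have X0: "(\<lambda>n. LINT x:{a<..<b}|lborel. \<bar>X n x\<bar>) \<longlonglongrightarrow> 0"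
    proof (rule L1_tendsto_zero_bounded[OF Xm Xb])
      show "AE x in lborel. (\<lambda>n. X n x) \<longlonglongrightarrow> 0"
        using wr0
      proof eventually_elim
        case (elim x)
        have "(\<lambda>n. (c (r n) + k (r n) - l) + (prim (w (r n)) x - prim w0 x)) \<longlonglongrightarrow> (l - l) + (prim w0 x - prim w0 x)"
          by (intro tendsto_intros ck elim)
        then show ?case by (simp add: X_def)
      qed
    qed
    from tendsto_add[OF DL1 X0]
    show "(\<lambda>n. (LINT t:{a<..<b}|lborel. \<bar>D n t\<bar>) + (LINT x:{a<..<b}|lborel. \<bar>X n x\<bar>)) \<longlonglongrightarrow> 0" by simp
    show "\<forall>\<^sub>F n in sequentially. (LINT x:{a<..<b}|lborel. \<bar>u (r n) x - u0 x\<bar>)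
        \<le> (LINT t:{a<..<b}|lborel. \<bar>D n t\<bar>) + (LINT x:{a<..<b}|lborel. \<bar>X n x\<bar>)"
    proof (intro always_eventually allI)
      fix n
      note Xi = set_integrable_abs[OF set_integrable_bounded[OF Xm Xb, of a b]]
      note Di = set_integrable_abs[OF set_integrable_bounded[OF Dm Db, of a b]]
      have ui: "set_integrable lborel {a<..<b} (\<lambda>x. \<bar>u (r n) x - u0 x\<bar>)"
        using assms(7) by (intro set_integrable_abs set_integral_diff(1) u0i) auto
      have "(LINT x:{a<..<b}|lborel. \<bar>u (r n) x - u0 x\<bar>) \<le> (LINT t:{a<..<b}|lborel. \<bar>D n t\<bar> + \<bar>X n t\<bar>)"
      proof (rule set_integral_mono_AE[OF ui set_integral_add(1)[OF Di Xi]])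
        show "AE x\<in>{a<..<b} in lborel. \<bar>u (r n) x - u0 x\<bar> \<le> \<bar>D n x\<bar> + \<bar>X n x\<bar>"
          using uZ[of "r n"]
        proof eventually_elim
          case (elim x)
          show ?case
          proof
            assume "x \<in> {a<..<b}"
            with elim have "u (r n) x - u0 x = D n x + X n x" by (simp add: u0_def D_def X_def)
            then show "\<bar>u (r n) x - u0 x\<bar> \<le> \<bar>D n x\<bar> + \<bar>X n x\<bar>" by simp
          qed
        qed
      qed
      also have "\<dots> = (LINT t:{a<..<b}|lborel. \<bar>D n t\<bar>) + (LINT t:{a<..<b}|lborel. \<bar>X n t\<bar>)"
        by (rule set_integral_add(2)[OF Di Xi])
      finally show "(LINT x:{a<..<b}|lborel. \<bar>u (r n) x - u0 x\<bar>)
        \<le> (LINT t:{a<..<b}|lborel. \<bar>D n t\<bar>) + (LINT x:{a<..<b}|lborel. \<bar>X n x\<bar>)" .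
    qed
    show "\<forall>\<^sub>F n in sequentially. 0 \<le> (LINT x:{a<..<b}|lborel. \<bar>u (r n) x - u0 x\<bar>)"
      unfolding set_lebesgue_integral_def by (intro always_eventually allI integral_nonneg_AE) auto
  qed simp

  have uK: "Linf_bound a b K u0"
  proof (rule Linf_bound_L1_limit[OF _ u0i _ uL1])
    show "set_integrable lborel {a<..<b} (u (r n))" for n using assms(7) by blast
    show "Linf_bound a b K (u (r n))" for n
      using energy_leD assms(9) unfolding admissible_def by blast
  qed

  \<comment> \<open>The density \<open>w0\<close> is split by sign and its parts are added to
    \<open>F\<close> and \<open>G\<close>. The sums stay monotone and right continuous, so
    \<open>Du\<close> is again a pair of Stieltjes measures.\<close>
  define p0 where "p0 x = max 0 (w0 x)" for x
  define q0 where "q0 x = max 0 (- w0 x)" for x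
  have p0: "integrable lborel p0" unfolding p0_def
    by (rule Bochner_Integration.integrable_bound[OF w0(1)]) (use w0 in auto)
  have q0: "integrable lborel q0" unfolding q0_def
    by (rule Bochner_Integration.integrable_bound[OF w0(1)]) (use w0 in auto)
  have "w0 = (\<lambda>x. p0 x - q0 x)" by (auto simp: p0_def q0_def)
  then have pq: "prim w0 x = prim p0 x - prim q0 x" for x using prim_diff_fun[OF p0 q0] by metis
  have mono_rc: "mono (\<lambda>x. H x + prim h x)" "\<And>x. continuous (at_right x) (\<lambda>x. H x + prim h x)"
    if "mono H" "\<And>x. continuous (at_right x) H" "integrable lborel h" "\<And>x. 0 \<le> h x" for H h
  proof -
    show "mono (\<lambda>x. H x + prim h x)"
      using that(1) mono_prim[OF that(3,4)] by (auto simp: mono_def intro: add_mono)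
    show "continuous (at_right x) (\<lambda>x. H x + prim h x)" for x
      using that(2) isCont_prim[OF that(3)] continuous_within_subset
      by (intro continuous_add) blast+
  qed
  define Du where "Du = interval_smeasure a b (\<lambda>x. F x + prim p0 x) (\<lambda>x. G x + prim q0 x)"
  have Du: "BV_deriv a b u0 Du"
  proof (rule BV_derivI_cdf[where \<kappa>="u0 a"])
    note mp = mono_rc[OF F(1,2) p0] and mq = mono_rc[OF G(1,2) q0]
    have nn: "0 \<le> p0 x" "0 \<le> q0 x" for x by (auto simp: p0_def q0_def)
    note ism = interval_smeasure[OF ab mp(1)[OF nn(1)] mp(2)[OF nn(1)] mq(1)[OF nn(2)] mq(2)[OF nn(2)], folded Du_def]
    show "finite_smeasure a b Du" by (rule ism(1))
    show "sval Du {a<..t} = u0 t - u0 a" if "t \<in> {a<..<b}" for t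
      using ism(2)[OF that] by (simp add: u0_def pq)
  qed (rule u0i)
  have "prim w0 a = 0"
    unfolding prim_def set_lebesgue_integral_def using w0(3)
    by (intro integral_eq_zero_AE AE_I2) (auto simp: indicator_def)
  then have cdf: "sval \<gamma>0 {a<..t} = u0 t - prim w0 t - u0 a" if "t \<in> {a<..<b}" for t
    using \<gamma>0(2)[OF that] by (simp add: u0_def)
  have "BV a b u0" unfolding BV_def using u0i Du by blast
  moreover have "\<forall>q. 1 < q \<longrightarrow> conv_Wm1q a b q (\<gamma> \<circ> r) \<gamma>0"
    using conv_Wm1q_if_L1[OF \<gamma>r \<gamma>0(1) D Dm Db DL1] by blast
  moreover have "conv_flat a b (\<gamma> \<circ> r) \<gamma>0"
    by (rule conv_flat_if_L1[OF ab \<gamma>r \<gamma>0(1) D Dm Db DL1])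
  ultimately show ?thesis
    using uK \<gamma>0(1) r uL1 lebesgue_decomp_compare[OF ab \<gamma>0(1) u0i w0(1-3) cdf] by blast
qed

end
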